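(* Let $U$ and $V$ be $n$-manifolds such that $V$ is obtained from $U$ by attaching 2-handles at infinity, with associated embedding $i\colon U\hookrightarrow V$. Then there is a smooth, fixed-point free flow on $U\times\mathbb{R}$ whose quotient is $V$ and whose quotient map $U\times\mathbb{R}\to V$ is homotopy equivalent to the embedding $i\colon U\hookrightarrow V$.
   Context: Conventions: manifolds are metrizable, smooth, connected and without boundary; embeddings are smooth injective immersions and need not be proper; flows are smooth ($C^\infty$) and complete (defined for all time), i.e. smooth $\mathbb{R}$-actions generated by complete vector fields. $D^k\subset\mathbb{R}^k$ is the closed unit disk. Attaching handles at infinity: an $n$-manifold $V$ is obtained from an $n$-manifold $U$ by attaching a layer of handles at infinity if there are embeddings $i$ of $U$ into $V$ and $j$ of a (possibly infinite, countable) disjoint union of copies of $\mathbb{R}^k\times\mathbb{R}^{n-k}$ into $V$ ($k$ may vary from copy to copy), whose images cover $V$, such that $j^{-1}(i(U))$ is the union of all of the copies of $(\mathbb{R}^k-D^k)\times\mathbb{R}^{n-k}$. Each copy of $\mathbb{R}^k\times\mathbb{R}^{n-k}$ is an open $k$-handle. If all handles have the same index $k$, one says $V$ is obtained from $U$ by attaching $k$-handles at infinity. Quotient: the quotient (orbit space) of a flow is the space of orbits with the quotient topology. A fixed-point free flow on an $(n+1)$-manifold has quotient the $n$-manifold $V$ if its orbit space is a (metrizable) manifold with an induced smooth structure, making the quotient map a smooth submersion, with which it is diffeomorphic to $V$. Two maps $q\colon A\to B$ and $i\colon A'\to B'$ are homotopy equivalent if there are homotopy equivalences $a\colon A\to A'$,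 $b\colon B\to B'$ with $b\circ q$ homotopic to $i\circ a$. *)

theory Defs
  imports "HOL-Analysis.Analysis"
begin

section \<open>Smooth maps between open subsets of Euclidean spaces\<close>

text \<open>
  For open \<open>S\<close>: \<open>Ck_on k f S\<close> says that all iterated directional derivatives of \<open>f\<close> of order
  at most \<open>k\<close> exist and are continuous on \<open>S\<close>.  Taking directional instead of total derivatives
  in the recursion keeps the type of \<open>f\<close> fixed.  Both notions below are meant for open \<open>S\<close> only.
\<close>

primrec Ck_on :: "nat \<Rightarrow> ('e::euclidean_space \<Rightarrow> 'f::euclidean_space) \<Rightarrow> 'e set \<Rightarrow> bool" where
  "Ck_on 0 f S \<longleftrightarrow> continuous_on S f"
| "Ck_on (Suc k) f S \<longleftrightarrow>
     (\<forall>x\<in>S. f differentiable (at x)) \<and>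
     (\<forall>v. Ck_on k (\<lambda>x. frechet_derivative f (at x) v) S)"

definition smooth_on :: "'e set \<Rightarrow> ('e::euclidean_space \<Rightarrow> 'f::euclidean_space) \<Rightarrow> bool" where
  "smooth_on S f \<longleftrightarrow> (\<forall>k. Ck_on k f S)"


section \<open>Smooth manifolds\<close>

text \<open>
  A space with an atlas modelled on the Euclidean space \<open>'e\<close>, whose dimension is \<open>DIM('e)\<close>.
  A chart is a pair \<open>(D, c)\<close> of its domain and its coordinate map; the values of \<open>c\<close> outside of
  \<open>D\<close> are irrelevant.  Atlases need not be maximal, since the notions below depend only on the
  smooth structure which an atlas generates.
\<close>

record ('a, 'e) mfd =
  mtop :: "'a topology"
  atlas :: "('a set \<times> ('a \<Rightarrow> 'e)) set"

abbreviation points :: "('a, 'e) mfd \<Rightarrow> 'a set" where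
  "points M \<equiv> topspace (mtop M)"

definition chart_on :: "'a topology \<Rightarrow> 'a set \<Rightarrow> ('a \<Rightarrow> 'e::euclidean_space) \<Rightarrow> bool" where
  "chart_on X D c \<longleftrightarrow>
     openin X D \<and> open (c ` D) \<and>
     homeomorphic_map (subtopology X D) (top_of_set (c ` D)) c"

definition smooth_atlas :: "('a, 'e::euclidean_space) mfd \<Rightarrow> bool" where
  "smooth_atlas M \<longleftrightarrow>
     (\<forall>(D, c)\<in>atlas M. chart_on (mtop M) D c) \<and>
     (\<Union>(D, c)\<in>atlas M. D) = points M \<and>
     (\<forall>(D, c)\<in>atlas M. \<forall>(D', c')\<in>atlas M. smooth_on (c ` (D \<inter> D')) (c' \<circ> inv_into D c))"

definition smooth_manifold :: "('a, 'e::euclidean_space) mfd \<Rightarrow> bool" where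
  "smooth_manifold M \<longleftrightarrow>
     smooth_atlas M \<and> metrizable_space (mtop M) \<and> connected_space (mtop M)"

definition euclidean_mfd :: "('e::euclidean_space, 'e) mfd" where
  "euclidean_mfd = \<lparr>mtop = euclidean, atlas = {(UNIV, id)}\<rparr>"

definition prod_mfd :: "('a, 'e::euclidean_space) mfd \<Rightarrow> ('b, 'f::euclidean_space) mfd
    \<Rightarrow> ('a \<times> 'b, 'e \<times> 'f) mfd" (infixr "\<times>\<^sub>M" 80) where
  "M \<times>\<^sub>M N =
     \<lparr>mtop = prod_topology (mtop M) (mtop N),
      atlas = {(D \<times> D', map_prod c c') |D c D' c'. (D, c) \<in> atlas M \<and> (D', c') \<in> atlas N}\<rparr>"

abbreviation real_line :: "(real, real) mfd" where
  "real_line \<equiv> euclidean_mfd"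

text \<open>The disjoint union of copies of \<open>'e\<close> indexed by \<open>I\<close> (in general not connected).\<close>

definition copies_mfd :: "'i set \<Rightarrow> ('i \<times> 'e::euclidean_space, 'e) mfd" where
  "copies_mfd I =
     \<lparr>mtop = sum_topology (\<lambda>h. euclidean) I, atlas = {({h} \<times> UNIV, snd) |h. h \<in> I}\<rparr>"


section \<open>Smooth maps, embeddings, submersions, diffeomorphisms\<close>

definition smooth_map :: "('a, 'e::euclidean_space) mfd \<Rightarrow> ('b, 'f::euclidean_space) mfd
    \<Rightarrow> ('a \<Rightarrow> 'b) \<Rightarrow> bool" where
  "smooth_map M N f \<longleftrightarrow>
     continuous_map (mtop M) (mtop N) f \<and>
     (\<forall>(D, c)\<in>atlas M. \<forall>(D', c')\<in>atlas N.
        smooth_on (c ` (D \<inter> f -` D')) (c' \<circ> f \<circ> inv_into D c))"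

text \<open>
  The derivative of \<open>f\<close> at the point \<open>x\<close> in the coordinates given by the charts \<open>(D, c)\<close> and
  \<open>(D', c')\<close>, assuming \<open>x \<in> D\<close> and \<open>f x \<in> D'\<close>.
\<close>

definition chart_derivative :: "'a set \<Rightarrow> ('a \<Rightarrow> 'e::euclidean_space) \<Rightarrow>
    ('b \<Rightarrow> 'f::euclidean_space) \<Rightarrow> ('a \<Rightarrow> 'b) \<Rightarrow> 'a \<Rightarrow> 'e \<Rightarrow> 'f" where
  "chart_derivative D c c' f x = frechet_derivative (c' \<circ> f \<circ> inv_into D c) (at (c x))"

definition immersion :: "('a, 'e::euclidean_space) mfd \<Rightarrow> ('b, 'f::euclidean_space) mfd
    \<Rightarrow> ('a \<Rightarrow> 'b) \<Rightarrow> bool" where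
  "immersion M N f \<longleftrightarrow> smooth_map M N f \<and>
     (\<forall>(D, c)\<in>atlas M. \<forall>(D', c')\<in>atlas N. \<forall>x\<in>D. f x \<in> D' \<longrightarrow> inj (chart_derivative D c c' f x))"

definition submersion :: "('a, 'e::euclidean_space) mfd \<Rightarrow> ('b, 'f::euclidean_space) mfd
    \<Rightarrow> ('a \<Rightarrow> 'b) \<Rightarrow> bool" where
  "submersion M N f \<longleftrightarrow> smooth_map M N f \<and>
     (\<forall>(D, c)\<in>atlas M. \<forall>(D', c')\<in>atlas N. \<forall>x\<in>D. f x \<in> D' \<longrightarrow> surj (chart_derivative D c c' f x))"

text \<open>An embedding is an injective immersion; it need be neither proper nor a topological embedding.\<close>

definition smooth_embedding :: "('a, 'e::euclidean_space) mfd \<Rightarrow> ('b, 'f::euclidean_space) mfd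
    \<Rightarrow> ('a \<Rightarrow> 'b) \<Rightarrow> bool" where
  "smooth_embedding M N f \<longleftrightarrow> immersion M N f \<and> inj_on f (points M)"

definition diffeomorphism :: "('a, 'e::euclidean_space) mfd \<Rightarrow> ('b, 'f::euclidean_space) mfd
    \<Rightarrow> ('a \<Rightarrow> 'b) \<Rightarrow> bool" where
  "diffeomorphism M N f \<longleftrightarrow> smooth_map M N f \<and>
     (\<exists>g. smooth_map N M g \<and> (\<forall>x\<in>points M. g (f x) = x) \<and> (\<forall>y\<in>points N. f (g y) = y))"


section \<open>Attaching handles at infinity\<close>

text \<open>
  A set \<open>K\<close> of \<open>k\<close> coordinate directions splits \<open>'e\<close> as a product of a \<open>k\<close>-dimensional and an
  \<open>(n-k)\<close>-dimensional Euclidean space, so that \<open>'e\<close> becomes an open \<open>k\<close>-handle.  With this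
  splitting, \<open>handle_end K\<close> is the complement of the closed unit disk in the first factor, times
  the second factor.
\<close>

definition handle_end :: "'e::euclidean_space set \<Rightarrow> 'e set" where
  "handle_end K = {x. norm (\<Sum>b\<in>K. (x \<bullet> b) *\<^sub>R b) > 1}"

text \<open>
  \<open>V\<close> is obtained from \<open>U\<close> by attaching a layer of handles at infinity, with embeddings \<open>i\<close> and
  \<open>j\<close>.  The handles are indexed by \<open>I\<close>, which is possibly empty or infinite, and the handle \<open>h\<close>
  has the splitting given by \<open>K h\<close>, hence the index \<open>card (K h)\<close>.
\<close>

definition handle_layer :: "('a, 'e::euclidean_space) mfd \<Rightarrow> ('b, 'e) mfd \<Rightarrow> ('a \<Rightarrow> 'b) \<Rightarrow>
    nat set \<Rightarrow> (nat \<Rightarrow> 'e set) \<Rightarrow> (nat \<times> 'e \<Rightarrow> 'b) \<Rightarrow> bool" where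
  "handle_layer U V i I K j \<longleftrightarrow>
     (\<forall>h\<in>I. K h \<subseteq> Basis) \<and>
     smooth_embedding U V i \<and>
     smooth_embedding (copies_mfd I) V j \<and>
     i ` points U \<union> j ` (I \<times> UNIV) = points V \<and>
     {p \<in> I \<times> UNIV. j p \<in> i ` points U} = (SIGMA h:I. handle_end (K h))"

definition attaching_handles_at_infinity :: "nat \<Rightarrow> ('a, 'e::euclidean_space) mfd \<Rightarrow>
    ('b, 'e) mfd \<Rightarrow> ('a \<Rightarrow> 'b) \<Rightarrow> bool" where
  "attaching_handles_at_infinity k U V i \<longleftrightarrow>
     (\<exists>I K j. handle_layer U V i I K j \<and> (\<forall>h\<in>I. card (K h) = k))"


section \<open>Flows and their orbit spaces\<close>

definition smooth_flow :: "('a, 'e::euclidean_space) mfd \<Rightarrow> (real \<Rightarrow> 'a \<Rightarrow> 'a) \<Rightarrow> bool" where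
  "smooth_flow M \<phi> \<longleftrightarrow>
     smooth_map (real_line \<times>\<^sub>M M) M (\<lambda>(t, x). \<phi> t x) \<and>
     (\<forall>x\<in>points M. \<phi> 0 x = x) \<and>
     (\<forall>x\<in>points M. \<forall>s t. \<phi> (s + t) x = \<phi> s (\<phi> t x))"

definition fixed_point_free :: "('a, 'e::euclidean_space) mfd \<Rightarrow> (real \<Rightarrow> 'a \<Rightarrow> 'a) \<Rightarrow> bool" where
  "fixed_point_free M \<phi> \<longleftrightarrow> \<not> (\<exists>x\<in>points M. \<forall>t. \<phi> t x = x)"

definition orbit :: "(real \<Rightarrow> 'a \<Rightarrow> 'a) \<Rightarrow> 'a \<Rightarrow> 'a set" where
  "orbit \<phi> x = range (\<lambda>t. \<phi> t x)"

definition orbit_space :: "'a topology \<Rightarrow> (real \<Rightarrow> 'a \<Rightarrow> 'a) \<Rightarrow> 'a set topology" where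
  "orbit_space X \<phi> =
     topology (\<lambda>W. W \<subseteq> orbit \<phi> ` topspace X \<and> openin X {x \<in> topspace X. orbit \<phi> x \<in> W})"

lemma openin_orbit_space:
  "openin (orbit_space X \<phi>) W \<longleftrightarrow>
     W \<subseteq> orbit \<phi> ` topspace X \<and> openin X {x \<in> topspace X. orbit \<phi> x \<in> W}"
proof -
  have 1: "{x \<in> topspace X. orbit \<phi> x \<in> S \<inter> T} =
      {x \<in> topspace X. orbit \<phi> x \<in> S} \<inter> {x \<in> topspace X. orbit \<phi> x \<in> T}" for S T
    by auto
  have 2: "{x \<in> topspace X. orbit \<phi> x \<in> \<Union>\<K>} =
      (\<Union>K\<in>\<K>. {x \<in> topspace X. orbit \<phi> x \<in> K})" for \<K>
    by auto
  have "istopology (\<lambda>W. W \<subseteq> orbit \<phi> ` topspace X \<and> openin X {x \<in> topspace X. orbit \<phi> x \<in> W})"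
    unfolding istopology_def 1 2 by blast
  then show ?thesis
    by (simp add: orbit_space_def)
qed

lemma topspace_orbit_space [simp]: "topspace (orbit_space X \<phi>) = orbit \<phi> ` topspace X"
proof
  have "{x \<in> topspace X. orbit \<phi> x \<in> orbit \<phi> ` topspace X} = topspace X"
    by auto
  then have "openin (orbit_space X \<phi>) (orbit \<phi> ` topspace X)"
    by (simp add: openin_orbit_space)
  then show "orbit \<phi> ` topspace X \<subseteq> topspace (orbit_space X \<phi>)"
    by (rule openin_subset)
qed (metis openin_orbit_space openin_topspace)

lemma quotient_map_orbit_space: "quotient_map X (orbit_space X \<phi>) (orbit \<phi>)"
  by (simp add: quotient_map_def openin_orbit_space)

text \<open>
  The flow \<open>\<phi>\<close> on \<open>M\<close> has quotient \<open>V\<close>, and \<open>q\<close> is its quotient map after identifying the orbit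
  space (with its induced smooth structure) with \<open>V\<close> by a diffeomorphism \<open>d\<close>.
\<close>

definition has_quotient :: "('a, 'e::euclidean_space) mfd \<Rightarrow> (real \<Rightarrow> 'a \<Rightarrow> 'a) \<Rightarrow>
    ('b, 'f::euclidean_space) mfd \<Rightarrow> ('a \<Rightarrow> 'b) \<Rightarrow> bool" where
  "has_quotient M \<phi> V q \<longleftrightarrow>
     (\<exists>(Q :: ('a set, 'f) mfd) d.
        mtop Q = orbit_space (mtop M) \<phi> \<and> smooth_manifold Q \<and>
        submersion M Q (orbit \<phi>) \<and>
        diffeomorphism Q V d \<and> q = d \<circ> orbit \<phi>)"


section \<open>Homotopy equivalence of maps\<close>

definition homotopy_equivalence_map :: "'a topology \<Rightarrow> 'b topology \<Rightarrow> ('a \<Rightarrow> 'b) \<Rightarrow> bool" where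
  "homotopy_equivalence_map X Y f \<longleftrightarrow> continuous_map X Y f \<and>
     (\<exists>g. continuous_map Y X g \<and>
          homotopic_with (\<lambda>x. True) X X (g \<circ> f) id \<and>
          homotopic_with (\<lambda>x. True) Y Y (f \<circ> g) id)"

definition homotopy_equivalent_maps :: "'a topology \<Rightarrow> 'b topology \<Rightarrow> ('a \<Rightarrow> 'b) \<Rightarrow>
    'c topology \<Rightarrow> 'd topology \<Rightarrow> ('c \<Rightarrow> 'd) \<Rightarrow> bool" where
  "homotopy_equivalent_maps A B q A' B' i \<longleftrightarrow>
     (\<exists>a b. homotopy_equivalence_map A A' a \<and> homotopy_equivalence_map B B' b \<and>
            homotopic_with (\<lambda>x. True) A B' (b \<circ> q) (i \<circ> a))"

end

theory Submission
  imports Defs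
begin

text \<open>
  Every orbit of the flow is a line or a circle.  Over a disk in the plane, the fibres of the flow
  form the trivial circle bundle with a section over the complement of the open unit disk removed:
  the orbits over the open unit disk are circles, those over its complement are circles punctured at
  one point.  If the section has winding number 1 along the unit circle, then the total space is
  diffeomorphic to an annulus times the line, compatibly with the projection over the
  outer part of the annulus: dividing by the diagonal rotations of the disk and the circle, it becomes the plane slit along
  \<open>[1, \<infinity>)\<close>, which is a half plane.  Taking the product with the remaining coordinates of
  the handle yields a flow on the part of \<open>U \<times> \<real>\<close> at the end of a 2-handle, which near its
  boundary is the translation in the \<open>\<real>\<close>-direction, and whose quotient is the handle.  These
  flows fit together with the translation on the rest of \<open>U \<times> \<real>\<close>, once the handles have been
  thinned such that the union of the slightly enlarged handle cores is closed.  On the circle over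
  \<open>Q\<close> the flow consists of Moebius transformations, parabolic for \<open>\<bar>Q\<bar> \<ge> 1\<close> and elliptic
  otherwise, hence it is explicit and no differential equation has to be solved.  Deforming
  the quotient map of the model linearly into the projection shows that it is homotopic to \<open>i\<close>
  composed with the projection.
\<close>

section \<open>Calculus of smooth functions\<close>

text \<open>Neither embedding need be proper: infinitely many handles, or the unbounded part of a
  single one, may accumulate at points of \<open>U\<close>, and a flow altered on all of the handles
  could fail to be smooth there. The alteration is therefore confined to planar radius below 2, and
  a reparametrisation of the handles draws this region towards the complement of \<open>U\<close>,
  at a rate depending on the handle and on the distance along its remaining coordinates. Index 2
  enters through a coincidence of dimensions: the point to be removed from the circle over
  \<open>Q\<close> is \<open>Q / cmod Q\<close>, which is possible because the unit sphere of the
  planar factor is a circle, like the line completed by one point. What is required of the quotient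
  is drawn from smooth local sections through all points. They make the candidate map open, so that
  the orbit space has the topology of \<open>V\<close> and inherits its metrizability, and they make
  the derivative surjective.\<close>

lemma has_derivative_cong_open:
  assumes "open S" "x \<in> S" "\<And>y. y \<in> S \<Longrightarrow> f y = g y"
  shows "(f has_derivative D) (at x) \<longleftrightarrow> (g has_derivative D) (at x)"
  using has_derivative_transform_within_open[of f D x UNIV S g]
    has_derivative_transform_within_open[of g D x UNIV S f] assms by auto

lemma frechet_derivative_cong_open:
  assumes "open S" "x \<in> S" "\<And>y. y \<in> S \<Longrightarrow> f y = g y"
  shows "frechet_derivative f (at x) = frechet_derivative g (at x)"
  unfolding frechet_derivative_def using has_derivative_cong_open[OF assms] by simp

lemma Ck_on_cong_imp:
  assumes "open S" "\<And>x. x \<in> S \<Longrightarrow> f x = g x" "Ck_on k f S"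
  shows "Ck_on k g S"
  using assms(2,3)
proof (induction k arbitrary: f g)
  case 0
  show ?case unfolding Ck_on.simps using 0 by (intro continuous_on_eq[of S f g]) auto
next
  case (Suc k)
  have "g differentiable (at x)" if "x \<in> S" for x
  proof -
    have "f differentiable (at x) \<longleftrightarrow> g differentiable (at x)"
      unfolding differentiable_def
      using has_derivative_cong_open[of S x f g, OF assms(1) that Suc.prems(1)] by simp
    then show ?thesis using Suc.prems(2) that by simp
  qed
  moreover have "Ck_on k (\<lambda>x. frechet_derivative g (at x) v) S" for v
  proof (rule Suc.IH)
    show "Ck_on k (\<lambda>x. frechet_derivative f (at x) v) S"
      using Suc.prems(2) by simp
    show "frechet_derivative f (at x) v = frechet_derivative g (at x) v" if "x \<in> S" for x
      using frechet_derivative_cong_open[of S x f g, OF assms(1) that Suc.prems(1)] by simp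
  qed
  ultimately show ?case by simp
qed

lemma Ck_on_subset: "Ck_on k f T \<Longrightarrow> S \<subseteq> T \<Longrightarrow> Ck_on k f S"
  by (induction k arbitrary: f) (auto intro: continuous_on_subset)

lemma Ck_on_SucI:
  assumes "open S" "\<And>x. x \<in> S \<Longrightarrow> (f has_derivative f' x) (at x)" "\<And>v. Ck_on k (\<lambda>x. f' x v) S"
  shows "Ck_on (Suc k) f S"
proof -
  have "frechet_derivative f (at x) = f' x" if "x \<in> S" for x
    using frechet_derivative_at[OF assms(2)[OF that]] by simp
  then have "Ck_on k (\<lambda>x. frechet_derivative f (at x) v) S" for v
    using Ck_on_cong_imp[OF assms(1) _ assms(3), of v "\<lambda>x. frechet_derivative f (at x) v"] by simp
  then show ?thesis
    using assms(2) by (auto simp: differentiable_def)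
qed

lemma Ck_on_has_derivative:
  "Ck_on (Suc k) f S \<Longrightarrow> x \<in> S \<Longrightarrow> (f has_derivative frechet_derivative f (at x)) (at x)"
  by (simp add: frechet_derivative_works[symmetric])

lemma Ck_on_SucD: "Ck_on (Suc k) f S \<Longrightarrow> Ck_on k f S"
proof (induction k arbitrary: f)
  case 0
  then show ?case
    by (auto intro!: continuous_at_imp_continuous_on differentiable_imp_continuous_within)
next
  case (Suc k)
  have "Ck_on k (\<lambda>x. frechet_derivative f (at x) v) S" for v
    using Suc.prems by (intro Suc.IH) simp
  then show ?case using Suc.prems by simp
qed

lemma Ck_on_local:
  assumes "\<And>x. x \<in> S \<Longrightarrow> \<exists>T. open T \<and> x \<in> T \<and> Ck_on k f T"
  shows "Ck_on k f S"
  using assms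
proof (induction k arbitrary: f)
  case 0
  have "isCont f x" if "x \<in> S" for x
    using 0[OF that] by (auto simp: continuous_on_eq_continuous_at)
  then show ?case by (simp add: continuous_at_imp_continuous_on)
next
  case (Suc k)
  then show ?case by (fastforce intro!: Suc.IH)
qed

lemma Ck_on_const: "open S \<Longrightarrow> Ck_on k (\<lambda>x. c) S"
proof (induction k arbitrary: c)
  case (Suc k)
  show ?case by (rule Ck_on_SucI[where f' = "\<lambda>x v. 0"]) (use Suc in auto)
qed simp

lemma Ck_on_bounded_linear:
  assumes "open S" "bounded_linear f" shows "Ck_on k f S"
proof (cases k)
  case 0
  then show ?thesis using assms by (simp add: linear_continuous_on)
next
  case (Suc l)
  show ?thesis unfolding Suc
    by (rule Ck_on_SucI[where f' = "\<lambda>x. f"])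
       (use assms Ck_on_const bounded_linear_imp_has_derivative in auto)
qed

lemma Ck_on_add:
  assumes "open S" "Ck_on k f S" "Ck_on k g S" shows "Ck_on k (\<lambda>x. f x + g x) S"
  using assms(2,3)
proof (induction k arbitrary: f g)
  case 0 then show ?case by (auto intro: continuous_intros)
next
  case (Suc k)
  show ?case
  proof (rule Ck_on_SucI[OF assms(1)])
    show "((\<lambda>x. f x + g x) has_derivative
        (\<lambda>v. frechet_derivative f (at x) v + frechet_derivative g (at x) v)) (at x)" if "x \<in> S" for x
      using Suc.prems[THEN Ck_on_has_derivative, OF that] by (rule has_derivative_add)
    show "Ck_on k (\<lambda>x. frechet_derivative f (at x) v + frechet_derivative g (at x) v) S" for v
      using Suc.prems by (intro Suc.IH) auto
  qed
qed

lemma Ck_on_bilinear: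
  assumes "bounded_bilinear bop" "open S" "Ck_on k f S" "Ck_on k g S"
  shows "Ck_on k (\<lambda>x. bop (f x) (g x)) S"
  using assms(3,4)
proof (induction k arbitrary: f g)
  case 0 then show ?case by (auto intro: bounded_bilinear.continuous_on[OF assms(1)])
next
  case (Suc k)
  show ?case
  proof (rule Ck_on_SucI[OF assms(2)])
    show "((\<lambda>x. bop (f x) (g x)) has_derivative
        (\<lambda>v. bop (f x) (frechet_derivative g (at x) v) + bop (frechet_derivative f (at x) v) (g x))) (at x)"
      if "x \<in> S" for x
      using Suc.prems[THEN Ck_on_has_derivative, OF that] by (rule bounded_bilinear.FDERIV[OF assms(1)])
    show "Ck_on k (\<lambda>x. bop (f x) (frechet_derivative g (at x) v) + bop (frechet_derivative f (at x) v) (g x)) S" for v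
      using Suc.prems by (intro Ck_on_add assms(2) Suc.IH) (auto dest: Ck_on_SucD simp del: Ck_on.simps(2), auto)
  qed
qed

lemma Ck_on_sum:
  assumes "open S" "\<And>b. b \<in> B \<Longrightarrow> Ck_on k (f b) S" shows "Ck_on k (\<lambda>x. \<Sum>b\<in>B. f b x) S"
  using assms(2)
  by (induction B rule: infinite_finite_induct) (auto intro: Ck_on_const Ck_on_add assms(1))

lemma linear_eq_sum_Basis:
  fixes L :: "'e::euclidean_space \<Rightarrow> 'f::real_vector"
  assumes "linear L" shows "L x = (\<Sum>b\<in>Basis. (x \<bullet> b) *\<^sub>R L b)"
proof -
  have "L x = L (\<Sum>b\<in>Basis. (x \<bullet> b) *\<^sub>R b)" by (simp add: euclidean_representation)
  also have "\<dots> = (\<Sum>b\<in>Basis. (x \<bullet> b) *\<^sub>R L b)"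
    using assms by (simp add: linear_sum linear_cmul)
  finally show ?thesis .
qed

text \<open>The direction in which \<open>g\<close> is differentiated varies with \<open>x\<close>,
  whereas \<open>Ck_on\<close> speaks of constant directions only. Expanding the chain rule in the
  basis leaves sums of products of derivatives in constant directions, to which the induction
  hypothesis applies.\<close>

lemma Ck_on_compose:
  assumes "open S" "open T" "f ` S \<subseteq> T" "Ck_on k f S" "Ck_on k g T"
  shows "Ck_on k (\<lambda>x. g (f x)) S"
  using assms(4,5)
proof (induction k arbitrary: g)
  case 0
  then show ?case
    using continuous_on_compose2[of T g S f] assms(3) by simp
next
  case (Suc k)
  define D where "D x v = (\<Sum>b\<in>Basis. (frechet_derivative f (at x) v \<bullet> b) *\<^sub>R
      frechet_derivative g (at (f x)) b)" for x v
  show ?case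
  proof (rule Ck_on_SucI[OF assms(1)])
    fix x assume x: "x \<in> S"
    have f: "(f has_derivative frechet_derivative f (at x)) (at x)"
      using Suc.prems(1) x by (rule Ck_on_has_derivative)
    have g: "(g has_derivative frechet_derivative g (at (f x))) (at (f x))"
      using Suc.prems(2) x assms(3) by (intro Ck_on_has_derivative[of k g T]) auto
    have "D x = (\<lambda>v. frechet_derivative g (at (f x)) (frechet_derivative f (at x) v))"
      using linear_eq_sum_Basis[OF bounded_linear.linear[OF has_derivative_bounded_linear[OF g]]]
      unfolding D_def by metis
    then show "((\<lambda>x. g (f x)) has_derivative D x) (at x)"
      using has_derivative_compose[OF f g] by simp
  next
    fix v
    have *: "Ck_on k (\<lambda>x. frechet_derivative g (at (f x)) b) S" for b
      using Suc.IH[OF Ck_on_SucD[OF Suc.prems(1)], of "\<lambda>y. frechet_derivative g (at y) b"] Suc.prems(2)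
      by simp
    have "Ck_on k (\<lambda>x. frechet_derivative f (at x) v \<bullet> b) S" for b
      using Suc.prems(1)
      by (intro Ck_on_bilinear[OF bounded_bilinear_inner assms(1)] Ck_on_const[OF assms(1)]) simp
    then show "Ck_on k (\<lambda>x. D x v) S"
      unfolding D_def
      by (intro Ck_on_sum assms(1) Ck_on_bilinear[OF bounded_bilinear_scaleR] *)
  qed
qed

named_theorems smooth_intros

lemma smooth_on_cong: "open S \<Longrightarrow> (\<And>x. x \<in> S \<Longrightarrow> f x = g x) \<Longrightarrow> smooth_on S f \<Longrightarrow> smooth_on S g"
  unfolding smooth_on_def using Ck_on_cong_imp by metis

lemma smooth_on_subset: "smooth_on T f \<Longrightarrow> S \<subseteq> T \<Longrightarrow> smooth_on S f"
  unfolding smooth_on_def using Ck_on_subset by blast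

lemma smooth_on_local:
  "(\<And>x. x \<in> S \<Longrightarrow> \<exists>T. open T \<and> x \<in> T \<and> smooth_on T f) \<Longrightarrow> smooth_on S f"
  unfolding smooth_on_def using Ck_on_local by metis

lemma smooth_on_imp_continuous_on: "smooth_on S f \<Longrightarrow> continuous_on S f"
  unfolding smooth_on_def using Ck_on.simps(1) by blast

lemma smooth_on_has_derivative:
  "smooth_on S f \<Longrightarrow> x \<in> S \<Longrightarrow> (f has_derivative frechet_derivative f (at x)) (at x)"
  unfolding smooth_on_def using Ck_on_has_derivative[of 0] by blast

lemma smooth_on_const [smooth_intros]: "open S \<Longrightarrow> smooth_on S (\<lambda>x. c)"
  by (simp add: smooth_on_def Ck_on_const)

lemma smooth_on_bounded_linear: "bounded_linear f \<Longrightarrow> open S \<Longrightarrow> smooth_on S f"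
  by (simp add: smooth_on_def Ck_on_bounded_linear)

lemma smooth_on_compose:
  "smooth_on T g \<Longrightarrow> smooth_on S f \<Longrightarrow> open S \<Longrightarrow> open T \<Longrightarrow> f ` S \<subseteq> T \<Longrightarrow> smooth_on S (\<lambda>x. g (f x))"
  by (simp add: smooth_on_def Ck_on_compose)

lemma smooth_on_compose_linear:
  "bounded_linear g \<Longrightarrow> smooth_on S f \<Longrightarrow> open S \<Longrightarrow> smooth_on S (\<lambda>x. g (f x))"
  by (rule smooth_on_compose[of UNIV]) (auto intro: smooth_on_bounded_linear)

lemma smooth_on_add [smooth_intros]:
  "smooth_on S f \<Longrightarrow> smooth_on S g \<Longrightarrow> open S \<Longrightarrow> smooth_on S (\<lambda>x. f x + g x)"
  by (simp add: smooth_on_def Ck_on_add)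

lemma smooth_on_bilinear:
  "bounded_bilinear bop \<Longrightarrow> smooth_on S f \<Longrightarrow> smooth_on S g \<Longrightarrow> open S \<Longrightarrow> smooth_on S (\<lambda>x. bop (f x) (g x))"
  by (simp add: smooth_on_def Ck_on_bilinear)

lemmas smooth_on_scaleR [smooth_intros] = smooth_on_bilinear[OF bounded_bilinear_scaleR]
lemmas smooth_on_mult [smooth_intros] = smooth_on_bilinear[OF bounded_bilinear_mult]
lemmas smooth_on_inner [smooth_intros] = smooth_on_bilinear[OF bounded_bilinear_inner]

lemma smooth_on_id [smooth_intros]: "open S \<Longrightarrow> smooth_on S (\<lambda>x. x)"
  by (rule smooth_on_bounded_linear[OF bounded_linear_ident])

lemmas smooth_on_fst [smooth_intros] = smooth_on_compose_linear[OF bounded_linear_fst]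
lemmas smooth_on_snd [smooth_intros] = smooth_on_compose_linear[OF bounded_linear_snd]
lemmas smooth_on_Re [smooth_intros] = smooth_on_compose_linear[OF bounded_linear_Re]
lemmas smooth_on_Im [smooth_intros] = smooth_on_compose_linear[OF bounded_linear_Im]
lemmas smooth_on_cnj [smooth_intros] = smooth_on_compose_linear[OF bounded_linear_cnj]
lemmas smooth_on_of_real [smooth_intros] = smooth_on_compose_linear[OF bounded_linear_of_real]
lemmas smooth_on_minus [smooth_intros] =
  smooth_on_compose_linear[OF bounded_linear_minus[OF bounded_linear_ident]]

lemma smooth_on_diff [smooth_intros]:
  "smooth_on S f \<Longrightarrow> smooth_on S g \<Longrightarrow> open S \<Longrightarrow> smooth_on S (\<lambda>x. f x - g x)"
  using smooth_on_add[of S f "\<lambda>x. - g x"] smooth_on_minus[of S g] by simp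

lemma smooth_on_sum [smooth_intros]:
  "(\<And>b. b \<in> B \<Longrightarrow> smooth_on S (f b)) \<Longrightarrow> open S \<Longrightarrow> smooth_on S (\<lambda>x. \<Sum>b\<in>B. f b x)"
  by (simp add: smooth_on_def Ck_on_sum)

lemma smooth_on_power [smooth_intros]:
  fixes f :: "_ \<Rightarrow> 'f::{euclidean_space, real_normed_algebra_1}"
  shows "smooth_on S f \<Longrightarrow> open S \<Longrightarrow> smooth_on S (\<lambda>x. f x ^ n)"
  by (induction n) (auto intro: smooth_intros)

lemma smooth_on_Pair [smooth_intros]:
  assumes "smooth_on S f" "smooth_on S g" "open S" shows "smooth_on S (\<lambda>x. (f x, g x))"
proof -
  have "smooth_on S (\<lambda>x. (f x, 0) + (0, g x))"
    using assms by (intro smooth_on_add smooth_on_compose_linear[of "\<lambda>y. (y, 0)"]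
      smooth_on_compose_linear[of "\<lambda>y. (0, y)"] bounded_linear_Pair bounded_linear_zero bounded_linear_ident) auto
  then show ?thesis by simp
qed

lemma smooth_on_Complex [smooth_intros]:
  assumes "smooth_on S f" "smooth_on S g" "open S" shows "smooth_on S (\<lambda>x. Complex (f x) (g x))"
proof -
  have "smooth_on S (\<lambda>x. of_real (f x) + \<i> * of_real (g x))"
    using assms by (intro smooth_intros)
  then show ?thesis by (simp add: Complex_eq)
qed

section \<open>Elementary functions\<close>

lemma smooth_on_derivative_family:
  fixes F :: "nat \<Rightarrow> real \<Rightarrow> real"
  assumes "open S" "\<And>n x. x \<in> S \<Longrightarrow> (F n has_real_derivative F (Suc n) x) (at x)"
  shows "smooth_on S (F n)"
proof -
  have "Ck_on k (F n) S" for k n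
  proof (induction k arbitrary: n)
    case 0
    show ?case using assms(2) by (auto intro!: continuous_at_imp_continuous_on DERIV_isCont)
  next
    case (Suc k)
    show ?case
    proof (rule Ck_on_SucI[OF assms(1)])
      show "(F n has_derivative (\<lambda>v. F (Suc n) x * v)) (at x)" if "x \<in> S" for x
        using assms(2)[OF that] unfolding has_field_derivative_def by simp
      show "Ck_on k (\<lambda>x. F (Suc n) x * v) S" for v
        using Ck_on_bilinear[OF bounded_bilinear_mult assms(1) Suc.IH Ck_on_const[OF assms(1)]] .
    qed
  qed
  then show ?thesis by (simp add: smooth_on_def)
qed

text \<open>The derivative is a polynomial in the inverse itself, so each order of smoothness yields
  the next.\<close>

lemma smooth_on_real_inverse: "smooth_on (-{0}) (inverse :: real \<Rightarrow> real)"
proof -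
  have "Ck_on k (inverse :: real \<Rightarrow> real) (-{0})" for k
  proof (induction k)
    case 0
    show ?case by (auto intro!: continuous_intros)
  next
    case (Suc k)
    show ?case
    proof (rule Ck_on_SucI)
      show "((inverse :: real \<Rightarrow> real) has_derivative (\<lambda>v. - (inverse x * v * inverse x))) (at x)"
        if "x \<in> -{0}" for x
        using that by (auto intro!: has_derivative_inverse')
      show "Ck_on k (\<lambda>x::real. - (inverse x * v * inverse x)) (-{0})" for v
        using Ck_on_bilinear[OF bounded_bilinear_mult _ Suc.IH
            Ck_on_bilinear[OF bounded_bilinear_mult _ Suc.IH Ck_on_const[of _ _ "-v"]]]
        by (simp add: mult_ac open_Compl)
    qed auto
  qed
  then show ?thesis by (simp add: smooth_on_def)
qed

lemma smooth_on_inverse [smooth_intros]: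
  fixes f :: "_ \<Rightarrow> real"
  assumes "smooth_on S f" "\<And>x. x \<in> S \<Longrightarrow> f x \<noteq> 0" "open S"
  shows "smooth_on S (\<lambda>x. inverse (f x))"
  using assms by (intro smooth_on_compose[OF smooth_on_real_inverse]) auto

lemma smooth_on_divide [smooth_intros]:
  fixes f :: "_ \<Rightarrow> real"
  assumes "smooth_on S f" "smooth_on S g" "\<And>x. x \<in> S \<Longrightarrow> g x \<noteq> 0" "open S"
  shows "smooth_on S (\<lambda>x. f x / g x)"
  using smooth_on_mult[OF assms(1) smooth_on_inverse[OF assms(2,3,4)] assms(4)]
  by (simp add: divide_inverse)

lemma smooth_on_complex_divide [smooth_intros]:
  fixes f :: "_ \<Rightarrow> complex"
  assumes "smooth_on S f" "smooth_on S g" "\<And>x. x \<in> S \<Longrightarrow> g x \<noteq> 0" "open S"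
  shows "smooth_on S (\<lambda>x. f x / g x)"
proof -
  have "smooth_on S (\<lambda>x. f x * cnj (g x) * of_real (inverse ((Re (g x))\<^sup>2 + (Im (g x))\<^sup>2)))"
    using assms by (intro smooth_intros) (simp_all add: complex_eq_iff sum_power2_eq_zero_iff)
  moreover have "f x * cnj (g x) * of_real (inverse ((Re (g x))\<^sup>2 + (Im (g x))\<^sup>2)) = f x / g x" for x
    using complex_div_cnj[of "f x" "g x"] by (simp only: cmod_power2 divide_inverse of_real_inverse)
  ultimately show ?thesis by (simp only:)
qed

lemma smooth_on_sqrt [smooth_intros]:
  assumes "smooth_on S f" "\<And>x. x \<in> S \<Longrightarrow> f x > 0" "open S"
  shows "smooth_on S (\<lambda>x. sqrt (f x))"
proof -
  have "Ck_on k sqrt {0<..}" for k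
  proof (induction k)
    case 0
    show ?case by (auto intro!: continuous_intros)
  next
    case (Suc k)
    have *: "smooth_on {0<..} (\<lambda>x::real. inverse x * (1/2) * v)" for v
      by (intro smooth_intros) auto
    show ?case
    proof (rule Ck_on_SucI)
      \<comment> \<open>Written as a multiple of \<open>sqrt x\<close>, the derivative falls under
        the induction hypothesis.\<close>
      show "(sqrt has_derivative (\<lambda>v. sqrt x * (inverse x * (1/2) * v))) (at x)"
        if "x \<in> {0<..}" for x
      proof -
        have "(sqrt has_real_derivative inverse (sqrt x) / 2) (at x)"
          using that by (intro DERIV_real_sqrt) auto
        moreover have "inverse (sqrt x) = sqrt x * inverse x"
          using that by (simp add: field_simps flip: power2_eq_square)
        moreover have "(\<lambda>v. sqrt x * (inverse x * (1/2) * v)) = (*) (sqrt x * inverse x / 2)"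
          by (rule ext) (simp add: mult.assoc)
        ultimately show ?thesis
          by (simp only: has_field_derivative_def)
      qed
      show "Ck_on k (\<lambda>x::real. sqrt x * (inverse x * (1/2) * v)) {0<..}" for v
        by (rule Ck_on_bilinear[OF bounded_bilinear_mult _ Suc.IH])
           (use *[unfolded smooth_on_def] in auto)
    qed auto
  qed
  then have "smooth_on {0<..} sqrt" by (simp add: smooth_on_def)
  then show ?thesis using assms smooth_on_compose[of "{0<..}" sqrt S f] by auto
qed

lemma smooth_on_norm [smooth_intros]:
  assumes "smooth_on S f" "\<And>x. x \<in> S \<Longrightarrow> f x \<noteq> 0" "open S"
  shows "smooth_on S (\<lambda>x. norm (f x))"
  unfolding norm_eq_sqrt_inner using assms by (intro smooth_intros) auto

lemma smooth_on_cos [smooth_intros]: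
  fixes f :: "_ \<Rightarrow> real"
  assumes "smooth_on S f" "open S" shows "smooth_on S (\<lambda>x. cos (f x))"
proof -
  \<comment> \<open>Differentiation is a shift by a quarter turn, so the derivatives form a family
    of one shape.\<close>
  define F where "F n x = cos (x + real n * (pi / 2))" for n x
  have "(F n has_real_derivative F (Suc n) x) (at x)" for n x
    unfolding F_def
  proof -
    have "x + real (Suc n) * (pi / 2) = x + real n * (pi / 2) + pi / 2" by (simp add: algebra_simps)
    then have "cos (x + real (Suc n) * (pi / 2)) = - sin (x + real n * (pi / 2))"
      by (simp only: cos_add cos_pi_half sin_pi_half)
    then show "((\<lambda>x. cos (x + real n * (pi / 2))) has_real_derivative cos (x + real (Suc n) * (pi / 2))) (at x)"
      by (auto intro!: derivative_eq_intros)
  qed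
  then have "smooth_on UNIV (F 0)" by (intro smooth_on_derivative_family) auto
  then have "smooth_on UNIV (cos :: real \<Rightarrow> real)" by (simp add: F_def[abs_def])
  then show ?thesis using assms smooth_on_compose[of UNIV cos S f] by simp
qed

section \<open>Smoothness of inverse functions\<close>

lemma Ck_on_inverse_family:
  fixes A B :: "'y::euclidean_space \<Rightarrow> 'e::euclidean_space \<Rightarrow> 'e"
  assumes S: "open S"
    and linA: "\<And>y. y \<in> S \<Longrightarrow> linear (A y)" and linB: "\<And>y. y \<in> S \<Longrightarrow> linear (B y)"
    and AB: "\<And>y v. y \<in> S \<Longrightarrow> A y (B y v) = v" and BA: "\<And>y v. y \<in> S \<Longrightarrow> B y (A y v) = v"
    and A: "\<And>w. Ck_on k (\<lambda>y. A y w) S"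
  shows "Ck_on k (\<lambda>y. B y v) S"
proof -
  \<comment> \<open>Joined to one bijection of \<open>S \<times> UNIV\<close>, the linear maps have
    continuous inverses by invariance of domain, and differentiable ones by the inverse function
    theorem; no determinants are involved.\<close>
  define F where "F p = (fst p, A (fst p) (snd p))" for p
  define F' where "F' p = (fst p, B (fst p) (snd p))" for p
  have F'F: "F' (F p) = p" if "p \<in> S \<times> UNIV" for p
    using that BA by (auto simp: F_def F'_def)
  have A_eq: "A y x = (\<Sum>b\<in>Basis. (x \<bullet> b) *\<^sub>R A y b)" if "y \<in> S" for y x
    using linear_eq_sum_Basis[OF linA[OF that]] .
  have img: "F ` (S \<times> UNIV) = S \<times> UNIV"
  proof -
    have "(y, v) \<in> F ` (S \<times> UNIV)" if "y \<in> S" for y v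
      using AB[OF that] that by (intro image_eqI[of _ F "(y, B y v)"]) (auto simp: F_def)
    moreover have "F ` (S \<times> UNIV) \<subseteq> S \<times> UNIV" by (auto simp: F_def)
    ultimately show ?thesis by auto
  qed
  have contF: "continuous_on (S \<times> UNIV) F" if "\<And>w. continuous_on S (\<lambda>y. A y w)"
  proof -
    have *: "continuous_on (S \<times> UNIV) (\<lambda>p. A (fst p) b)" for b
      using that by (rule continuous_on_compose2) (auto intro: continuous_intros)
    have "continuous_on (S \<times> UNIV) (\<lambda>p. (fst p, \<Sum>b\<in>Basis. (snd p \<bullet> b) *\<^sub>R A (fst p) b))"
      by (intro continuous_intros *)
    moreover have "F p = (fst p, \<Sum>b\<in>Basis. (snd p \<bullet> b) *\<^sub>R A (fst p) b)" if "p \<in> S \<times> UNIV" for p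
      using A_eq that by (auto simp: F_def)
    ultimately show ?thesis by (metis (mono_tags, lifting) continuous_on_eq)
  qed
  show ?thesis using A
  proof (induction k arbitrary: v)
    case 0
    then have "continuous_on (S \<times> UNIV) F'"
      using continuous_on_inverse_open[OF open_Times[OF S open_UNIV] contF _ F'F] img by simp
    then have "continuous_on S (\<lambda>y. snd (F' (y, v)))"
      by (intro continuous_on_snd continuous_on_compose2[of "S \<times> UNIV" F' S "\<lambda>y. (y, v)"])
         (auto intro: continuous_intros)
    then show ?case by (simp add: F'_def)
  next
    case (Suc k)
    define D where "D y u w = frechet_derivative (\<lambda>y. A y w) (at y) u" for y u w
    have D: "((\<lambda>y. A y w) has_derivative (\<lambda>u. D y u w)) (at y)" if "y \<in> S" for y w
      using Ck_on_has_derivative[OF Suc.prems that] by (simp add: D_def[abs_def])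
    \<comment> \<open>Differentiating \<open>A y (B y v) = v\<close> shows that the derivative of
      \<open>B y v\<close> in the direction \<open>u\<close> has to be
      \<open>B y (E y u)\<close>.\<close>
    define E where "E y u = - (\<Sum>b\<in>Basis. (B y v \<bullet> b) *\<^sub>R D y u b)" for y u
    have contA: "continuous_on S (\<lambda>y. A y w)" for w
      using D S by (intro continuous_at_imp_continuous_on) (auto intro: has_derivative_continuous)
    show ?case
    proof (rule Ck_on_SucI[OF S])
      fix y assume y: "y \<in> S"
      interpret A: linear "A y" by (rule linA[OF y])
      interpret B: linear "B y" by (rule linB[OF y])
      define x where "x = B y v"
      \<comment> \<open>The derivative of \<open>F\<close> at \<open>(y, x)\<close> and its inverse,
        both block triangular.\<close>
      define H where "H p = (fst p, (\<Sum>b\<in>Basis. (x \<bullet> b) *\<^sub>R D y (fst p) b) + A y (snd p))" for p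
      define H' where "H' p = (fst p, B y (snd p - (\<Sum>b\<in>Basis. (x \<bullet> b) *\<^sub>R D y (fst p) b)))" for p
      have D': "((\<lambda>p. A (fst p) b) has_derivative (\<lambda>u. D y (fst u) b)) (at (y, x))" for b
        using has_derivative_compose[OF has_derivative_fst[OF has_derivative_ident],
            of "\<lambda>y. A y b" "\<lambda>u. D y u b" "(y, x)" UNIV] D[OF y]
        by simp
      have "((\<lambda>p. (snd p \<bullet> b) *\<^sub>R A (fst p) b) has_derivative
          (\<lambda>u. (x \<bullet> b) *\<^sub>R D y (fst u) b + (snd u \<bullet> b) *\<^sub>R A y b)) (at (y, x))" for b
        using has_derivative_scaleR[OF has_derivative_inner_left[OF has_derivative_snd[OF has_derivative_ident]] D', of b b]
        by simp
      then have "((\<lambda>p. \<Sum>b\<in>Basis. (snd p \<bullet> b) *\<^sub>R A (fst p) b) has_derivative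
          (\<lambda>u. \<Sum>b\<in>Basis. (x \<bullet> b) *\<^sub>R D y (fst u) b + (snd u \<bullet> b) *\<^sub>R A y b)) (at (y, x))"
        by (rule has_derivative_sum)
      then have "((\<lambda>p. \<Sum>b\<in>Basis. (snd p \<bullet> b) *\<^sub>R A (fst p) b) has_derivative
          (\<lambda>u. (\<Sum>b\<in>Basis. (x \<bullet> b) *\<^sub>R D y (fst u) b) + A y (snd u))) (at (y, x))"
        by (simp only: sum.distrib A_eq[OF y, symmetric])
      then have "((\<lambda>p. (fst p, \<Sum>b\<in>Basis. (snd p \<bullet> b) *\<^sub>R A (fst p) b)) has_derivative H) (at (y, x))"
        unfolding H_def[abs_def] by (intro has_derivative_Pair has_derivative_fst has_derivative_ident)
      then have "(F has_derivative H) (at (y, x))"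
        by (rule has_derivative_transform_within_open[OF _ open_Times[OF S open_UNIV]])
           (use y A_eq in \<open>auto simp: F_def\<close>)
      moreover have "H \<circ> H' = id"
        using AB[OF y] by (auto simp: H_def H'_def fun_eq_iff)
      ultimately have "(F' has_derivative H') (at (F (y, x)))"
        using y by (intro has_derivative_inverse_strong[OF open_Times[OF S open_UNIV] _ contF[OF contA] F'F]) auto
      then have F': "(F' has_derivative H') (at (y, v))"
        using AB[OF y] by (simp add: F_def x_def)
      have "((\<lambda>y. (y, v)) has_derivative (\<lambda>u. (u, 0))) (at y)"
        by (intro has_derivative_Pair has_derivative_ident has_derivative_const)
      from has_derivative_compose[OF this F']
      have "((\<lambda>y. snd (F' (y, v))) has_derivative (\<lambda>u. snd (H' (u, 0)))) (at y)"
        by (rule has_derivative_snd)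
      moreover have "snd (H' (u, 0)) = (\<Sum>b\<in>Basis. (E y u \<bullet> b) *\<^sub>R B y b)" for u
      proof -
        have "snd (H' (u, 0)) = B y (E y u)" by (simp add: H'_def E_def x_def)
        then show ?thesis using linear_eq_sum_Basis[OF linB[OF y], of "E y u"] by (rule trans)
      qed
      ultimately show "((\<lambda>y. B y v) has_derivative (\<lambda>u. \<Sum>b\<in>Basis. (E y u \<bullet> b) *\<^sub>R B y b)) (at y)"
        unfolding F'_def by (simp only: snd_conv fst_conv)
    next
      fix u
      have IH: "Ck_on k (\<lambda>y. B y w) S" for w
        by (rule Suc.IH[OF Ck_on_SucD[OF Suc.prems]])
      have 1: "Ck_on k (\<lambda>y. D y u b) S" for b
        using Suc.prems[of b] by (simp add: D_def)
      have 2: "Ck_on k (\<lambda>y. - 1 *\<^sub>R E y u) S"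
        unfolding E_def by simp
          (intro Ck_on_sum S Ck_on_bilinear[OF bounded_bilinear_scaleR]
            Ck_on_bilinear[OF bounded_bilinear_inner] IH 1 Ck_on_const)
      have "Ck_on k (\<lambda>y. - 1 *\<^sub>R (- 1 *\<^sub>R E y u)) S"
        by (rule Ck_on_bilinear[OF bounded_bilinear_scaleR S Ck_on_const[OF S] 2])
      then show "Ck_on k (\<lambda>y. \<Sum>b\<in>Basis. (E y u \<bullet> b) *\<^sub>R B y b) S"
        by (intro Ck_on_sum S Ck_on_bilinear[OF bounded_bilinear_scaleR]
            Ck_on_bilinear[OF bounded_bilinear_inner] IH Ck_on_const) simp
    qed
  qed
qed

text \<open>Bootstrapping: the derivative of \<open>g\<close> at \<open>y\<close> is the inverse of
  the derivative of \<open>f\<close> at \<open>g y\<close>, so it has as many derivatives as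
  \<open>g\<close>, and \<open>g\<close> gains one order. The image is open by invariance of
  domain.\<close>

lemma smooth_on_inverse_function:
  fixes f :: "'e::euclidean_space \<Rightarrow> 'e"
  assumes S: "open S" and f: "smooth_on S f" and gf: "\<And>x. x \<in> S \<Longrightarrow> g (f x) = x"
    and inj: "\<And>x. x \<in> S \<Longrightarrow> inj (frechet_derivative f (at x))"
  shows "open (f ` S)" "smooth_on (f ` S) g"
proof -
  have contf: "continuous_on S f" using f by (rule smooth_on_imp_continuous_on)
  show opn: "open (f ` S)"
    using contf S inj_on_inverseI[of S g f, OF gf] by (rule invariance_of_domain)
  have contg: "continuous_on (f ` S) g"
    using continuous_on_inverse_open[OF S contf _ gf] by simp
  define A where "A y = frechet_derivative f (at (g y))" for y
  have A: "(f has_derivative A y) (at (g y))" if "y \<in> f ` S" for y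
    unfolding A_def using smooth_on_has_derivative[OF f] gf that by auto
  have linA: "linear (A y)" if "y \<in> f ` S" for y
    using has_derivative_bounded_linear[OF A[OF that]] by (rule bounded_linear.linear)
  have bij: "bij (A y)" if "y \<in> f ` S" for y
    using linear_injective_imp_surjective[OF linA[OF that]] inj gf that
    by (auto simp: A_def bij_def)
  define B where "B y = inv (A y)" for y
  have AB: "A y (B y v) = v" if "y \<in> f ` S" for y v
    unfolding B_def using bij[OF that] by (simp add: bij_is_surj surj_f_inv_f)
  have BA: "B y (A y v) = v" if "y \<in> f ` S" for y v
    unfolding B_def using bij[OF that] by (simp add: bij_is_inj)
  have linB: "linear (B y)" if "y \<in> f ` S" for y
    unfolding B_def using inj_linear_imp_inv_bounded_linear linA[OF that] bij[OF that]
    by (auto simp: bij_def linear_conv_bounded_linear)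
  have g: "(g has_derivative B y) (at y)" if y: "y \<in> f ` S" for y
  proof -
    obtain x where x: "x \<in> S" "y = f x" using y by auto
    show ?thesis
      using has_derivative_inverse_strong[OF S x(1) contf gf, of "A y" "B y"] A[OF y] AB[OF y] x gf
      by (simp add: fun_eq_iff)
  qed
  have "Ck_on k g (f ` S)" for k
  proof (induction k)
    case 0
    then show ?case using contg by simp
  next
    case (Suc k)
    show ?case
    proof (rule Ck_on_SucI[OF opn g])
      fix v
      have "Ck_on k (\<lambda>y. A y w) (f ` S)" for w
      proof -
        have "\<forall>v. Ck_on k (\<lambda>x. frechet_derivative f (at x) v) S"
          using f[unfolded smooth_on_def, rule_format, of "Suc k"] by simp
        then show ?thesis
          unfolding A_def using gf by (intro Ck_on_compose[OF opn S _ Suc.IH]) auto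
      qed
      then show "Ck_on k (\<lambda>y. B y v) (f ` S)"
        using Ck_on_inverse_family[of "f ` S" A B k v, OF opn linA linB AB BA] by blast
    qed
  qed
  then show "smooth_on (f ` S) g" by (simp add: smooth_on_def)
qed

section \<open>A flat function and smooth majorants\<close>

definition flat :: "real \<Rightarrow> real" where
  "flat x = (if x > 0 then exp (- (1 / x)) else 0)"

lemma flat_pos: "x > 0 \<Longrightarrow> flat x > 0" and flat_nonneg: "flat x \<ge> 0"
  and flat_eq_0: "x \<le> 0 \<Longrightarrow> flat x = 0"
  by (auto simp: flat_def)

lemma flat_mono: "x \<le> y \<Longrightarrow> flat x \<le> flat y"
  by (auto simp: flat_def frac_le)

lemma flat_power_tendsto_0: "((\<lambda>x::real. exp (- inverse x) * inverse x ^ m) \<longlongrightarrow> 0) (at_right 0)"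
proof -
  have "((\<lambda>x::real. x ^ m / exp x) \<longlongrightarrow> 0) at_top"
    by (rule tendsto_power_div_exp_0)
  then have "((\<lambda>x::real. inverse x ^ m / exp (inverse x)) \<longlongrightarrow> 0) (at_right 0)"
    by (rule filterlim_compose) (rule filterlim_inverse_at_top_right)
  then show ?thesis
    by (simp add: exp_minus divide_inverse mult.commute)
qed

text \<open>The flat function divided by \<open>x ^ m\<close> is \<open>F m\<close>, and the
  derivative of \<open>F m\<close> is a combination of \<open>F (m + 1)\<close> and
  \<open>F (m + 2)\<close>. Exponential decay beats each of these poles, so this remains true at 0.
  The induction therefore runs over all \<open>m\<close> at once.\<close>

lemma smooth_on_flat_UNIV: "smooth_on UNIV flat"
proof -
  define F :: "nat \<Rightarrow> real \<Rightarrow> real" where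
    "F m x = (if x > 0 then exp (- inverse x) * inverse x ^ m else 0)" for m x
  have deriv: "(F m has_real_derivative F (m + 2) x - real m * F (m + 1) x) (at x)" for m x
  proof (cases x "0 :: real" rule: linorder_cases)
    case less
    have "(F m has_real_derivative 0) (at x)"
      by (rule has_field_derivative_transform_within_open[OF DERIV_const[of 0], of "{..<0}"])
         (use less in \<open>auto simp: F_def\<close>)
    then show ?thesis using less by (simp add: F_def)
  next
    case greater
    have "((\<lambda>x. exp (- inverse x) * inverse x ^ m) has_real_derivative
        exp (- inverse x) * inverse x ^ 2 * inverse x ^ m -
        real m * inverse x ^ (m - 1) * inverse x ^ 2 * exp (- inverse x)) (at x)"
      using greater by (auto intro!: derivative_eq_intros simp: power2_eq_square)
    moreover have "exp (- inverse x) * inverse x ^ 2 * inverse x ^ m -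
        real m * inverse x ^ (m - 1) * inverse x ^ 2 * exp (- inverse x) =
        exp (- inverse x) * inverse x ^ (m + 2) - real m * (exp (- inverse x) * inverse x ^ (m + 1))"
      by (cases m) (simp_all add: power_add power2_eq_square del: power_inverse)
    ultimately have "((\<lambda>x. exp (- inverse x) * inverse x ^ m) has_real_derivative
        exp (- inverse x) * inverse x ^ (m + 2) - real m * (exp (- inverse x) * inverse x ^ (m + 1))) (at x)"
      by (simp only:)
    then have "(F m has_real_derivative
        exp (- inverse x) * inverse x ^ (m + 2) - real m * (exp (- inverse x) * inverse x ^ (m + 1))) (at x)"
      by (rule has_field_derivative_transform_within_open[of _ _ _ "{0<..}"])
         (use greater in \<open>auto simp: F_def\<close>)
    then show ?thesis
      using greater unfolding F_def by simp
  next
    case equal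
    have "((\<lambda>h. (F m (0 + h) - F m 0) / h) \<longlongrightarrow> 0) (at 0)"
    proof (rule filterlim_split_at)
      show "((\<lambda>h. (F m (0 + h) - F m 0) / h) \<longlongrightarrow> 0) (at_left 0)"
        by (rule tendsto_eventually) (auto simp: eventually_at_filter F_def)
      show "((\<lambda>h. (F m (0 + h) - F m 0) / h) \<longlongrightarrow> 0) (at_right 0)"
        by (rule Lim_transform_eventually[OF flat_power_tendsto_0[of "Suc m"]])
           (auto simp: eventually_at_filter F_def divide_inverse mult_ac)
    qed
    then show ?thesis using equal by (simp add: DERIV_def F_def)
  qed
  have "Ck_on k (F m) UNIV" for k m
  proof (induction k arbitrary: m)
    case 0
    show ?case using deriv by (auto intro!: continuous_at_imp_continuous_on DERIV_isCont)
  next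
    case (Suc k)
    show ?case
    proof (rule Ck_on_SucI[OF open_UNIV])
      show "(F m has_derivative (*) (F (m + 2) x - real m * F (m + 1) x)) (at x)" for x
        using deriv unfolding has_field_derivative_def .
      have *: "Ck_on k (\<lambda>x. c * F m x) UNIV" for c m
        by (intro Ck_on_bilinear[OF bounded_bilinear_mult] Ck_on_const Suc.IH) auto
      have "Ck_on k (\<lambda>x. v * F (m + 2) x + (- v * real m) * F (m + 1) x) UNIV" for v
        by (intro Ck_on_add * open_UNIV)
      then show "Ck_on k (\<lambda>x. (F (m + 2) x - real m * F (m + 1) x) * v) UNIV" for v
        by (simp add: algebra_simps)
    qed
  qed
  moreover have "F 0 = flat" by (auto simp: F_def flat_def inverse_eq_divide)
  ultimately show ?thesis by (metis smooth_on_def)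
qed

lemma smooth_on_flat [smooth_intros]:
  "smooth_on S f \<Longrightarrow> open S \<Longrightarrow> smooth_on S (\<lambda>x. flat (f x))"
  by (rule smooth_on_compose[OF smooth_on_flat_UNIV]) auto

text \<open>The \<open>m\<close>-th summand vanishes up to \<open>m - 1\<close> and is at least
  \<open>\<bar>B m\<bar>\<close> from \<open>m\<close> on, so the sum is locally finite. Such a
  majorant makes a handle thinner with growing distance along its remaining coordinates.\<close>

lemma smooth_majorant:
  fixes B :: "nat \<Rightarrow> real"
  obtains E where "smooth_on UNIV E" "\<And>x. E x \<ge> (1::real)" "\<And>m x. real m \<le> x \<Longrightarrow> B m \<le> E x"
proof
  define E where "E x = 1 + (\<Sum>m<nat \<lceil>x + 1\<rceil>. \<bar>B m\<bar> / flat 1 * flat (x - real m + 1))" for x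
  \<comment> \<open>Surplus summands vanish, so near a given point a constant number of them can be
    used.\<close>
  have E_eq: "E x = 1 + (\<Sum>m<N. \<bar>B m\<bar> / flat 1 * flat (x - real m + 1))" if "x + 1 \<le> real N" for x N
  proof -
    have "flat (x - real m + 1) = 0" if "m \<ge> nat \<lceil>x + 1\<rceil>" for m
      using that by (intro flat_eq_0) linarith
    then have "(\<Sum>m<N. \<bar>B m\<bar> / flat 1 * flat (x - real m + 1)) =
        (\<Sum>m<nat \<lceil>x + 1\<rceil>. \<bar>B m\<bar> / flat 1 * flat (x - real m + 1))"
      using \<open>x + 1 \<le> real N\<close> by (intro sum.mono_neutral_right) (auto, linarith)
    then show ?thesis by (simp add: E_def)
  qed
  show "smooth_on UNIV E"
  proof (rule smooth_on_local)
    fix x :: real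
    obtain N where N: "x + 1 < real N" using reals_Archimedean2 by blast
    have "smooth_on {..<real N - 1} (\<lambda>x. 1 + (\<Sum>m<N. \<bar>B m\<bar> / flat 1 * flat (x - real m + 1)))"
      by (intro smooth_intros) auto
    then have "smooth_on {..<real N - 1} E"
      by (rule smooth_on_cong[rotated 2]) (use E_eq[of _ N] in auto)
    then show "\<exists>T. open T \<and> x \<in> T \<and> smooth_on T E"
      using N by (intro exI[of _ "{..<real N - 1}"]) auto
  qed
  show "E x \<ge> 1" for x
    unfolding E_def using flat_nonneg by (simp add: sum_nonneg)
  show "B m \<le> E x" if "real m \<le> x" for m x
  proof -
    have "B m \<le> \<bar>B m\<bar> / flat 1 * flat 1" using flat_pos[of 1] by simp
    also have "\<dots> \<le> \<bar>B m\<bar> / flat 1 * flat (x - real m + 1)"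
      using that flat_nonneg by (intro mult_left_mono flat_mono) auto
    also have "\<dots> \<le> (\<Sum>m<nat \<lceil>x + 1\<rceil>. \<bar>B m\<bar> / flat 1 * flat (x - real m + 1))"
      using that flat_nonneg by (intro member_le_sum) (auto, linarith)
    finally show ?thesis by (simp add: E_def)
  qed
qed

section \<open>Entire power series and the cardinal sine\<close>

lemma smooth_on_powser:
  fixes c :: "nat \<Rightarrow> real"
  assumes "\<And>x. summable (\<lambda>n. c n * x ^ n)"
  shows "smooth_on UNIV (\<lambda>x. \<Sum>n. c n * x ^ n)"
proof -
  define F where "F k x = (\<Sum>n. (diffs ^^ k) c n * x ^ n)" for k and x :: real
  have summ: "summable (\<lambda>n. (diffs ^^ k) c n * x ^ n)" for k x
  proof (induction k arbitrary: x)
    case (Suc k)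
    then show ?case using termdiff_converges_all[OF Suc.IH] by simp
  qed (use assms in simp)
  have "(F k has_real_derivative F (Suc k) x) (at x)" for k x
    unfolding F_def using termdiffs_strong_converges_everywhere[OF summ] by simp
  then have "smooth_on UNIV (F 0)" by (intro smooth_on_derivative_family) auto
  then show ?thesis by (simp add: F_def[abs_def])
qed

text \<open>This is \<open>sin x / x\<close>, given by its series in order to be smooth at 0 as
  well. It lets \<open>rsin\<close> pass smoothly from elliptic to parabolic transformations, where
  the speed vanishes.\<close>

definition sinc :: "real \<Rightarrow> real" where
  "sinc x = (\<Sum>n. sin_coeff (Suc n) * x ^ n)"

lemma summable_sinc: "summable (\<lambda>n. sin_coeff (Suc n) * x ^ n)" for x :: real
proof (cases "x = 0")
  case True
  then show ?thesis by (simp add: summable_zero_power')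
next
  case False
  have "summable (\<lambda>n. sin_coeff (Suc n) * x ^ Suc n)"
    using summable_norm_sin[of x, THEN summable_norm_cancel] by (subst summable_Suc_iff) simp
  from summable_mult[OF this, of "inverse x"] show ?thesis using False by (simp add: field_simps)
qed

lemma sin_eq_sinc: "sin x = x * sinc x"
proof -
  have "(\<lambda>n. sin_coeff (Suc n) * x ^ Suc n) sums (sin x - sin_coeff 0 * x ^ 0)"
    using sin_converges[of x] by (subst sums_Suc_iff) simp
  moreover have "(\<lambda>n. x * (sin_coeff (Suc n) * x ^ n)) sums (x * sinc x)"
    unfolding sinc_def by (intro sums_mult summable_sums summable_sinc)
  ultimately show ?thesis using sums_unique2 by (simp add: mult_ac)
qed

lemma sinc_0 [simp]: "sinc 0 = 1"
  by (simp add: sinc_def sin_coeff_def)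

lemma smooth_on_sinc [smooth_intros]:
  assumes "smooth_on S f" "open S" shows "smooth_on S (\<lambda>x. sinc (f x))"
proof -
  have "smooth_on UNIV sinc"
    unfolding sinc_def[abs_def] by (rule smooth_on_powser[OF summable_sinc])
  then show ?thesis using assms smooth_on_compose[of UNIV sinc S f] by simp
qed

section \<open>Manifolds in terms of local smoothness\<close>

context
  fixes M :: "('a, 'e::euclidean_space) mfd" and D c
  assumes M: "smooth_atlas M" and Dc: "(D, c) \<in> atlas M"
begin

lemma chart_open: "openin (mtop M) D" "open (c ` D)"
  and chart_homeo: "homeomorphic_map (subtopology (mtop M) D) (top_of_set (c ` D)) c"
  using M Dc by (auto simp: smooth_atlas_def chart_on_def)

lemma chart_subset: "D \<subseteq> points M"
  using chart_open(1) by (rule openin_subset)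

lemma chart_inj: "inj_on c D"
  using chart_homeo chart_subset
  by (auto simp: homeomorphic_eq_everything_map Int_absorb1)

lemma chart_inv [simp]: "x \<in> D \<Longrightarrow> inv_into D c (c x) = x"
  using chart_inj by simp

lemma chart_image_open:
  assumes "openin (mtop M) O'" "O' \<subseteq> D" shows "open (c ` O')"
proof -
  have "openin (subtopology (mtop M) D) O'"
    using assms by (simp add: openin_open_subtopology[OF chart_open(1)])
  then have "openin (top_of_set (c ` D)) (c ` O')"
    using chart_homeo by (simp add: homeomorphic_eq_everything_map open_map_def)
  then show ?thesis using chart_open(2) openin_open_trans by blast
qed

lemma chart_preimage_open:
  assumes "open W" shows "openin (mtop M) {x \<in> D. c x \<in> W}"
proof -
  have "continuous_map (subtopology (mtop M) D) (top_of_set (c ` D)) c"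
    using chart_homeo by (rule homeomorphic_imp_continuous_map)
  then have "openin (subtopology (mtop M) D) {x \<in> topspace (subtopology (mtop M) D). c x \<in> c ` D \<inter> W}"
    using assms by (intro openin_continuous_map_preimage) auto
  moreover have "{x \<in> topspace (subtopology (mtop M) D). c x \<in> c ` D \<inter> W} = {x \<in> D. c x \<in> W}"
    using chart_subset by auto
  ultimately show ?thesis
    by (simp add: openin_open_subtopology[OF chart_open(1)])
qed

end

lemma chart_at:
  assumes "smooth_atlas M" "x \<in> points M"
  obtains D c where "(D, c) \<in> atlas M" "x \<in> D"
proof -
  have "x \<in> (\<Union>(D, c)\<in>atlas M. D)" using assms unfolding smooth_atlas_def by simp
  then show ?thesis using that by auto
qed

lemma smooth_atlasI:
  assumes "\<And>D c. (D, c) \<in> atlas M \<Longrightarrow> chart_on (mtop M) D c"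
    and "\<And>x. x \<in> points M \<Longrightarrow> \<exists>D c. (D, c) \<in> atlas M \<and> x \<in> D"
    and "\<And>D c D' c'. (D, c) \<in> atlas M \<Longrightarrow> (D', c') \<in> atlas M \<Longrightarrow>
      smooth_on (c ` (D \<inter> D')) (c' \<circ> inv_into D c)"
  shows "smooth_atlas M"
proof -
  have "D \<subseteq> points M" if "(D, c) \<in> atlas M" for D c
    using assms(1)[OF that] by (auto simp: chart_on_def dest: openin_subset)
  then show ?thesis using assms unfolding smooth_atlas_def by fast
qed

lemma chart_transition:
  assumes "smooth_atlas M" "(D, c) \<in> atlas M" "(D', c') \<in> atlas M"
  shows "smooth_on (c ` (D \<inter> D')) (c' \<circ> inv_into D c)"
  using assms by (auto simp: smooth_atlas_def)

section \<open>Smoothness at a point and its independence of charts\<close>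

definition smooth_at :: "('a, 'e::euclidean_space) mfd \<Rightarrow> ('b, 'f::euclidean_space) mfd
    \<Rightarrow> ('a \<Rightarrow> 'b) \<Rightarrow> 'a \<Rightarrow> bool" where
  "smooth_at M N f x \<longleftrightarrow>
     (\<exists>D c D' c' O'. (D, c) \<in> atlas M \<and> (D', c') \<in> atlas N \<and> openin (mtop M) O' \<and> x \<in> O' \<and> O' \<subseteq> D \<and>
        f ` O' \<subseteq> D' \<and> smooth_on (c ` O') (\<lambda>y. c' (f (inv_into D c y))))"

lemma open_preimage_in_charts:
  assumes M: "smooth_atlas M" and N: "smooth_atlas N" and Dc: "(D, c) \<in> atlas M" and Dc': "(D', c') \<in> atlas N"
    and O: "openin (mtop M) O'" "O' \<subseteq> D" "f ` O' \<subseteq> D'" and cont: "continuous_on (c ` O') (\<lambda>y. c' (f (inv_into D c y)))"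
    and W: "openin (mtop N) W"
  shows "openin (mtop M) {y \<in> O'. f y \<in> W}"
proof -
  let ?g = "\<lambda>y. c' (f (inv_into D c y))"
  have "open (c' ` (D' \<inter> W))"
    using W chart_open[OF N Dc'] by (intro chart_image_open[OF N Dc']) auto
  then have "open (c ` O' \<inter> ?g -` (c' ` (D' \<inter> W)))"
    using cont chart_image_open[OF M Dc O(1,2)] by (rule continuous_open_preimage[rotated 2])
  then have "openin (mtop M) (O' \<inter> {x \<in> D. c x \<in> c ` O' \<inter> ?g -` (c' ` (D' \<inter> W))})"
    using O(1) by (intro openin_Int chart_preimage_open[OF M Dc])
  moreover have "O' \<inter> {x \<in> D. c x \<in> c ` O' \<inter> ?g -` (c' ` (D' \<inter> W))} = {y \<in> O'. f y \<in> W}"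
  proof -
    have "f y \<in> W \<longleftrightarrow> c' (f y) \<in> c' ` (D' \<inter> W)" if "y \<in> O'" for y
      using that O(3) chart_inj[OF N Dc'] by (auto simp: inj_on_def)
    then have "y \<in> {x \<in> D. c x \<in> c ` O' \<inter> ?g -` (c' ` (D' \<inter> W))} \<longleftrightarrow> f y \<in> W" if "y \<in> O'" for y
      using that O(2) chart_inv[OF M Dc, of y] by (simp add: subset_iff)
    then show ?thesis by blast
  qed
  ultimately show ?thesis by simp
qed

text \<open>The definition of \<open>smooth_at\<close> asks for some pair of charts, which keeps it
  easy to establish, and continuity is implicit in it. Shrinking the neighbourhood until
  \<open>f\<close> also lands in \<open>D'\<close> permits the change to any given charts.\<close>

lemma smooth_at_charts:
  assumes M: "smooth_atlas M" and N: "smooth_atlas N" and f: "smooth_at M N f x"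
    and Dc: "(D, c) \<in> atlas M" "x \<in> D" and Dc': "(D', c') \<in> atlas N" "f x \<in> D'"
  obtains O' where "openin (mtop M) O'" "x \<in> O'" "O' \<subseteq> D" "f ` O' \<subseteq> D'"
    "smooth_on (c ` O') (\<lambda>y. c' (f (inv_into D c y)))"
proof -
  obtain E e E' e' T where T: "(E, e) \<in> atlas M" "(E', e') \<in> atlas N" "openin (mtop M) T" "x \<in> T" "T \<subseteq> E"
    "f ` T \<subseteq> E'" and s: "smooth_on (e ` T) (\<lambda>y. e' (f (inv_into E e y)))"
    using f unfolding smooth_at_def by blast
  define O' where "O' = {y \<in> T. f y \<in> D'} \<inter> D"
  have O: "openin (mtop M) O'"
    unfolding O'_def
    using T open_preimage_in_charts[OF M N T(1,2,3,5,6) smooth_on_imp_continuous_on[OF s]]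
      chart_open(1)[OF N Dc'(1)] chart_open(1)[OF M Dc(1)] by blast
  have sub: "O' \<subseteq> D" "O' \<subseteq> E" "O' \<subseteq> T" "f ` O' \<subseteq> D'" "f ` O' \<subseteq> E'" using T by (auto simp: O'_def)
  then have pt: "y \<in> O' \<Longrightarrow> y \<in> D" "y \<in> O' \<Longrightarrow> y \<in> E" "y \<in> O' \<Longrightarrow> f y \<in> D'"
    "y \<in> O' \<Longrightarrow> f y \<in> E'" for y by auto
  have opn: "open (c ` O')" "open (e ` O')"
    using chart_image_open[OF M Dc(1) O] chart_image_open[OF M T(1) O] sub by auto
  have 1: "smooth_on (c ` O') (e \<circ> inv_into D c)"
    using chart_transition[OF M Dc(1) T(1)] by (rule smooth_on_subset) (use sub in auto)
  have 2: "smooth_on (e ` O') (\<lambda>y. e' (f (inv_into E e y)))"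
    using s by (rule smooth_on_subset) (use sub in auto)
  have 3: "smooth_on (e' ` (E' \<inter> D')) (c' \<circ> inv_into E' e')"
    by (rule chart_transition[OF N T(2) Dc'(1)])
  have opn3: "open (e' ` (E' \<inter> D'))"
    using chart_open(1)[OF N T(2)] chart_open(1)[OF N Dc'(1)] by (intro chart_image_open[OF N T(2)]) auto
  have "smooth_on (e ` O') (\<lambda>y. (c' \<circ> inv_into E' e') (e' (f (inv_into E e y))))"
    by (rule smooth_on_compose[OF 3 2 opn(2) opn3]) (use pt chart_inv[OF M T(1)] in auto)
  then have "smooth_on (c ` O') (\<lambda>y. (c' \<circ> inv_into E' e') (e' (f (inv_into E e ((e \<circ> inv_into D c) y)))))"
    by (rule smooth_on_compose[OF _ 1 opn]) (use sub chart_inv[OF M Dc(1)] in auto)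
  then have "smooth_on (c ` O') (\<lambda>y. c' (f (inv_into D c y)))"
    by (rule smooth_on_cong[OF opn(1), rotated])
       (use pt chart_inv[OF M Dc(1)] chart_inv[OF M T(1)] chart_inv[OF N T(2)] in auto)
  moreover have "x \<in> O'" using T Dc Dc' by (auto simp: O'_def)
  ultimately show ?thesis using that O sub by blast
qed

lemma smooth_at_in_points:
  assumes "smooth_atlas M" "smooth_atlas N" "smooth_at M N f x"
  shows "x \<in> points M" "f x \<in> points N"
proof -
  obtain D c D' c' O' where "(D, c) \<in> atlas M" "(D', c') \<in> atlas N" "x \<in> O'" "O' \<subseteq> D" "f ` O' \<subseteq> D'"
    using assms(3) unfolding smooth_at_def by blast
  then show "x \<in> points M" "f x \<in> points N"
    using chart_subset[OF assms(1)] chart_subset[OF assms(2)] by blast+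
qed

lemma smooth_at_open_nhd:
  assumes "smooth_atlas M" "smooth_atlas N" "smooth_at M N f x" "openin (mtop N) W" "f x \<in> W"
  obtains O' where "openin (mtop M) O'" "x \<in> O'" "f ` O' \<subseteq> W"
proof -
  obtain E e E' e' T where T: "(E, e) \<in> atlas M" "(E', e') \<in> atlas N" "openin (mtop M) T" "x \<in> T" "T \<subseteq> E"
    "f ` T \<subseteq> E'" and s: "smooth_on (e ` T) (\<lambda>y. e' (f (inv_into E e y)))"
    using assms(3) unfolding smooth_at_def by blast
  have "openin (mtop M) {y \<in> T. f y \<in> W}"
    by (rule open_preimage_in_charts[OF assms(1,2) T(1,2,3,5,6) smooth_on_imp_continuous_on[OF s] assms(4)])
  then show ?thesis using that[of "{y \<in> T. f y \<in> W}"] T assms(5) by auto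
qed

lemma smooth_map_iff_smooth_at:
  assumes M: "smooth_atlas M" and N: "smooth_atlas N"
  shows "smooth_map M N f \<longleftrightarrow> (\<forall>x\<in>points M. smooth_at M N f x)"
proof
  assume f: "smooth_map M N f"
  show "\<forall>x\<in>points M. smooth_at M N f x"
  proof
    fix x assume x: "x \<in> points M"
    have cont: "continuous_map (mtop M) (mtop N) f" using f by (simp add: smooth_map_def)
    obtain D c where Dc: "(D, c) \<in> atlas M" "x \<in> D" using chart_at[OF M x] .
    have "f x \<in> points N" using cont x by (auto simp: continuous_map_def)
    then obtain D' c' where Dc': "(D', c') \<in> atlas N" "f x \<in> D'" using chart_at[OF N] by blast
    have "openin (mtop M) {y \<in> points M. f y \<in> D'}"
      using cont chart_open(1)[OF N Dc'(1)] by (rule openin_continuous_map_preimage)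
    then have "openin (mtop M) (D \<inter> {y \<in> points M. f y \<in> D'})"
      using chart_open(1)[OF M Dc(1)] by auto
    moreover have "D \<inter> {y \<in> points M. f y \<in> D'} = D \<inter> f -` D'" using chart_subset[OF M Dc(1)] by auto
    moreover have "smooth_on (c ` (D \<inter> f -` D')) (\<lambda>y. c' (f (inv_into D c y)))"
      using f Dc(1) Dc'(1) by (fastforce simp: smooth_map_def comp_def)
    ultimately show "smooth_at M N f x"
      unfolding smooth_at_def using Dc Dc'
      by (intro exI[of _ D] exI[of _ c] exI[of _ D'] exI[of _ c'] exI[of _ "D \<inter> f -` D'"]) auto
  qed
next
  assume f: "\<forall>x\<in>points M. smooth_at M N f x"
  show "smooth_map M N f"
    unfolding smooth_map_def
  proof (intro conjI ballI, goal_cases)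
    case 1
    show "continuous_map (mtop M) (mtop N) f"
      unfolding continuous_map_def
    proof (intro conjI allI impI)
      show "f \<in> points M \<rightarrow> points N" using f smooth_at_in_points[OF M N] by auto
      fix W assume W: "openin (mtop N) W"
      show "openin (mtop M) {x \<in> points M. f x \<in> W}"
      proof (subst openin_subopen, clarify)
        fix x assume "x \<in> points M" "f x \<in> W"
        then obtain O' where "openin (mtop M) O'" "x \<in> O'" "f ` O' \<subseteq> W"
          using f smooth_at_open_nhd[OF M N _ W] by metis
        then show "\<exists>T. openin (mtop M) T \<and> x \<in> T \<and> T \<subseteq> {x \<in> points M. f x \<in> W}"
          by (intro exI[of _ O']) (auto dest: openin_subset)
      qed
    qed
  next
    case (2 Dc0)
    have "smooth_on (c ` (D \<inter> f -` D')) (c' \<circ> f \<circ> inv_into D c)"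
      if Dc: "(D, c) \<in> atlas M" and Dc': "(D', c') \<in> atlas N" for D c D' c'
    proof (rule smooth_on_local)
      fix y assume "y \<in> c ` (D \<inter> f -` D')"
      then obtain x where x: "x \<in> D" "f x \<in> D'" "y = c x" by auto
      then have "smooth_at M N f x" using f chart_subset[OF M Dc] by auto
      then obtain O' where "openin (mtop M) O'" "x \<in> O'" "O' \<subseteq> D"
        "smooth_on (c ` O') (\<lambda>y. c' (f (inv_into D c y)))"
        using smooth_at_charts[where f = f and x = x, OF M N _ Dc x(1) Dc' x(2)] by metis
      then show "\<exists>T. open T \<and> y \<in> T \<and> smooth_on T (c' \<circ> f \<circ> inv_into D c)"
        using x chart_image_open[OF M Dc, of O'] by (intro exI[of _ "c ` O'"]) (auto simp: comp_def)
    qed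
    then show ?case using 2 by auto
  qed
qed

lemma smooth_at_cong:
  assumes M: "smooth_atlas M" and f: "smooth_at M N f x"
    and T: "openin (mtop M) T" "x \<in> T" "\<And>y. y \<in> T \<Longrightarrow> f y = g y"
  shows "smooth_at M N g x"
proof -
  obtain D c D' c' O' where O: "(D, c) \<in> atlas M" "(D', c') \<in> atlas N" "openin (mtop M) O'" "x \<in> O'" "O' \<subseteq> D"
    "f ` O' \<subseteq> D'" and s: "smooth_on (c ` O') (\<lambda>y. c' (f (inv_into D c y)))"
    using f unfolding smooth_at_def by blast
  have OT: "openin (mtop M) (O' \<inter> T)" using O T by blast
  have opn: "open (c ` (O' \<inter> T))"
    using chart_image_open[OF M O(1) OT] O by auto
  have "smooth_on (c ` (O' \<inter> T)) (\<lambda>y. c' (f (inv_into D c y)))"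
    using s by (rule smooth_on_subset) auto
  then have "smooth_on (c ` (O' \<inter> T)) (\<lambda>y. c' (g (inv_into D c y)))"
    by (rule smooth_on_cong[OF opn, rotated]) (use O T chart_inv[OF M O(1)] in auto)
  moreover have "g ` (O' \<inter> T) \<subseteq> D'" using O(6) T(3) by (auto simp flip: T(3))
  ultimately show ?thesis
    unfolding smooth_at_def using O T OT
    by (intro exI[of _ D] exI[of _ c] exI[of _ D'] exI[of _ c'] exI[of _ "O' \<inter> T"]) auto
qed

lemma smooth_at_compose:
  assumes M: "smooth_atlas M" and N: "smooth_atlas N" and P: "smooth_atlas P"
    and g: "smooth_at N P g (f x)" and f: "smooth_at M N f x"
  shows "smooth_at M P (\<lambda>x. g (f x)) x"
proof -
  obtain D c where Dc: "(D, c) \<in> atlas M" "x \<in> D"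
    using chart_at[OF M smooth_at_in_points(1)[OF M N f]] .
  obtain E e where E: "(E, e) \<in> atlas N" "f x \<in> E"
    using chart_at[OF N smooth_at_in_points(2)[OF M N f]] .
  obtain H h where H: "(H, h) \<in> atlas P" "g (f x) \<in> H"
    using chart_at[OF P smooth_at_in_points(2)[OF N P g]] .
  obtain T where T: "openin (mtop N) T" "f x \<in> T" "T \<subseteq> E" "g ` T \<subseteq> H"
    "smooth_on (e ` T) (\<lambda>y. h (g (inv_into E e y)))"
    using smooth_at_charts[OF N P g E H] .
  obtain S where S: "openin (mtop M) S" "x \<in> S" "S \<subseteq> D" "f ` S \<subseteq> E"
    "smooth_on (c ` S) (\<lambda>y. e (f (inv_into D c y)))"
    using smooth_at_charts[OF M N f Dc E] .
  define O' where "O' = {y \<in> S. f y \<in> T}"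
  have O: "openin (mtop M) O'"
    unfolding O'_def
    by (rule open_preimage_in_charts[OF M N Dc(1) E(1) S(1,3,4) smooth_on_imp_continuous_on[OF S(5)] T(1)])
  have sub: "O' \<subseteq> S" "O' \<subseteq> D" "f ` O' \<subseteq> T" "f ` O' \<subseteq> E" using S by (auto simp: O'_def)
  then have pt: "y \<in> O' \<Longrightarrow> y \<in> D" "y \<in> O' \<Longrightarrow> f y \<in> T" "y \<in> O' \<Longrightarrow> f y \<in> E" for y by auto
  have opn: "open (c ` O')" "open (e ` T)"
    using chart_image_open[OF M Dc(1) O] chart_image_open[OF N E(1) T(1)] T sub by auto
  have "smooth_on (c ` O') (\<lambda>y. e (f (inv_into D c y)))"
    using S(5) by (rule smooth_on_subset) (use sub in auto)
  from smooth_on_compose[OF T(5) this opn]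
  have "smooth_on (c ` O') (\<lambda>y. h (g (inv_into E e (e (f (inv_into D c y))))))"
    using pt chart_inv[OF M Dc(1)] by (simp add: image_subset_iff)
  then have "smooth_on (c ` O') (\<lambda>y. h (g (f (inv_into D c y))))"
    by (rule smooth_on_cong[OF opn(1), rotated])
       (use pt chart_inv[OF M Dc(1)] chart_inv[OF N E(1)] in auto)
  then show ?thesis
    unfolding smooth_at_def using Dc H O sub S T
    by (intro exI[of _ D] exI[of _ c] exI[of _ H] exI[of _ h] exI[of _ O'])
       (auto simp: O'_def image_subset_iff)
qed

section \<open>Euclidean spaces and products\<close>

lemma smooth_atlas_euclidean [simp]: "smooth_atlas (euclidean_mfd :: ('e::euclidean_space, 'e) mfd)"
proof -
  have "homeomorphic_map (top_of_set UNIV) (top_of_set UNIV) (id :: 'e \<Rightarrow> 'e)"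
    by simp
  moreover have "inv_into UNIV id = (id :: 'e \<Rightarrow> 'e)" by (simp add: inv_id)
  ultimately show ?thesis
    by (auto simp: smooth_atlas_def euclidean_mfd_def chart_on_def id_def comp_def intro!: smooth_intros)
qed

lemma mtop_euclidean [simp]: "mtop euclidean_mfd = euclidean"
  by (simp add: euclidean_mfd_def)

lemma smooth_at_euclidean:
  "open S \<Longrightarrow> x \<in> S \<Longrightarrow> smooth_on S f \<Longrightarrow> smooth_at euclidean_mfd euclidean_mfd f x"
  unfolding smooth_at_def euclidean_mfd_def
  by (intro exI[of _ UNIV] exI[of _ id] exI[of _ S]) (auto simp: inv_id)

lemma smooth_at_compose_smooth_on:
  assumes "smooth_atlas M" "smooth_at M euclidean_mfd f x" "smooth_on S F" "open S" "f x \<in> S"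
  shows "smooth_at M euclidean_mfd (\<lambda>y. F (f y)) x"
  using assms by (intro smooth_at_compose[of M euclidean_mfd euclidean_mfd F f] smooth_at_euclidean[of S]) auto

lemma smooth_at_const:
  assumes M: "smooth_atlas M" and N: "smooth_atlas N" and x: "x \<in> points M" and y: "y \<in> points N"
  shows "smooth_at M N (\<lambda>_. y) x"
proof -
  obtain D c where Dc: "(D, c) \<in> atlas M" "x \<in> D" using chart_at[OF M x] .
  obtain D' c' where Dc': "(D', c') \<in> atlas N" "y \<in> D'" using chart_at[OF N y] .
  show ?thesis unfolding smooth_at_def
    using Dc Dc' chart_open[OF M Dc(1)]
    by (intro exI[of _ D] exI[of _ c] exI[of _ D'] exI[of _ c']) (auto intro: smooth_intros)
qed

lemma smooth_at_id:
  assumes M: "smooth_atlas M" and x: "x \<in> points M"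
  shows "smooth_at M M (\<lambda>x. x) x"
proof -
  obtain D c where Dc: "(D, c) \<in> atlas M" "x \<in> D" using chart_at[OF M x] .
  have "smooth_on (c ` D) (\<lambda>y. c (inv_into D c y))"
    by (rule smooth_on_cong[OF _ _ smooth_on_id]) (use chart_open[OF M Dc(1)] in \<open>auto simp: f_inv_into_f\<close>)
  then show ?thesis unfolding smooth_at_def
    using Dc chart_open[OF M Dc(1)] by blast
qed

lemma inv_into_map_prod:
  assumes "inj_on c D" "inj_on c' D'" "p \<in> c ` D \<times> c' ` D'"
  shows "inv_into (D \<times> D') (map_prod c c') p = (inv_into D c (fst p), inv_into D' c' (snd p))"
proof -
  have "inj_on (map_prod c c') (D \<times> D')" using assms(1,2) by (rule map_prod_inj_on)
  moreover obtain x y where "p = map_prod c c' (x, y)" "x \<in> D" "y \<in> D'" using assms(3) by auto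
  ultimately show ?thesis using assms(1,2) by (simp add: inv_into_f_eq)
qed

lemma mtop_prod_mfd [simp]: "mtop (M \<times>\<^sub>M N) = prod_topology (mtop M) (mtop N)"
  by (simp add: prod_mfd_def)

lemma smooth_atlas_prod [simp]:
  assumes M: "smooth_atlas M" and N: "smooth_atlas N"
  shows "smooth_atlas (M \<times>\<^sub>M N)"
proof (rule smooth_atlasI, goal_cases)
  case (1 D0 c0)
  then obtain D c D' c' where q: "D0 = D \<times> D'" "c0 = map_prod c c'"
    and Dc: "(D, c) \<in> atlas M" and Dc': "(D', c') \<in> atlas N"
    by (auto simp: prod_mfd_def)
  have img: "map_prod c c' ` (D \<times> D') = c ` D \<times> c' ` D'" by (auto simp: map_prod_def)
  have "homeomorphic_map (prod_topology (subtopology (mtop M) D) (subtopology (mtop N) D'))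
      (prod_topology (top_of_set (c ` D)) (top_of_set (c' ` D'))) (\<lambda>(x, y). (c x, c' y))"
  proof -
    obtain g g' where "homeomorphic_maps (subtopology (mtop M) D) (top_of_set (c ` D)) c g"
      "homeomorphic_maps (subtopology (mtop N) D') (top_of_set (c' ` D')) c' g'"
      using chart_homeo[OF M Dc] chart_homeo[OF N Dc'] unfolding homeomorphic_map_maps by auto
    then have "homeomorphic_maps (prod_topology (subtopology (mtop M) D) (subtopology (mtop N) D'))
        (prod_topology (top_of_set (c ` D)) (top_of_set (c' ` D')))
        (\<lambda>(x, y). (c x, c' y)) (\<lambda>(x, y). (g x, g' y))"
      unfolding homeomorphic_maps_prod by blast
    then show ?thesis unfolding homeomorphic_map_maps by blast
  qed
  moreover have "(\<lambda>(x, y). (c x, c' y)) = map_prod c c'" by (auto simp: map_prod_def)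
  ultimately have "homeomorphic_map (subtopology (prod_topology (mtop M) (mtop N)) (D \<times> D'))
      (top_of_set (c ` D \<times> c' ` D')) (map_prod c c')"
    by (simp add: subtopology_Times)
  then show ?case
    using chart_open[OF M Dc] chart_open[OF N Dc']
    by (simp add: q chart_on_def img openin_prod_Times_iff open_Times)
next
  case (2 x)
  then have "fst x \<in> points M" "snd x \<in> points N" by (auto simp: prod_mfd_def)
  then obtain D c D' c' where "(D, c) \<in> atlas M" "fst x \<in> D" "(D', c') \<in> atlas N" "snd x \<in> D'"
    using chart_at[OF M] chart_at[OF N] by metis
  then show ?case
    by (intro exI[of _ "D \<times> D'"] exI[of _ "map_prod c c'"]) (auto simp: prod_mfd_def mem_Times_iff)
next
  case (3 D0 c0 E0 e0)
  obtain D c D' c' where q: "D0 = D \<times> D'" "c0 = map_prod c c'"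
    and Dc: "(D, c) \<in> atlas M" and Dc': "(D', c') \<in> atlas N"
    using 3 by (auto simp: prod_mfd_def)
  obtain E e E' e' where r: "E0 = E \<times> E'" "e0 = map_prod e e'"
    and Ee: "(E, e) \<in> atlas M" and Ee': "(E', e') \<in> atlas N"
    using 3 by (auto simp: prod_mfd_def)
  have img: "map_prod c c' ` (D \<times> D' \<inter> E \<times> E') = c ` (D \<inter> E) \<times> c' ` (D' \<inter> E')"
    by (auto simp: map_prod_def Times_Int_Times)
  have o: "open (c ` (D \<inter> E))" "open (c' ` (D' \<inter> E'))"
    using chart_open(1)[OF M Dc] chart_open(1)[OF M Ee] chart_open(1)[OF N Dc'] chart_open(1)[OF N Ee']
    by (auto intro!: chart_image_open[OF M Dc] chart_image_open[OF N Dc'])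
  have "smooth_on (c ` (D \<inter> E) \<times> c' ` (D' \<inter> E'))
      (\<lambda>p. ((e \<circ> inv_into D c) (fst p), (e' \<circ> inv_into D' c') (snd p)))"
    by (intro smooth_on_Pair smooth_on_compose[OF chart_transition[OF M Dc Ee] _ _ o(1)]
          smooth_on_compose[OF chart_transition[OF N Dc' Ee'] _ _ o(2)] smooth_intros open_Times o) auto
  then have "smooth_on (c ` (D \<inter> E) \<times> c' ` (D' \<inter> E'))
      (map_prod e e' \<circ> inv_into (D \<times> D') (map_prod c c'))"
    by (rule smooth_on_cong[OF open_Times[OF o], rotated])
       (auto simp: inv_into_map_prod[OF chart_inj[OF M Dc] chart_inj[OF N Dc']])
  then show ?case by (simp add: q r img)
qed

lemma smooth_at_fst_snd:
  assumes M: "smooth_atlas M" and N: "smooth_atlas N" and p: "p \<in> points M \<times> points N"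
  shows "smooth_at (M \<times>\<^sub>M N) M fst p" "smooth_at (M \<times>\<^sub>M N) N snd p"
proof -
  obtain D c where Dc: "(D, c) \<in> atlas M" "fst p \<in> D" using chart_at[OF M] p by (metis mem_Times_iff)
  obtain D' c' where Dc': "(D', c') \<in> atlas N" "snd p \<in> D'" using chart_at[OF N] p by (metis mem_Times_iff)
  have at: "(D \<times> D', map_prod c c') \<in> atlas (M \<times>\<^sub>M N)" using Dc Dc' by (auto simp: prod_mfd_def)
  have opn: "openin (mtop (M \<times>\<^sub>M N)) (D \<times> D')"
    using chart_open(1)[OF smooth_atlas_prod[OF M N] at] .
  have img: "map_prod c c' ` (D \<times> D') = c ` D \<times> c' ` D'" by (auto simp: map_prod_def)
  have o: "open (c ` D \<times> c' ` D')" using chart_open[OF M Dc(1)] chart_open[OF N Dc'(1)] by (simp add: open_Times)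
  have inv: "inv_into (D \<times> D') (map_prod c c') y = (inv_into D c (fst y), inv_into D' c' (snd y))"
    if "y \<in> c ` D \<times> c' ` D'" for y
    using inv_into_map_prod[OF chart_inj[OF M Dc(1)] chart_inj[OF N Dc'(1)] that] .
  have "smooth_on (c ` D \<times> c' ` D') (\<lambda>y. c (fst (inv_into (D \<times> D') (map_prod c c') y)))"
    by (rule smooth_on_cong[OF o _ smooth_on_fst[OF smooth_on_id[OF o] o]])
       (auto simp: inv f_inv_into_f)
  then show "smooth_at (M \<times>\<^sub>M N) M fst p"
    unfolding smooth_at_def using at Dc Dc' opn img p
    by (intro exI[of _ "D \<times> D'"] exI[of _ "map_prod c c'"] exI[of _ D] exI[of _ c])
       (auto simp: mem_Times_iff)
  have "smooth_on (c ` D \<times> c' ` D') (\<lambda>y. c' (snd (inv_into (D \<times> D') (map_prod c c') y)))"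
    by (rule smooth_on_cong[OF o _ smooth_on_snd[OF smooth_on_id[OF o] o]])
       (auto simp: inv f_inv_into_f)
  then show "smooth_at (M \<times>\<^sub>M N) N snd p"
    unfolding smooth_at_def using at Dc Dc' opn img p
    by (intro exI[of _ "D \<times> D'"] exI[of _ "map_prod c c'"] exI[of _ D'] exI[of _ c'])
       (auto simp: mem_Times_iff)
qed

lemma smooth_at_Pair:
  assumes M: "smooth_atlas M" and N: "smooth_atlas N" and P: "smooth_atlas P"
    and f: "smooth_at M N f x" and g: "smooth_at M P g x"
  shows "smooth_at M (N \<times>\<^sub>M P) (\<lambda>x. (f x, g x)) x"
proof -
  obtain D c where Dc: "(D, c) \<in> atlas M" "x \<in> D"
    using chart_at[OF M smooth_at_in_points(1)[OF M N f]] .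
  obtain E e where E: "(E, e) \<in> atlas N" "f x \<in> E"
    using chart_at[OF N smooth_at_in_points(2)[OF M N f]] .
  obtain H h where H: "(H, h) \<in> atlas P" "g x \<in> H"
    using chart_at[OF P smooth_at_in_points(2)[OF M P g]] .
  obtain S where S: "openin (mtop M) S" "x \<in> S" "S \<subseteq> D" "f ` S \<subseteq> E"
    "smooth_on (c ` S) (\<lambda>y. e (f (inv_into D c y)))"
    using smooth_at_charts[OF M N f Dc E] .
  obtain T where T: "openin (mtop M) T" "x \<in> T" "T \<subseteq> D" "g ` T \<subseteq> H"
    "smooth_on (c ` T) (\<lambda>y. h (g (inv_into D c y)))"
    using smooth_at_charts[OF M P g Dc H] .
  have ST: "openin (mtop M) (S \<inter> T)" using S T by blast
  have o: "open (c ` (S \<inter> T))" using chart_image_open[OF M Dc(1) ST] S by auto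
  have "smooth_on (c ` (S \<inter> T)) (\<lambda>y. (e (f (inv_into D c y)), h (g (inv_into D c y))))"
    by (intro smooth_on_Pair o smooth_on_subset[OF S(5)] smooth_on_subset[OF T(5)]) auto
  moreover have "(E \<times> H, map_prod e h) \<in> atlas (N \<times>\<^sub>M P)" using E H by (auto simp: prod_mfd_def)
  ultimately show ?thesis
    unfolding smooth_at_def using Dc S T ST
    by (intro exI[of _ D] exI[of _ c] exI[of _ "E \<times> H"] exI[of _ "map_prod e h"] exI[of _ "S \<inter> T"]) auto
qed

text \<open>Here the target is the Euclidean space of product type with its single chart, not the
  product manifold of \<open>smooth_at_Pair\<close>. The formulas of the model are smooth on subsets
  of the former.\<close>

lemma smooth_at_euclidean_Pair:
  assumes M: "smooth_atlas M" and f: "smooth_at M euclidean_mfd f x" and g: "smooth_at M euclidean_mfd g x"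
  shows "smooth_at M euclidean_mfd (\<lambda>x. (f x, g x)) x"
proof -
  obtain D c where Dc: "(D, c) \<in> atlas M" "x \<in> D"
    using chart_at[OF M smooth_at_in_points(1)[OF M _ f]] by auto
  have E: "(UNIV, id) \<in> atlas (euclidean_mfd :: ('x::euclidean_space, 'x) mfd)" by (simp add: euclidean_mfd_def)
  obtain S where S: "openin (mtop M) S" "x \<in> S" "S \<subseteq> D"
    "smooth_on (c ` S) (\<lambda>y. id (f (inv_into D c y)))"
    using smooth_at_charts[OF M _ f Dc E] by auto
  obtain T where T: "openin (mtop M) T" "x \<in> T" "T \<subseteq> D"
    "smooth_on (c ` T) (\<lambda>y. id (g (inv_into D c y)))"
    using smooth_at_charts[OF M _ g Dc E] by auto
  have ST: "openin (mtop M) (S \<inter> T)" using S T by blast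
  have o: "open (c ` (S \<inter> T))" using chart_image_open[OF M Dc(1) ST] S by auto
  have "smooth_on (c ` (S \<inter> T)) (\<lambda>y. (id (f (inv_into D c y)), id (g (inv_into D c y))))"
    by (intro smooth_on_Pair o smooth_on_subset[OF S(4)] smooth_on_subset[OF T(4)]) auto
  then show ?thesis
    unfolding smooth_at_def using Dc S T ST E
    by (intro exI[of _ D] exI[of _ c] exI[of _ UNIV] exI[of _ id] exI[of _ "S \<inter> T"]) auto
qed

text \<open>Both manifolds have the same model space, so an injective derivative is bijective and
  the inverse function theorem applies in charts. As \<open>f\<close> is injective, the local
  inverses are restrictions of a single map.\<close>

lemma immersion_inverse_smooth:
  fixes U :: "('a, 'e::euclidean_space) mfd" and V :: "('b, 'e) mfd"
  assumes U: "smooth_atlas U" and V: "smooth_atlas V"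
    and f: "immersion U V f" and inj: "inj_on f (points U)"
  shows "openin (mtop V) (f ` points U)"
    and "x \<in> points U \<Longrightarrow> smooth_at V U (inv_into (points U) f) (f x)"
proof -
  have key: "\<exists>W. openin (mtop V) W \<and> f x \<in> W \<and> W \<subseteq> f ` points U \<and>
      smooth_at V U (inv_into (points U) f) (f x)" if x: "x \<in> points U" for x
  proof -
    have sm: "smooth_at U V f x" using f smooth_map_iff_smooth_at[OF U V] x by (auto simp: immersion_def)
    obtain D c where Dc: "(D, c) \<in> atlas U" "x \<in> D" using chart_at[OF U x] .
    obtain D' c' where Dc': "(D', c') \<in> atlas V" "f x \<in> D'"
      using chart_at[OF V smooth_at_in_points(2)[OF U V sm]] .
    obtain T where T: "openin (mtop U) T" "x \<in> T" "T \<subseteq> D" "f ` T \<subseteq> D'"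
      "smooth_on (c ` T) (\<lambda>y. c' (f (inv_into D c y)))"
      using smooth_at_charts[OF U V sm Dc Dc'] .
    have pt: "y \<in> T \<Longrightarrow> y \<in> D" "y \<in> T \<Longrightarrow> f y \<in> D'" "y \<in> T \<Longrightarrow> y \<in> points U" for y
      using T chart_subset[OF U Dc(1)] by auto
    define g where "g = (\<lambda>y. c' (f (inv_into D c y)))"
    define h where "h = (\<lambda>z. c (inv_into (points U) f (inv_into D' c' z)))"
    have o: "open (c ` T)" using chart_image_open[OF U Dc(1) T(1,3)] .
    have hg: "h (g y) = y" if "y \<in> c ` T" for y
      using that pt chart_inv[OF U Dc(1)] chart_inv[OF V Dc'(1)] inj by (auto simp: h_def g_def)
    have injd: "inj (frechet_derivative g (at y))" if y: "y \<in> c ` T" for y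
    proof -
      obtain u where u: "u \<in> T" "y = c u" using y by auto
      have "inj (chart_derivative D c c' f u)"
        using f Dc(1) Dc'(1) pt[OF u(1)] by (fastforce simp: immersion_def)
      then show ?thesis
        using u by (simp add: chart_derivative_def g_def comp_def)
    qed
    have gT: "g ` (c ` T) = c' ` (f ` T)"
      using pt chart_inv[OF U Dc(1)] by (force simp: g_def image_image)
    have og: "open (c' ` (f ` T))" and sh: "smooth_on (c' ` (f ` T)) h"
      using smooth_on_inverse_function[OF o T(5)[folded g_def] hg injd] gT by auto
    define W where "W = {y \<in> D'. c' y \<in> c' ` (f ` T)}"
    have W: "openin (mtop V) W" unfolding W_def by (rule chart_preimage_open[OF V Dc'(1) og])
    have Weq: "W = f ` T"
      using T(4) chart_inj[OF V Dc'(1)] by (auto simp: W_def inj_on_def)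
    have "inv_into (points U) f ` W \<subseteq> D" using pt inj by (auto simp: Weq)
    then have "smooth_at V U (inv_into (points U) f) (f x)"
      unfolding smooth_at_def using Dc Dc' W T sh Weq
      by (intro exI[of _ D'] exI[of _ c'] exI[of _ D] exI[of _ c] exI[of _ W]) (auto simp: h_def)
    moreover have "f x \<in> W" "W \<subseteq> f ` points U" using Weq T(2) pt(3) by auto
    ultimately show ?thesis using W by (intro exI[of _ W]) simp
  qed
  show "openin (mtop V) (f ` points U)"
    by (subst openin_subopen) (use key in blast)
  show "x \<in> points U \<Longrightarrow> smooth_at V U (inv_into (points U) f) (f x)"
    using key by blast
qed

text \<open>Near \<open>q p\<close> the composite of \<open>s\<close> and \<open>q\<close> is the
  identity, so the derivative of \<open>s\<close> is a right inverse of that of \<open>q\<close>.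
  The condition \<open>s (q p) = p\<close> places the conclusion at \<open>p\<close> rather than
  elsewhere in its fibre.\<close>

lemma submersion_if_sections:
  assumes M: "smooth_atlas M" and V: "smooth_atlas V" and q: "smooth_map M V q"
    and sec: "\<And>p. p \<in> points M \<Longrightarrow> \<exists>s W. openin (mtop V) W \<and> q p \<in> W \<and> (\<forall>v\<in>W. q (s v) = v) \<and>
      s (q p) = p \<and> smooth_at V M s (q p)"
  shows "submersion M V q"
  unfolding submersion_def
proof (intro conjI q ballI, clarify)
  fix D c D' c' x
  assume Dc: "(D, c) \<in> atlas M" and Dc': "(D', c') \<in> atlas V" and x: "x \<in> D" and qx: "q x \<in> D'"
  have xM: "x \<in> points M" using chart_subset[OF M Dc] x by auto
  have qs: "smooth_at M V q x" using q smooth_map_iff_smooth_at[OF M V] xM by auto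
  obtain s W where W: "openin (mtop V) W" "q x \<in> W" "\<And>v. v \<in> W \<Longrightarrow> q (s v) = v"
    and s: "s (q x) = x" "smooth_at V M s (q x)" using sec[OF xM] by blast
  obtain T where T: "openin (mtop M) T" "x \<in> T" "T \<subseteq> D" "smooth_on (c ` T) (\<lambda>y. c' (q (inv_into D c y)))"
    using smooth_at_charts[OF M V qs Dc x Dc' qx] by metis
  have "s (q x) \<in> D" using s x by simp
  then obtain R where R: "openin (mtop V) R" "q x \<in> R" "R \<subseteq> D'" "s ` R \<subseteq> D"
    "smooth_on (c' ` R) (\<lambda>y. c (s (inv_into D' c' y)))"
    using smooth_at_charts[OF V M s(2) Dc' qx Dc] by metis
  have inv: "inv_into D' c' (c' (q x)) = q x" using chart_inv[OF V Dc' qx] .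
  define Q where "Q = (\<lambda>y. c' (q (inv_into D c y)))"
  define S where "S = (\<lambda>y. c (s (inv_into D' c' y)))"
  have "(Q has_derivative frechet_derivative Q (at (c x))) (at (c x))"
    using smooth_on_has_derivative[OF T(4)] T(2) unfolding Q_def by auto
  moreover have Sx: "S (c' (q x)) = c x" by (simp add: S_def inv s)
  ultimately have dQ: "(Q has_derivative frechet_derivative Q (at (c x))) (at (S (c' (q x))))" by simp
  have dS: "(S has_derivative frechet_derivative S (at (c' (q x)))) (at (c' (q x)))"
    using smooth_on_has_derivative[OF R(5)] R(2) unfolding S_def by auto
  have WR: "openin (mtop V) (W \<inter> R)" using W R by blast
  have o: "open (c' ` (W \<inter> R))" using chart_image_open[OF V Dc' WR] R by auto
  have "((\<lambda>y. Q (S y)) has_derivative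
      (\<lambda>v. frechet_derivative Q (at (c x)) (frechet_derivative S (at (c' (q x))) v))) (at (c' (q x)))"
    using has_derivative_compose[OF dS dQ] .
  then have "((\<lambda>y. y) has_derivative
      (\<lambda>v. frechet_derivative Q (at (c x)) (frechet_derivative S (at (c' (q x))) v))) (at (c' (q x)))"
  proof (rule has_derivative_transform_within_open[OF _ o])
    show "c' (q x) \<in> c' ` (W \<inter> R)" using W R by auto
    fix y assume "y \<in> c' ` (W \<inter> R)"
    then obtain v where v: "v \<in> W" "v \<in> R" "y = c' v" by auto
    then have "v \<in> D'" "s v \<in> D" using R by auto
    then show "Q (S y) = y"
      using v W by (simp add: Q_def S_def chart_inv[OF V Dc'] chart_inv[OF M Dc])
  qed
  then have "frechet_derivative Q (at (c x)) (frechet_derivative S (at (c' (q x))) v) = v" for v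
    using has_derivative_unique[OF has_derivative_ident] by metis
  then have "surj (frechet_derivative Q (at (c x)))" by (metis surjI)
  then show "surj (chart_derivative D c c' q x)"
    by (simp add: chart_derivative_def Q_def comp_def)
qed

section \<open>The smooth structure of an orbit space\<close>

definition transport_mfd :: "'q topology \<Rightarrow> ('q \<Rightarrow> 'b) \<Rightarrow> ('b, 'e) mfd \<Rightarrow> ('q, 'e) mfd" where
  "transport_mfd X d V =
     \<lparr>mtop = X, atlas = (\<lambda>(D, c). ({x \<in> topspace X. d x \<in> D}, c \<circ> d)) ` atlas V\<rparr>"

context
  fixes X :: "'q topology" and d :: "'q \<Rightarrow> 'b" and V :: "('b, 'e::euclidean_space) mfd"
  assumes V: "smooth_atlas V" and d: "homeomorphic_map X (mtop V) d"
begin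

lemma transport_bij: "d ` topspace X = points V" "inj_on d (topspace X)"
  using d by (auto simp: homeomorphic_eq_everything_map)

lemma inv_into_transport:
  assumes Dc: "(D, c) \<in> atlas V" and y: "y \<in> c ` D"
  shows "inv_into {x \<in> topspace X. d x \<in> D} (c \<circ> d) y = inv_into (topspace X) d (inv_into D c y)"
    "inv_into (topspace X) d (inv_into D c y) \<in> {x \<in> topspace X. d x \<in> D}"
    "d (inv_into (topspace X) d (inv_into D c y)) = inv_into D c y"
proof -
  have 1: "inv_into D c y \<in> D" using y by (simp add: inv_into_into)
  then have 2: "inv_into D c y \<in> d ` topspace X" using chart_subset[OF V Dc] transport_bij by auto
  show 3: "d (inv_into (topspace X) d (inv_into D c y)) = inv_into D c y"
    using 2 by (simp add: f_inv_into_f)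
  show 4: "inv_into (topspace X) d (inv_into D c y) \<in> {x \<in> topspace X. d x \<in> D}"
    using 1 2 3 by (simp add: inv_into_into)
  have "inj_on (c \<circ> d) {x \<in> topspace X. d x \<in> D}"
    using chart_inj[OF V Dc] transport_bij(2) by (auto simp: inj_on_def)
  then show "inv_into {x \<in> topspace X. d x \<in> D} (c \<circ> d) y = inv_into (topspace X) d (inv_into D c y)"
    using 3 4 y by (intro inv_into_f_eq) (auto simp: f_inv_into_f)
qed

lemma transport_image: "D \<subseteq> points V \<Longrightarrow> d ` {x \<in> topspace X. d x \<in> D} = D"
  using transport_bij(1) by (auto simp: image_iff)

lemma smooth_atlas_transport: "smooth_atlas (transport_mfd X d V)"
proof (rule smooth_atlasI, goal_cases)
  case (1 D0 c0)
  then obtain D c where q: "D0 = {x \<in> topspace X. d x \<in> D}" "c0 = c \<circ> d" and Dc: "(D, c) \<in> atlas V"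
    by (auto simp: transport_mfd_def)
  have D: "D \<subseteq> points V" by (rule chart_subset[OF V Dc])
  have img: "(c \<circ> d) ` {x \<in> topspace X. d x \<in> D} = c ` D"
    using transport_image[OF D] by (metis image_comp)
  have "openin X {x \<in> topspace X. d x \<in> D}"
    using d chart_open(1)[OF V Dc] by (intro openin_continuous_map_preimage homeomorphic_imp_continuous_map)
  moreover have "homeomorphic_map (subtopology X {x \<in> topspace X. d x \<in> D}) (subtopology (mtop V) D) d"
    using d D by (intro homeomorphic_map_subtopologies) (use transport_image[OF D] in \<open>auto simp: Int_absorb1\<close>)
  then have "homeomorphic_map (subtopology X {x \<in> topspace X. d x \<in> D}) (top_of_set (c ` D)) (c \<circ> d)"
    using chart_homeo[OF V Dc] by (rule homeomorphic_map_compose)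
  ultimately show ?case
    using chart_open(2)[OF V Dc] by (simp only: q chart_on_def img transport_mfd_def mfd.simps)
next
  case (2 x)
  then have "d x \<in> points V" using transport_bij(1) by (auto simp: transport_mfd_def)
  then obtain D c where "(D, c) \<in> atlas V" "d x \<in> D" using chart_at[OF V] by blast
  then show ?case
    using 2 by (intro exI[of _ "{x \<in> topspace X. d x \<in> D}"] exI[of _ "c \<circ> d"])
      (force simp: transport_mfd_def)
next
  case (3 D0 c0 E0 e0)
  obtain D c where q: "D0 = {x \<in> topspace X. d x \<in> D}" "c0 = c \<circ> d" and Dc: "(D, c) \<in> atlas V"
    using 3 by (auto simp: transport_mfd_def)
  obtain E e where r: "E0 = {x \<in> topspace X. d x \<in> E}" "e0 = e \<circ> d" and Ee: "(E, e) \<in> atlas V"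
    using 3 by (auto simp: transport_mfd_def)
  have DE: "openin (mtop V) (D \<inter> E)" using chart_open(1)[OF V Dc] chart_open(1)[OF V Ee] by blast
  have o: "open (c ` (D \<inter> E))" using chart_image_open[OF V Dc DE] by auto
  have sub: "D \<inter> E \<subseteq> points V" using DE by (rule openin_subset)
  have img: "(c \<circ> d) ` ({x \<in> topspace X. d x \<in> D} \<inter> {x \<in> topspace X. d x \<in> E}) = c ` (D \<inter> E)"
  proof -
    have "{x \<in> topspace X. d x \<in> D} \<inter> {x \<in> topspace X. d x \<in> E} = {x \<in> topspace X. d x \<in> D \<inter> E}"
      by auto
    then show ?thesis using transport_image[OF sub] by (metis image_comp)
  qed
  have "smooth_on (c ` (D \<inter> E)) ((e \<circ> d) \<circ> inv_into {x \<in> topspace X. d x \<in> D} (c \<circ> d))"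
  proof (rule smooth_on_cong[OF o _ chart_transition[OF V Dc Ee]])
    fix y assume "y \<in> c ` (D \<inter> E)"
    then have "y \<in> c ` D" by auto
    then show "(e \<circ> inv_into D c) y = ((e \<circ> d) \<circ> inv_into {x \<in> topspace X. d x \<in> D} (c \<circ> d)) y"
      by (simp add: inv_into_transport[OF Dc])
  qed
  then show ?case by (simp only: q r img)
qed

lemma smooth_at_transport:
  "x \<in> topspace X \<Longrightarrow> smooth_at (transport_mfd X d V) V d x"
  "x \<in> topspace X \<Longrightarrow> smooth_at V (transport_mfd X d V) (inv_into (topspace X) d) (d x)"
proof -
  assume x: "x \<in> topspace X"
  then have "d x \<in> points V" using transport_bij(1) by auto
  then obtain D c where Dc: "(D, c) \<in> atlas V" "d x \<in> D" using chart_at[OF V] by blast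
  have D: "D \<subseteq> points V" by (rule chart_subset[OF V Dc(1)])
  define D' where "D' = {x \<in> topspace X. d x \<in> D}"
  have at: "(D', c \<circ> d) \<in> atlas (transport_mfd X d V)" using Dc by (force simp: transport_mfd_def D'_def)
  have D'o: "openin (mtop (transport_mfd X d V)) D'" by (rule chart_open(1)[OF smooth_atlas_transport at])
  have img: "(c \<circ> d) ` D' = c ` D"
    unfolding D'_def using transport_image[OF D] by (metis image_comp)
  have o: "open (c ` D)" by (rule chart_open(2)[OF V Dc(1)])
  have "smooth_on (c ` D) (\<lambda>y. c (d (inv_into D' (c \<circ> d) y)))"
    by (rule smooth_on_cong[OF o _ smooth_on_id[OF o]])
       (simp add: D'_def inv_into_transport[OF Dc(1)] f_inv_into_f)
  then show "smooth_at (transport_mfd X d V) V d x"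
    unfolding smooth_at_def using at Dc D'o img x
    by (intro exI[of _ D'] exI[of _ "c \<circ> d"] exI[of _ D] exI[of _ c]) (auto simp: D'_def)
  have "smooth_on (c ` D) (\<lambda>y. (c \<circ> d) (inv_into (topspace X) d (inv_into D c y)))"
    by (rule smooth_on_cong[OF o _ smooth_on_id[OF o]])
       (simp add: inv_into_transport[OF Dc(1)] f_inv_into_f)
  moreover have "inv_into (topspace X) d ` D \<subseteq> D'"
    using D transport_bij by (auto simp: D'_def inv_into_into f_inv_into_f)
  ultimately show "smooth_at V (transport_mfd X d V) (inv_into (topspace X) d) (d x)"
    unfolding smooth_at_def using at Dc chart_open(1)[OF V Dc(1)]
    by (intro exI[of _ D] exI[of _ c] exI[of _ D'] exI[of _ "c \<circ> d"]) auto
qed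

end

lemma mtop_transport [simp]: "mtop (transport_mfd X d V) = X"
  by (simp add: transport_mfd_def)

text \<open>The orbit space receives the atlas of \<open>V\<close> through the bijection
  \<open>d\<close> induced by \<open>q\<close>. The local sections serve twice: they show that
  \<open>q\<close> is a quotient map, whence \<open>d\<close> is a homeomorphism, and that
  \<open>orbit \<phi>\<close> is a submersion. Outside of the points of \<open>M\<close> the map
  \<open>q'\<close> may differ from \<open>q\<close>.\<close>

lemma has_quotient_if_sections:
  assumes M: "smooth_atlas M" and V: "smooth_manifold V" and q: "smooth_map M V q"
    and surj: "q ` points M = points V"
    and orb: "\<And>x y. x \<in> points M \<Longrightarrow> y \<in> points M \<Longrightarrow> orbit \<phi> x = orbit \<phi> y \<longleftrightarrow> q x = q y"
    and sec: "\<And>p. p \<in> points M \<Longrightarrow> \<exists>s W. openin (mtop V) W \<and> q p \<in> W \<and> (\<forall>v\<in>W. q (s v) = v) \<and>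
      s (q p) = p \<and> smooth_at V M s (q p)"
  obtains q' where "has_quotient M \<phi> V q'" "\<And>x. x \<in> points M \<Longrightarrow> q' x = q x"
proof -
  have VA: "smooth_atlas V" using V by (simp add: smooth_manifold_def)
  define d where "d W = q (SOME x. x \<in> points M \<and> orbit \<phi> x = W)" for W
  define X where "X = orbit_space (mtop M) \<phi>"
  have topX: "topspace X = orbit \<phi> ` points M" by (simp add: X_def)
  have dq: "d (orbit \<phi> x) = q x" if "x \<in> points M" for x
  proof -
    have "\<exists>y. y \<in> points M \<and> orbit \<phi> y = orbit \<phi> x" using that by auto
    from someI_ex[OF this] orb that show ?thesis unfolding d_def by blast
  qed
  have q_at: "smooth_at M V q x" if "x \<in> points M" for x
    using q smooth_map_iff_smooth_at[OF M VA] that by auto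
  have qcont: "continuous_map (mtop M) (mtop V) q" using q by (simp add: smooth_map_def)
  have qquot: "openin (mtop V) W" if sW: "W \<subseteq> points V" and oW: "openin (mtop M) {x \<in> points M. q x \<in> W}" for W
  proof (subst openin_subopen, clarify)
    fix v assume v: "v \<in> W"
    then have "v \<in> q ` points M" using sW surj by auto
    then obtain p where p: "p \<in> points M" "q p = v" by auto
    then obtain s T where T: "openin (mtop V) T" "v \<in> T" "\<And>v. v \<in> T \<Longrightarrow> q (s v) = v" "s v = p"
      and s: "smooth_at V M s v" using sec[OF p(1), unfolded p(2)] by blast
    obtain R where R: "openin (mtop V) R" "v \<in> R" "s ` R \<subseteq> {x \<in> points M. q x \<in> W}"
      using smooth_at_open_nhd[OF VA M s oW] T p v by auto
    have "T \<inter> R \<subseteq> W" using R T by force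
    then show "\<exists>T. openin (mtop V) T \<and> v \<in> T \<and> T \<subseteq> W"
      using R T by (intro exI[of _ "T \<inter> R"]) auto
  qed
  have injd: "inj_on d (topspace X)" using topX dq orb by (auto simp: inj_on_def)
  have imgd: "d ` topspace X = points V" using topX dq surj by (auto simp: image_image)
  have opens: "openin X W \<longleftrightarrow> openin (mtop V) (d ` W)" if W: "W \<subseteq> topspace X" for W
  proof -
    have eq: "{x \<in> points M. orbit \<phi> x \<in> W} = {x \<in> points M. q x \<in> d ` W}"
    proof -
      have "orbit \<phi> x \<in> W \<longleftrightarrow> q x \<in> d ` W" if x: "x \<in> points M" for x
      proof
        assume "q x \<in> d ` W"
        then obtain w where w: "w \<in> W" "q x = d w" by auto
        then obtain y where y: "y \<in> points M" "w = orbit \<phi> y" using W topX by auto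
        then have "q x = q y" using dq w by simp
        then have "orbit \<phi> x = orbit \<phi> y" using orb[OF x y(1)] by simp
          then show "orbit \<phi> x \<in> W" using y w by simp
      qed (use dq[OF x] in force)
      then show ?thesis by auto
    qed
    have sub: "d ` W \<subseteq> points V" using image_mono[OF W, of d] imgd by simp
    show ?thesis
      using qquot[OF sub] openin_continuous_map_preimage[OF qcont, of "d ` W"] W topX
      unfolding X_def openin_orbit_space eq by auto
  qed
  have homeo: "homeomorphic_map X (mtop V) d"
    unfolding homeomorphic_map_def using injd imgd
  proof (intro conjI)
    show "quotient_map X (mtop V) d"
      unfolding quotient_map_def
    proof (intro conjI allI impI imgd)
      fix W assume W: "W \<subseteq> points V"
      have "d ` {x \<in> topspace X. d x \<in> W} = W" using imgd W by (auto simp: image_iff)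
      then show "openin X {x \<in> topspace X. d x \<in> W} = openin (mtop V) W"
        using opens[of "{x \<in> topspace X. d x \<in> W}"] by auto
    qed
  qed
  define Q where "Q = transport_mfd X d V"
  have Q: "smooth_atlas Q" unfolding Q_def by (rule smooth_atlas_transport[OF VA homeo])
  have mQ: "mtop Q = X" by (simp add: Q_def)
  have dsm: "smooth_at Q V d x" if "x \<in> points Q" for x
    using smooth_at_transport(1)[OF VA homeo] that by (simp add: Q_def)
  have dism: "smooth_at V Q (inv_into (topspace X) d) v" if "v \<in> points V" for v
  proof -
    have "v \<in> d ` topspace X" using that imgd by simp
    then show ?thesis using smooth_at_transport(2)[OF VA homeo] by (auto simp: Q_def)
  qed
  have hs: "X homeomorphic_space mtop V" using homeo by (rule homeomorphic_map_imp_homeomorphic_space)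
  have QM: "smooth_manifold Q"
    using V Q homeomorphic_metrizable_space[OF hs] homeomorphic_connected_space[OF hs]
    by (simp add: smooth_manifold_def mQ)
  have orb_eq: "orbit \<phi> x = inv_into (topspace X) d (q x)" if "x \<in> points M" for x
    using dq[OF that] injd topX that by (metis image_eqI inv_into_f_f)
  have osm: "smooth_at M Q (orbit \<phi>) x" if x: "x \<in> points M" for x
  proof (rule smooth_at_cong[OF M])
    show "smooth_at M Q (\<lambda>x. inv_into (topspace X) d (q x)) x"
      using x surj by (intro smooth_at_compose[OF M VA Q] dism q_at) auto
  qed (use x orb_eq in auto)
  have sub: "submersion M Q (orbit \<phi>)"
  proof (rule submersion_if_sections[OF M Q])
    show "smooth_map M Q (orbit \<phi>)" using osm smooth_map_iff_smooth_at[OF M Q] by blast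
    fix p assume p: "p \<in> points M"
    then obtain s W where W: "openin (mtop V) W" "q p \<in> W" "\<And>v. v \<in> W \<Longrightarrow> q (s v) = v" "s (q p) = p"
      and s: "smooth_at V M s (q p)" using sec[OF p] by blast
    obtain R where R: "openin (mtop V) R" "q p \<in> R" "s ` R \<subseteq> points M"
      using smooth_at_open_nhd[OF VA M s openin_topspace] W p by auto
    have op: "orbit \<phi> p \<in> topspace X" using p topX by auto
    define T where "T = {w \<in> topspace X. d w \<in> W \<inter> R}"
    have "openin X T" unfolding T_def
      using W R homeo by (intro openin_continuous_map_preimage homeomorphic_imp_continuous_map) auto
    moreover have "orbit \<phi> p \<in> T" using op W R dq[OF p] by (simp add: T_def)
    moreover have "orbit \<phi> (s (d w)) = w" if w: "w \<in> T" for w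
    proof -
      have "s (d w) \<in> points M" "q (s (d w)) = d w" using w R W by (auto simp: T_def)
      then show ?thesis using orb_eq injd w by (simp add: T_def)
    qed
    moreover have "s (d (orbit \<phi> p)) = p" using dq[OF p] W by simp
    moreover have "smooth_at Q M (\<lambda>w. s (d w)) (orbit \<phi> p)"
      using s dq[OF p] dsm[of "orbit \<phi> p"] op by (intro smooth_at_compose[OF Q VA M]) (auto simp: mQ)
    ultimately show "\<exists>s W. openin (mtop Q) W \<and> orbit \<phi> p \<in> W \<and> (\<forall>v\<in>W. orbit \<phi> (s v) = v) \<and>
        s (orbit \<phi> p) = p \<and> smooth_at Q M s (orbit \<phi> p)"
      unfolding mQ by (intro exI[of _ "\<lambda>w. s (d w)"] exI[of _ T]) simp
  qed
  have diff: "diffeomorphism Q V d"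
    unfolding diffeomorphism_def
  proof (intro conjI exI[of _ "inv_into (topspace X) d"] ballI)
    show "smooth_map Q V d" using dsm smooth_map_iff_smooth_at[OF Q VA] by blast
    show "smooth_map V Q (inv_into (topspace X) d)" using dism smooth_map_iff_smooth_at[OF VA Q] by blast
  qed (use injd imgd in \<open>auto simp: mQ f_inv_into_f\<close>)
  show ?thesis
  proof
    show "has_quotient M \<phi> V (d \<circ> orbit \<phi>)"
      unfolding has_quotient_def
      using QM sub diff by (intro exI[of _ Q] exI[of _ d]) (auto simp: mQ X_def)
    show "(d \<circ> orbit \<phi>) x = q x" if "x \<in> points M" for x using dq[OF that] by simp
  qed
qed

section \<open>The model flow over a planar handle\<close>

definition dip :: "real \<Rightarrow> real" where
  "dip r = flat (2 - r) / flat 1"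

text \<open>The circle assigned to \<open>r\<close> has the diameter from \<open>- brad r\<close> to
  \<open>r\<close>. At \<open>r = 1\<close> it degenerates to the point 1, since
  \<open>dip 1 = 1\<close>. For \<open>r \<ge> 2\<close>, where \<open>dip\<close> vanishes, it is
  centred at 0, and the model changes nothing there.\<close>

definition brad :: "real \<Rightarrow> real" where
  "brad r = r - 2 * dip r"

lemma flat_1: "flat 1 > 0" by (simp add: flat_pos)

lemma dip_less_1: "r > 1 \<Longrightarrow> dip r < 1"
proof -
  assume r: "r > 1"
  have "flat (2 - r) < flat 1"
    using r flat_1 by (cases "2 - r > 0") (auto simp: flat_def)
  then show ?thesis using flat_1 by (simp add: dip_def)
qed

lemma dip_eq_0: "r \<ge> 2 \<Longrightarrow> dip r = 0"
  by (simp add: dip_def flat_eq_0)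

lemma dip_1 [simp]: "dip 1 = 1"
  using flat_1 by (simp add: dip_def)

text \<open>\<open>dip\<close> is decreasing, hence \<open>brad\<close> has slope at least 1. This
  nests the circles strictly and also enters in the invertibility of the derivative of
  \<open>unroll\<close>.\<close>

lemma brad_diff: "r \<le> s \<Longrightarrow> s - r \<le> brad s - brad r"
  using flat_1 flat_mono[of "2 - s" "2 - r"] by (simp add: brad_def dip_def divide_right_mono)

lemma brad_greater: "r > 1 \<Longrightarrow> brad r > -1"
  using dip_less_1[of r] by (simp add: brad_def)

lemma add_brad_pos: "r > 1 \<Longrightarrow> r + brad r > 0"
  using dip_less_1[of r] by (simp add: brad_def)

lemma smooth_on_dip [smooth_intros]:
  "smooth_on S f \<Longrightarrow> open S \<Longrightarrow> smooth_on S (\<lambda>x. dip (f x))"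
  unfolding dip_def using flat_1 by (intro smooth_intros) auto

lemma smooth_on_brad [smooth_intros]:
  "smooth_on S f \<Longrightarrow> open S \<Longrightarrow> smooth_on S (\<lambda>x. brad (f x))"
  unfolding brad_def by (intro smooth_intros)

lemma brad_has_derivative:
  obtains b where "(brad has_real_derivative b) (at r)" "b > 0"
proof -
  have "smooth_on UNIV (\<lambda>r. brad r - r)"
    by (intro smooth_intros) auto
  from smooth_on_has_derivative[OF this UNIV_I, of r]
  have "(\<lambda>r. brad r - r) differentiable (at r)" unfolding differentiable_def by blast
  then obtain D where D: "((\<lambda>r. brad r - r) has_real_derivative D) (at r)"
    by (auto simp: real_differentiable_def)
  have "D \<ge> 0"
    by (rule mono_on_imp_deriv_nonneg[OF _ D, of UNIV]) (use brad_diff in \<open>auto simp: mono_on_def algebra_simps\<close>)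
  moreover have "((\<lambda>r. (brad r - r) + r) has_real_derivative D + 1) (at r)"
    by (intro derivative_intros D)
  then have "(brad has_real_derivative D + 1) (at r)" by simp
  ultimately show ?thesis using that[of "D + 1"] by simp
qed

lemma of_real_ii_nonzero [simp]:
  "complex_of_real t + \<i> \<noteq> 0" "complex_of_real t - \<i> \<noteq> 0" "complex_of_real t \<noteq> \<i>"
  by (auto simp: complex_eq_iff)

definition slit :: "complex set" where
  "slit = {w. Im w = 0 \<and> Re w \<ge> 1}"

lemma closed_slit: "closed slit"
proof -
  have "slit = {w. Im w = 0} \<inter> {w. 1 \<le> Re w}" by (auto simp: slit_def)
  moreover have "closed ({w. Im w = 0} \<inter> {w. 1 \<le> Re w})"
    by (intro closed_Int closed_Collect_eq closed_Collect_le continuous_intros)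
  ultimately show ?thesis by simp
qed

text \<open>
  The half plane of all \<open>r + \<i> t\<close> with \<open>r > 1\<close> is mapped onto the slit plane, the vertical lines
  being mapped to the nested circles through \<open>r\<close> and \<open>- brad r\<close>, punctured at \<open>r\<close>.
\<close>

definition unroll :: "complex \<Rightarrow> complex" where
  "unroll p = (of_real (Re p * Im p) + \<i> * of_real (brad (Re p))) / (of_real (Im p) - \<i>)"

lemma unroll_Re: "Re (unroll p) = (Re p * (Im p)\<^sup>2 - brad (Re p)) / ((Im p)\<^sup>2 + 1)"
  and unroll_Im: "Im (unroll p) = Im p * (Re p + brad (Re p)) / ((Im p)\<^sup>2 + 1)"
  by (simp_all add: unroll_def Re_divide Im_divide power2_eq_square algebra_simps)

text \<open>The altitude theorem on the circle with diameter from \<open>- brad (Re p)\<close> to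
  \<open>Re p\<close>. The last equation recovers the line coordinate as a slope seen from the
  puncture.\<close>

lemma unroll_circle:
  assumes "Re p > 1"
  shows "Re p - Re (unroll p) > 0" "Re (unroll p) + brad (Re p) \<ge> 0"
    "(Re p - Re (unroll p)) * (Re (unroll p) + brad (Re p)) = (Im (unroll p))\<^sup>2"
    "Im p = Im (unroll p) / (Re p - Re (unroll p))"
proof -
  define k where "k = (Im p)\<^sup>2 + 1"
  have k: "k > 0" by (simp add: k_def add_nonneg_pos)
  have 1: "Re p - Re (unroll p) = (Re p + brad (Re p)) / k"
    using k unfolding unroll_Re k_def by (simp add: field_simps)
  have 2: "Re (unroll p) + brad (Re p) = (Re p + brad (Re p)) * (Im p)\<^sup>2 / k"
    using k unfolding unroll_Re k_def by (simp add: field_simps)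
  show "Re p - Re (unroll p) > 0" "Re (unroll p) + brad (Re p) \<ge> 0"
    unfolding 1 2 using k add_brad_pos[OF assms] by auto
  show "(Re p - Re (unroll p)) * (Re (unroll p) + brad (Re p)) = (Im (unroll p))\<^sup>2"
    unfolding 1 2 unroll_Im k_def[symmetric] by (simp add: power2_eq_square)
  show "Im p = Im (unroll p) / (Re p - Re (unroll p))"
    unfolding 1 unroll_Im k_def[symmetric] using k add_brad_pos[OF assms] by simp
qed

lemma unroll_not_slit: assumes "Re p > 1" shows "unroll p \<notin> slit"
proof
  assume s: "unroll p \<in> slit"
  have "(Im p)\<^sup>2 + 1 \<noteq> 0" by (simp add: add_nonneg_eq_0_iff)
  then have "Im p = 0" using s add_brad_pos[OF assms] by (auto simp: slit_def unroll_Im)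
  then show False using s brad_greater[OF assms] by (auto simp: slit_def unroll_Re)
qed

lemma unroll_inj: "inj_on unroll {p. Re p > 1}"
proof (rule inj_onI)
  fix p q assume p: "p \<in> {p. Re p > 1}" and q: "q \<in> {p. Re p > 1}" and eq: "unroll p = unroll q"
  have less: False if "Re a > 1" "Re b > 1" "unroll a = unroll b" "Re a < Re b" for a b
  proof -
    \<comment> \<open>For one and the same point of the plane, the product in the altitude theorem
      grows strictly with the circle, while the square of the altitude stays the same.\<close>
    have "brad (Re a) < brad (Re b)" using brad_diff[of "Re a" "Re b"] that by simp
    then have "(Re a - Re (unroll a)) * (Re (unroll a) + brad (Re a)) <
        (Re b - Re (unroll b)) * (Re (unroll b) + brad (Re b))"
      using unroll_circle(1,2)[OF that(1)] that by (intro mult_strict_mono) auto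
    then show False using unroll_circle(3)[OF that(1)] unroll_circle(3)[OF that(2)] that by simp
  qed
  then have "Re p = Re q" using p q eq by (metis linorder_neqE_linordered_idom mem_Collect_eq)
  then show "p = q"
    using unroll_circle(4)[of p] unroll_circle(4)[of q] p q eq by (simp add: complex_eq_iff)
qed

lemma unroll_surj:
  assumes "w \<notin> slit" obtains p where "Re p > 1" "unroll p = w"
proof -
  define X where "X = Re w" define Y where "Y = Im w"
  \<comment> \<open>\<open>F r\<close> is minus the power of \<open>w\<close> with respect to the
    circle of \<open>r\<close>, so a zero gives a circle through \<open>w\<close>. At
    \<open>lo\<close> the point is still outside, since it avoids the slit; \<open>hi\<close> is at
    least 2, so that its circle is centred at 0, and it is large enough to enclose
    \<open>w\<close>.\<close>
  define F where "F r = (r - X) * (X + brad r) - Y\<^sup>2" for r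
  define lo where "lo = max 1 X"
  define hi where "hi = 2 + \<bar>X\<bar> + \<bar>Y\<bar>"
  have Flo: "F lo < 0"
  proof (cases "X < 1")
    case True
    then have "F lo = - ((1 - X)\<^sup>2 + Y\<^sup>2)"
      by (simp add: F_def lo_def brad_def power2_eq_square algebra_simps)
    moreover have "(1 - X)\<^sup>2 > 0" using True by simp
    ultimately show ?thesis by (smt (verit) zero_le_power2)
  next
    case False
    then show ?thesis using assms by (auto simp: F_def lo_def X_def Y_def slit_def max_def)
  qed
  have "brad hi = hi" by (simp add: brad_def dip_eq_0 hi_def)
  moreover have "\<bar>Y\<bar> * \<bar>Y\<bar> \<le> (hi - X) * (X + hi)" by (intro mult_mono) (auto simp: hi_def)
  ultimately have Fhi: "F hi \<ge> 0" by (simp add: F_def power2_eq_square)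
  have "continuous_on UNIV brad"
    by (rule smooth_on_imp_continuous_on) (intro smooth_intros, auto)
  then have "continuous_on {lo..hi} F"
    unfolding F_def by (intro continuous_intros) (auto intro: continuous_on_subset)
  then obtain r where r: "lo \<le> r" "F r = 0"
    using IVT'[of F lo 0 hi] Flo Fhi by (force simp: lo_def hi_def)
  have "r \<noteq> lo" using r Flo by auto
  then have r1: "r > 1" "r > X" using r by (auto simp: lo_def)
  define u where "u = r - X"
  have u: "u > 0" using r1 by (simp add: u_def)
  have prod: "u * (X + brad r) = Y\<^sup>2" using r by (simp add: F_def u_def)
  have rb: "r + brad r > 0" using add_brad_pos[OF r1(1)] .
  define t where "t = Y / u"
  have t2: "t\<^sup>2 = (X + brad r) / u" using prod u by (simp add: t_def power_divide power2_eq_square field_simps)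
  have t21: "t\<^sup>2 + 1 = (r + brad r) / u" unfolding t2 using u by (simp add: field_simps u_def)
  have "unroll (Complex r t) = w"
  proof (rule complex_eqI)
    have "r * t\<^sup>2 - brad r = X * ((r + brad r) / u)"
      unfolding t2 using u by (simp add: field_simps) (simp add: u_def algebra_simps)
    then show "Re (unroll (Complex r t)) = Re w"
      unfolding unroll_Re complex.sel t21 using rb u by (simp add: X_def)
    show "Im (unroll (Complex r t)) = Im w"
      unfolding unroll_Im complex.sel t21 using rb u by (simp add: t_def Y_def)
  qed
  then show ?thesis using that[of "Complex r t"] r1 by simp
qed

definition roll :: "complex \<Rightarrow> complex" where
  "roll = inv_into {p. Re p > 1} unroll"

lemma roll_unroll [simp]: "Re p > 1 \<Longrightarrow> roll (unroll p) = p"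
  unfolding roll_def using unroll_inj by (intro inv_into_f_f) auto

lemma unroll_image: "unroll ` {p. Re p > 1} = - slit"
  using unroll_not_slit unroll_surj by (auto simp: image_iff) metis

lemma Re_roll: "w \<notin> slit \<Longrightarrow> Re (roll w) > 1" and unroll_roll: "w \<notin> slit \<Longrightarrow> unroll (roll w) = w"
  using unroll_surj roll_unroll by metis+

lemma open_Re_greater: "open {p. Re p > c}"
  by (intro open_Collect_less continuous_intros)

lemma smooth_on_unroll: "smooth_on {p. Re p > 1} unroll"
  unfolding unroll_def[abs_def] by (intro smooth_intros open_Re_greater) auto

lemma smooth_on_roll: "smooth_on (- slit) roll"
proof -
  have "inj (frechet_derivative unroll (at p))" if p: "Re p > 1" for p
  proof -
    define r where "r = Re p" define t where "t = Im p"
    obtain b where b: "(brad has_real_derivative b) (at r)" "b > 0" using brad_has_derivative .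
    have db: "((\<lambda>p. brad (Re p)) has_derivative (\<lambda>v. b * Re v)) (at p)"
      using has_derivative_compose[OF bounded_linear_imp_has_derivative[OF bounded_linear_Re]
          b(1)[unfolded has_field_derivative_def r_def]] .
    define L where "L v = ((of_real (Re v * t + r * Im v) + \<i> * of_real (b * Re v)) * (of_real t - \<i>)
        - (of_real (r * t) + \<i> * of_real (brad r)) * of_real (Im v)) / ((of_real t - \<i>) * (of_real t - \<i>))" for v
    have "(unroll has_derivative L) (at p)"
      unfolding unroll_def[abs_def] L_def[abs_def] r_def t_def
      by (auto intro!: derivative_eq_intros db bounded_linear_imp_has_derivative[OF bounded_linear_Re]
           bounded_linear_imp_has_derivative[OF bounded_linear_Im] has_derivative_of_real simp: algebra_simps)
    moreover have "v = 0" if "L v = 0" for v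
    proof -
      have eq: "(of_real (Re v * t + r * Im v) + \<i> * of_real (b * Re v)) * (of_real t - \<i>)
        - (of_real (r * t) + \<i> * of_real (brad r)) * of_real (Im v) = 0"
        using that by (simp add: L_def)
      \<comment> \<open>The real part isolates \<open>Re v\<close> with a positive factor. Once
        \<open>Re v\<close> is 0, the imaginary part leaves \<open>Im v\<close> times the diameter
        \<open>r + brad r\<close>.\<close>
      from arg_cong[OF this, of Re] have "Re v * (t * t + b) = 0" by (simp add: algebra_simps)
      moreover have "t * t + b > 0" using b by (simp add: add_nonneg_pos)
      ultimately have "Re v = 0" by simp
      moreover from this arg_cong[OF eq, of Im] have "(r + brad r) * Im v = 0" by (simp add: algebra_simps)
      then have "Im v = 0" using add_brad_pos[of r] p by (auto simp: r_def)
      ultimately show ?thesis by (simp add: complex_eq_iff)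
    qed
    ultimately show ?thesis
      using frechet_derivative_at[of unroll L p] linear_injective_0[of L]
      by (metis bounded_linear.linear has_derivative_bounded_linear)
  qed
  then show ?thesis
    using smooth_on_inverse_function(2)[OF open_Re_greater[of 1] smooth_on_unroll, of roll]
    by (simp add: unroll_image)
qed

text \<open>
  The maps \<open>collapse s\<close> deform the projection (\<open>s = 0\<close>) into the quotient map of the model flow
  (\<open>s = 1\<close>).  The pair of \<open>collapse 1\<close> and \<open>phase\<close> identifies an annulus times the line with
  the punctured circle bundle, where \<open>reconstruct\<close> is the inverse.
\<close>

definition collapse :: "real \<Rightarrow> complex \<times> real \<Rightarrow> complex" where
  "collapse s p = fst p *
     (1 - 2 * \<i> * of_real (s * dip (cmod (fst p)) / cmod (fst p)) / (of_real (snd p) + \<i>))"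

definition phase :: "complex \<times> real \<Rightarrow> complex" where
  "phase p = fst p / of_real (cmod (fst p)) * ((of_real (snd p) - \<i>) / (of_real (snd p) + \<i>))"

definition reconstruct :: "complex \<Rightarrow> complex \<Rightarrow> complex \<times> real" where
  "reconstruct Q z = (let p = roll (Q * cnj z) in
     (of_real (Re p) * z * ((of_real (Im p) + \<i>) / (of_real (Im p) - \<i>)), Im p))"

abbreviation outside :: "(complex \<times> real) set" where
  "outside \<equiv> {p. cmod (fst p) > 1}"

lemma open_outside: "open outside"
  by (intro open_Collect_less continuous_intros)

lemma cmod_of_real_ii: "cmod (of_real t - \<i>) = cmod (of_real t + \<i>)"
  by (simp add: cmod_def)

lemma of_real_cmod_square: "complex_of_real (cmod z) * of_real (cmod z) = z * cnj z"
  using complex_norm_square[of z] by (simp add: power2_eq_square)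

lemma norm_phase: "p \<in> outside \<Longrightarrow> cmod (phase p) = 1"
  unfolding phase_def norm_mult norm_divide cmod_of_real_ii by auto

lemma collapse_0 [simp]: "collapse 0 p = fst p"
  by (simp add: collapse_def)

lemma collapse_far: "cmod (fst p) \<ge> 2 \<Longrightarrow> collapse s p = fst p"
  by (simp add: collapse_def dip_eq_0)

lemma collapse_eq:
  assumes "p \<in> outside"
  shows "collapse 1 p = fst p / of_real (cmod (fst p)) *
    ((of_real (cmod (fst p) * snd p) + \<i> * of_real (brad (cmod (fst p)))) / (of_real (snd p) + \<i>))"
proof -
  have *: "x * (1 - 2 * \<i> * (d / a) / u) = x / a * ((a * (u - \<i>) + \<i> * (a - 2 * d)) / u)"
    if "a \<noteq> 0" "u \<noteq> 0" for x a d u :: complex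
    using that by (simp add: field_simps)
  have "cmod (fst p) \<noteq> 0" using assms by auto
  then show ?thesis
    using *[of "of_real (cmod (fst p))" "of_real (snd p) + \<i>" "fst p" "of_real (dip (cmod (fst p)))"]
    by (simp add: collapse_def brad_def)
qed

text \<open>\<open>Q * cnj z\<close> is the invariant of the simultaneous rotations of
  \<open>Q\<close> and \<open>z\<close>. The direction of \<open>fst p\<close> cancels in it, and
  what remains depends on the radius and the line coordinate alone.\<close>

lemma collapse_phase:
  assumes "p \<in> outside"
  shows "collapse 1 p * cnj (phase p) = unroll (Complex (cmod (fst p)) (snd p))"
proof -
  have 1: "fst p / of_real (cmod (fst p)) * cnj (fst p / of_real (cmod (fst p))) = 1"
    using assms of_real_cmod_square[of "fst p"] by (auto simp: field_simps)
  have "collapse 1 p * cnj (phase p) =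
     (fst p / of_real (cmod (fst p)) * cnj (fst p / of_real (cmod (fst p)))) *
     ((of_real (cmod (fst p) * snd p) + \<i> * of_real (brad (cmod (fst p)))) / (of_real (snd p) - \<i>))"
    unfolding collapse_eq[OF assms] phase_def by (simp add: mult_ac)
  then show ?thesis unfolding 1 by (simp add: unroll_def)
qed

lemma collapse_phase_not_slit: "p \<in> outside \<Longrightarrow> collapse 1 p * cnj (phase p) \<notin> slit"
  by (simp add: collapse_phase unroll_not_slit)

lemma reconstruct_collapse: "p \<in> outside \<Longrightarrow> reconstruct (collapse 1 p) (phase p) = p"
  by (cases p) (simp add: reconstruct_def collapse_phase Let_def, simp add: phase_def)

text \<open>The invariant \<open>Q * cnj z\<close> determines radius and line coordinate by
  \<open>roll\<close>; the direction is then read off from \<open>z\<close>.\<close>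

lemma
  assumes z: "cmod z = 1" and Q: "Q * cnj z \<notin> slit"
  shows reconstruct_outside: "reconstruct Q z \<in> outside"
    and collapse_reconstruct: "collapse 1 (reconstruct Q z) = Q"
    and phase_reconstruct: "phase (reconstruct Q z) = z"
proof -
  define p where "p = roll (Q * cnj z)"
  have p: "Re p > 1" "unroll p = Q * cnj z" unfolding p_def using Q Re_roll unroll_roll by auto
  have r: "reconstruct Q z = (of_real (Re p) * z * ((of_real (Im p) + \<i>) / (of_real (Im p) - \<i>)), Im p)"
    by (simp add: reconstruct_def p_def Let_def)
  have n: "cmod (fst (reconstruct Q z)) = Re p"
    unfolding r using z p by (simp add: norm_mult norm_divide cmod_of_real_ii)
  show out: "reconstruct Q z \<in> outside" using n p by simp
  have fst: "fst (reconstruct Q z) / of_real (Re p) = z * ((of_real (Im p) + \<i>) / (of_real (Im p) - \<i>))"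
    unfolding r using p by simp
  show "phase (reconstruct Q z) = z"
    unfolding phase_def n fst by (simp add: r)
  have "collapse 1 (reconstruct Q z) = z * unroll p"
    unfolding collapse_eq[OF out] n fst by (simp add: r unroll_def)
  also have "\<dots> = Q" using z complex_norm_square[of z] by (simp add: p mult.assoc mult.left_commute)
  finally show "collapse 1 (reconstruct Q z) = Q" .
qed

lemma smooth_on_collapse: "smooth_on (UNIV \<times> outside) (\<lambda>x. collapse (fst x) (snd x))"
proof -
  have "open (UNIV \<times> outside :: (real \<times> complex \<times> real) set)"
    by (intro open_Times open_UNIV open_outside)
  then show ?thesis
    unfolding collapse_def by (intro smooth_intros) auto
qed

lemma smooth_on_phase: "smooth_on outside phase"
  unfolding phase_def[abs_def] by (intro smooth_intros open_outside) auto

text \<open>Not restricted to unit vectors in the second component, so as to be an open set, on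
  which \<open>smooth_on\<close> is meaningful.\<close>

definition admissible :: "(complex \<times> complex) set" where
  "admissible = {x. fst x * cnj (snd x) \<notin> slit}"

lemma open_admissible: "open admissible"
proof -
  have "admissible = (\<lambda>x. fst x * cnj (snd x)) -` (- slit)" by (auto simp: admissible_def)
  moreover have "open ((\<lambda>x. fst x * cnj (snd x)) -` (- slit))"
    using closed_slit by (intro open_vimage continuous_intros) (simp add: open_Compl)
  ultimately show ?thesis by simp
qed

lemma smooth_on_reconstruct: "smooth_on admissible (\<lambda>x. reconstruct (fst x) (snd x))"
proof -
  have 1: "smooth_on admissible (\<lambda>x. roll (fst x * cnj (snd x)))"
    by (rule smooth_on_compose[OF smooth_on_roll])
       (intro smooth_intros open_admissible | use closed_slit in \<open>auto simp: admissible_def open_Compl\<close>)+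
  show ?thesis
    unfolding reconstruct_def Let_def by (intro smooth_intros 1 open_admissible) auto
qed

section \<open>A family of Moebius groups acting on the circle\<close>

definition modulus :: "complex \<Rightarrow> real" where
  "modulus Q = sqrt ((cmod Q)\<^sup>2 + (flat (1 - (cmod Q)\<^sup>2))\<^sup>2)"

text \<open>\<open>focus\<close> and \<open>speed\<close> arise by normalising the pair of
  \<open>Q\<close> and \<open>flat (1 - (cmod Q)\<^sup>2)\<close>. This extends
  \<open>Q / cmod Q\<close> smoothly into the open unit disk with norm below 1, and provides a
  smooth square root of \<open>1 - (cmod (focus Q))\<^sup>2\<close>, the quantity that separates
  elliptic from parabolic.\<close>

definition focus :: "complex \<Rightarrow> complex" where
  "focus Q = Q / of_real (modulus Q)"

definition speed :: "complex \<Rightarrow> real" where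
  "speed Q = flat (1 - (cmod Q)\<^sup>2) / modulus Q"

lemma modulus_pos: "modulus Q > 0"
proof (cases "Q = 0")
  case True
  then show ?thesis using flat_1 by (simp add: modulus_def)
next
  case False
  then show ?thesis by (auto simp: modulus_def intro!: add_pos_nonneg)
qed

lemma focus_speed: "(cmod (focus Q))\<^sup>2 + (speed Q)\<^sup>2 = 1"
proof -
  have "(modulus Q)\<^sup>2 = (cmod Q)\<^sup>2 + (flat (1 - (cmod Q)\<^sup>2))\<^sup>2" by (simp add: modulus_def)
  then have "(cmod Q)\<^sup>2 / (modulus Q)\<^sup>2 + (flat (1 - (cmod Q)\<^sup>2))\<^sup>2 / (modulus Q)\<^sup>2 = 1"
    using modulus_pos[of Q]
    by (metis add_divide_distrib divide_self less_irrefl zero_less_power)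
  then show ?thesis
    using modulus_pos[of Q] by (simp add: focus_def speed_def norm_divide power_divide)
qed

lemma focus_far: "cmod Q \<ge> 1 \<Longrightarrow> focus Q = Q / of_real (cmod Q)"
  and speed_far: "cmod Q \<ge> 1 \<Longrightarrow> speed Q = 0"
  by (simp_all add: focus_def speed_def modulus_def flat_eq_0)

text \<open>The point missing from the circle over \<open>Q\<close> is the fixed point of the group.
  Over the open unit disk nothing is missing, since \<open>focus Q\<close> has norm below 1
  there.\<close>

lemma slit_iff_focus:
  assumes z: "cmod z = 1" shows "Q * cnj z \<in> slit \<longleftrightarrow> z = focus Q"
proof
  assume "Q * cnj z \<in> slit"
  then obtain x where x: "Q * cnj z = of_real x" "x \<ge> 1"
    by (metis (mono_tags, lifting) complex_is_Real_iff mem_Collect_eq of_real_Re slit_def)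
  have "Q = Q * cnj z * z" using z complex_norm_square[of z] by (simp add: mult.assoc mult.commute)
  then have Q: "Q = of_real x * z" using x by simp
  then have "cmod Q = x" using z x by (simp add: norm_mult)
  then show "z = focus Q" using focus_far[of Q] Q x by simp
next
  assume f: "z = focus Q"
  then have "speed Q = 0" using focus_speed[of Q] z by simp
  then have "flat (1 - (cmod Q)\<^sup>2) = 0" using modulus_pos[of Q] by (simp add: speed_def)
  then have "(cmod Q)\<^sup>2 \<ge> 1" using flat_pos[of "1 - (cmod Q)\<^sup>2"] by argo
  then have Q: "cmod Q \<ge> 1" using power2_le_imp_le[of 1 "cmod Q"] by simp
  then have "Q * cnj z = of_real (cmod Q)"
    using f focus_far[of Q] of_real_cmod_square[of Q, symmetric] Q by auto
  then show "Q * cnj z \<in> slit" using Q by (simp add: slit_def)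
qed

lemma smooth_on_modulus: "smooth_on UNIV modulus"
proof -
  \<comment> \<open>The norm is not smooth at 0, but its square is an inner product.\<close>
  have eq: "modulus Q = sqrt (Q \<bullet> Q + (flat (1 - Q \<bullet> Q))\<^sup>2)" for Q :: complex
    by (simp add: modulus_def dot_square_norm)
  have "Q \<bullet> Q + (flat (1 - Q \<bullet> Q))\<^sup>2 > 0" for Q :: complex
    using modulus_pos[of Q] by (simp add: eq)
  then have "smooth_on UNIV (\<lambda>Q :: complex. sqrt (Q \<bullet> Q + (flat (1 - Q \<bullet> Q))\<^sup>2))"
    by (intro smooth_intros) auto
  then show ?thesis by (simp add: eq[abs_def])
qed

lemma smooth_on_focus: "smooth_on UNIV focus"
  unfolding focus_def[abs_def] using smooth_on_modulus modulus_pos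
  by (intro smooth_intros) (auto simp: less_imp_neq[THEN not_sym])

lemma smooth_on_speed: "smooth_on UNIV speed"
proof -
  have "smooth_on UNIV (\<lambda>Q :: complex. flat (1 - Q \<bullet> Q) / modulus Q)"
    using smooth_on_modulus modulus_pos by (intro smooth_intros) (auto simp: less_imp_neq[THEN not_sym])
  then show ?thesis by (simp add: speed_def[abs_def] dot_square_norm)
qed

text \<open>If a matrix \<open>X\<close> satisfies \<open>X\<^sup>2 = - d\<^sup>2\<close>, then
  \<open>exp (t X)\<close> is \<open>rcos d t\<close> times the identity plus
  \<open>rsin d t\<close> times \<open>X\<close>. The addition theorems contain only the square of
  \<open>d\<close> and no division, so \<open>d = 0\<close> is included, where the coefficients are
  1 and \<open>t\<close>.\<close>

definition rcos :: "real \<Rightarrow> real \<Rightarrow> real" where "rcos d t = cos (d * t)"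
definition rsin :: "real \<Rightarrow> real \<Rightarrow> real" where "rsin d t = t * sinc (d * t)"

lemma rsin_eq: "d \<noteq> 0 \<Longrightarrow> rsin d t = sin (d * t) / d"
  by (simp add: rsin_def sin_eq_sinc)

lemma rsin_0 [simp]: "rsin 0 t = t" "rsin d 0 = 0" and rcos_0 [simp]: "rcos 0 t = 1" "rcos d 0 = 1"
  by (simp_all add: rsin_def rcos_def)

lemma rsin_add: "rsin d (s + t) = rsin d s * rcos d t + rcos d s * rsin d t"
  by (cases "d = 0") (simp_all add: rsin_eq rcos_def sin_add distrib_left field_simps)

lemma rcos_add: "rcos d (s + t) = rcos d s * rcos d t - d\<^sup>2 * rsin d s * rsin d t"
  by (cases "d = 0") (simp_all add: rsin_eq rcos_def cos_add distrib_left power2_eq_square)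

lemma rcos_rsin: "(rcos d t)\<^sup>2 + d\<^sup>2 * (rsin d t)\<^sup>2 = 1"
  by (cases "d = 0") (simp_all add: rsin_eq rcos_def power_divide)

text \<open>For \<open>f = focus Q\<close>, let \<open>X\<close> be the matrix with rows
  \<open>(\<i>, - \<i> f)\<close> and \<open>(\<i> cnj f, - \<i>)\<close>, whose square is
  \<open>- (speed Q)\<^sup>2\<close>. This is the denominator of the Moebius transformation of
  \<open>exp (t X)\<close>. On the unit circle the numerator is \<open>z\<close> times the conjugate
  denominator.\<close>

definition turn_den :: "real \<Rightarrow> complex \<Rightarrow> complex \<Rightarrow> complex" where
  "turn_den t Q z = of_real (rcos (speed Q) t) - \<i> * of_real (rsin (speed Q) t) * (1 - cnj (focus Q) * z)"

text \<open>
  The one-parameter group of Moebius transformations of the unit circle generated by the vector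
  field \<open>\<i> * (2 * z - focus Q - cnj (focus Q) * z\<^sup>2)\<close>.  It is parabolic with fixed point \<open>focus Q\<close>
  if \<open>cmod Q \<ge> 1\<close>, and elliptic without fixed points on the circle otherwise.
\<close>

definition turn :: "real \<Rightarrow> complex \<Rightarrow> complex \<Rightarrow> complex" where
  "turn t Q z = z * cnj (turn_den t Q z) / turn_den t Q z"

text \<open>A zero could only occur in the parabolic case and at the fixed point, but there the
  denominator is 1.\<close>

lemma turn_den_nonzero:
  assumes z: "cmod z = 1" shows "turn_den t Q z \<noteq> 0"
proof
  assume D: "turn_den t Q z = 0"
  define a where "a = cnj (focus Q) * z"
  have a: "cmod a = cmod (focus Q)" using z by (simp add: a_def norm_mult)
  have Re: "rcos (speed Q) t = rsin (speed Q) t * Im a" and Im: "rsin (speed Q) t * (1 - Re a) = 0"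
    using arg_cong[OF D, of Re] arg_cong[OF D, of Im]
    by (simp_all add: turn_den_def flip: a_def)
  have "rsin (speed Q) t \<noteq> 0" using rcos_rsin[of "speed Q" t] Re by auto
  then have "Re a = 1" using Im by simp
  moreover have "(Re a)\<^sup>2 + (Im a)\<^sup>2 + (speed Q)\<^sup>2 = 1"
    using focus_speed[of Q] by (simp flip: a cmod_power2)
  ultimately have "Im a = 0" "speed Q = 0" by (simp_all add: add_nonneg_eq_0_iff)
  then show False using Re by simp
qed

lemma norm_turn: "cmod z = 1 \<Longrightarrow> cmod (turn t Q z) = 1"
  using turn_den_nonzero[of z t Q] by (simp add: turn_def norm_mult norm_divide)

lemma turn_0 [simp]: "turn 0 Q z = z"
  by (simp add: turn_def turn_den_def)

text \<open>The cocycle rule of the denominators, which carries the group law of the matrices. The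
  law for \<open>turn\<close> follows from it by conjugation, because the numerator is
  \<open>z\<close> times the conjugate denominator.\<close>

lemma turn_den_add:
  assumes z: "cmod z = 1"
  shows "turn_den s Q (turn t Q z) * turn_den t Q z = turn_den (s + t) Q z"
proof -
  define f c1 s1 c2 s2 d where defs: "f = focus Q" "c1 = complex_of_real (rcos (speed Q) s)"
    "s1 = complex_of_real (rsin (speed Q) s)" "c2 = complex_of_real (rcos (speed Q) t)"
    "s2 = complex_of_real (rsin (speed Q) t)" "d = complex_of_real ((speed Q)\<^sup>2)"
  have zz: "z * cnj z = 1" using z complex_norm_square[of z] by simp
  have ff: "f * cnj f = 1 - d"
    using focus_speed[of Q] complex_norm_square[of f] unfolding defs
    by (metis add_diff_cancel_right' of_real_1 of_real_diff)
  have D: "turn_den t Q z = c2 - \<i> * s2 * (1 - cnj f * z)" by (simp add: turn_den_def defs)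
  have cD: "z * cnj (turn_den t Q z) = (c2 + \<i> * s2) * z - \<i> * s2 * f"
  proof -
    have "z * cnj (turn_den t Q z) = (c2 + \<i> * s2) * z - \<i> * s2 * f * (z * cnj z)"
      by (simp add: turn_den_def defs algebra_simps)
    then show ?thesis by (simp add: zz)
  qed
  have e1: "turn_den s Q (turn t Q z) = c1 - \<i> * s1 * (1 - cnj f * turn t Q z)"
    by (simp add: turn_den_def defs)
  have e2: "turn t Q z * turn_den t Q z = z * cnj (turn_den t Q z)"
    using turn_den_nonzero[OF z, of t Q] by (simp add: turn_def)
  have "turn_den s Q (turn t Q z) * turn_den t Q z =
      (c1 - \<i> * s1) * turn_den t Q z + \<i> * s1 * cnj f * (turn t Q z * turn_den t Q z)"
    unfolding e1 by (simp add: algebra_simps)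
  also have "\<dots> = (c1 - \<i> * s1) * turn_den t Q z + \<i> * s1 * cnj f * (z * cnj (turn_den t Q z))"
    unfolding e2 ..
  also have "\<dots> = (c1 * c2 - s1 * s2 + s1 * s2 * (f * cnj f)) -
      \<i> * (s1 * c2 + c1 * s2) * (1 - cnj f * z)"
    unfolding cD unfolding D by (simp add: algebra_simps)
  \<comment> \<open>Replacing \<open>f * cnj f\<close> by \<open>1 - d\<close> turns the constant
    term into the addition theorem of \<open>rcos\<close>.\<close>
  also have "\<dots> = turn_den (s + t) Q z"
    unfolding ff by (simp add: turn_den_def rcos_add rsin_add defs algebra_simps)
  finally show ?thesis .
qed

lemma turn_add:
  assumes z: "cmod z = 1" shows "turn s Q (turn t Q z) = turn (s + t) Q z"
proof -
  have "turn s Q (turn t Q z) = z * cnj (turn_den s Q (turn t Q z) * turn_den t Q z) /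
      (turn_den s Q (turn t Q z) * turn_den t Q z)"
    by (simp add: turn_def[of s] turn_def[of t Q z] mult_ac)
  then show ?thesis unfolding turn_den_add[OF z] by (simp add: turn_def)
qed

lemma turn_focus: "cmod (focus Q) = 1 \<Longrightarrow> turn t Q (focus Q) = focus Q"
proof -
  assume f: "cmod (focus Q) = 1"
  have "cnj (focus Q) * focus Q = 1" using f complex_norm_square[of "focus Q"] by (simp add: mult.commute)
  moreover have "speed Q = 0" using focus_speed[of Q] f by simp
  ultimately show ?thesis by (simp add: turn_def turn_den_def)
qed

lemma turn_not_focus:
  assumes z: "cmod z = 1" and nf: "z \<noteq> focus Q" shows "turn t Q z \<noteq> focus Q"
proof
  assume eq: "turn t Q z = focus Q"
  then have "cmod (focus Q) = 1" using norm_turn[OF z] by metis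
  then have "turn (-t) Q (turn t Q z) = focus Q" using turn_focus eq by simp
  then show False using turn_add[OF z, of "-t" Q t] nf by simp
qed

text \<open>
  With \<open>g\<^sup>2 = z * w\<close>, the equation \<open>turn t Q z = w\<close> becomes one real linear equation for the pair
  \<open>rcos\<close>, \<open>rsin\<close>.
\<close>

lemma turn_transitive:
  assumes z: "cmod z = 1" "z \<noteq> focus Q" and w: "cmod w = 1" "w \<noteq> focus Q"
  obtains t where "turn t Q z = w"
proof -
  define f where "f = focus Q"
  define g where "g = csqrt (z * w)"
  have g2: "g * g = z * w" by (simp add: g_def flip: power2_eq_square)
  have "cmod (g * g) = 1" using z w by (simp add: g2 norm_mult)
  then have g: "cmod g = 1" by (simp add: norm_mult) (metis abs_norm_cancel abs_square_eq_1 power2_eq_square)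
  have gg: "g * cnj g = 1" using complex_norm_square[of g] g by simp
  have zz: "z * cnj z = 1" using complex_norm_square[of z] z by simp
  define u where "u = z * cnj g"
  have zu: "z = g * u" using gg by (simp add: u_def mult.left_commute)
  have wu: "w = g * cnj u"
  proof -
    have "g * cnj u = g * g * cnj z" by (simp add: u_def)
    also have "\<dots> = w" unfolding g2 using zz by (simp add: mult.commute mult.left_commute)
    finally show ?thesis by simp
  qed
  define h where "h = f * cnj g"
  have fh: "f = g * h" using gg by (simp add: h_def mult.left_commute)
  define P R where "P = Im u" and "R = Re u - Re h"
  have step: "turn t Q z = w" if "rcos (speed Q) t * P + rsin (speed Q) t * R = 0" for t
  proof -
    let ?c = "complex_of_real (rcos (speed Q) t)" and ?s = "complex_of_real (rsin (speed Q) t)"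
    have D: "turn_den t Q z = ?c - \<i> * ?s * (1 - cnj f * z)" by (simp add: turn_den_def f_def)
    have "z * cnj (turn_den t Q z) - w * turn_den t Q z =
        ?c * (z - w) + \<i> * ?s * (z - f * (z * cnj z) + w - cnj f * (z * w))"
      unfolding D by (simp add: algebra_simps)
    also have "\<dots> = ?c * (z - w) + \<i> * ?s * (z - f + w - cnj f * (g * g))"
      by (simp add: zz g2)
    also have "\<dots> = g * (?c * (u - cnj u) + \<i> * ?s * (u + cnj u - h - cnj h * (g * cnj g)))"
      unfolding zu wu fh by (simp add: algebra_simps)
    also have "\<dots> = g * (2 * \<i> * of_real (rcos (speed Q) t * P + rsin (speed Q) t * R))"
      by (simp add: gg complex_eq_iff P_def R_def algebra_simps)
    finally have "z * cnj (turn_den t Q z) = w * turn_den t Q z" using that by simp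
    then show ?thesis using turn_den_nonzero[OF z(1), of t Q] by (simp add: turn_def)
  qed
  show ?thesis
  proof (cases "speed Q = 0")
    \<comment> \<open>In the elliptic case \<open>rcos\<close> and \<open>speed Q\<close> times
      \<open>rsin\<close> run through the whole unit circle, so every linear equation for them is
      solvable.\<close>
    case False
    define A where "A = speed Q * P"
    have "\<exists>x. cos x * A + sin x * R = 0"
    proof (cases "R = 0")
      case True
      then show ?thesis by (intro exI[of _ "pi / 2"]) simp
    next
      case False
      have "cos (arctan (- A / R)) * A + sin (arctan (- A / R)) * R = 0"
        unfolding cos_arctan sin_arctan using False by (simp add: field_simps)
      then show ?thesis by blast
    qed
    then obtain x where "cos x * A + sin x * R = 0" by blast
    then have "rcos (speed Q) (x / speed Q) * P + rsin (speed Q) (x / speed Q) * R = 0"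
      using False by (simp add: rcos_def rsin_eq A_def field_simps)
    then show ?thesis using step that by blast
  next
    case True
    have nf: "cmod f = 1" using focus_speed[of Q] True abs_square_eq_1[of "cmod f"] by (simp add: f_def)
    have uh: "cmod u = 1" "cmod h = 1" using z g nf by (simp_all add: u_def h_def norm_mult)
    show ?thesis
    proof (cases "R = 0")
      \<comment> \<open>In the parabolic case the equation reads \<open>P + t * R = 0\<close>, which
        can be unsolvable only for \<open>R = 0\<close>. But then \<open>u\<close> and
        \<open>h\<close> have the same real part on the unit circle, so they agree up to
        conjugation, and \<open>z\<close> or \<open>w\<close> would be the fixed point.\<close>
      case True
      then have re: "Re u = Re h" by (simp add: R_def)
      then have "(Im u)\<^sup>2 = (Im h)\<^sup>2"
        using uh cmod_power2[of u] cmod_power2[of h] by simp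
      then have "Im u = Im h \<or> Im u = - Im h" by (simp add: power2_eq_iff)
      then have "u = h \<or> cnj u = h" using re by (auto simp: complex_eq_iff)
      then have "z = f \<or> w = f" using zu wu fh by auto
      then show ?thesis using z w by (simp add: f_def)
    next
      case False
      then have "rcos (speed Q) (- P / R) * P + rsin (speed Q) (- P / R) * R = 0"
        using \<open>speed Q = 0\<close> by simp
      then show ?thesis using step that by blast
    qed
  qed
qed

lemma turn_moves:
  assumes z: "cmod z = 1" "z \<noteq> focus Q" obtains t where "turn t Q z \<noteq> z"
proof -
  obtain w where w: "cmod w = 1" "w \<noteq> focus Q" "w \<noteq> z"
  proof -
    have "card {1, -1, \<i>} = 3" by (simp add: complex_eq_iff)
    moreover have "card {focus Q, z} \<le> 2" by (simp add: card_insert_if)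
    ultimately have "\<not> {1, -1, \<i>} \<subseteq> {focus Q, z}"
      using card_mono[of "{focus Q, z}" "{1, -1, \<i>}"] by auto
    then obtain w where "w \<in> {1, -1, \<i>}" "w \<notin> {focus Q, z}" by blast
    then show ?thesis using that[of w] by auto
  qed
  then show ?thesis using turn_transitive[OF z w(1,2)] that by metis
qed

text \<open>Up to rotation by the direction of \<open>fst p\<close>, the phase is a Cayley transform
  of the line, which conjugates the parabolic group to translations. The rate 2 obtained here
  dictates the factor 2 in \<open>flow\<close> away from the handles.\<close>

lemma turn_far:
  assumes "cmod (fst p) \<ge> 2"
  shows "turn t (fst p) (phase p) = phase (fst p, snd p + 2 * t)"
proof -
  define a where "a = complex_of_real (snd p)"
  define b where "b = complex_of_real t"
  define f where "f = focus (fst p)"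
  have f: "f = fst p / of_real (cmod (fst p))" and sp: "speed (fst p) = 0"
    using assms focus_far speed_far unfolding f_def by auto
  have "cmod f = 1" using assms by (auto simp: f norm_divide)
  then have ff: "cnj f * f = 1" using complex_norm_square[of f] by (simp add: mult.commute)
  have nz: "a + \<i> \<noteq> 0" "a - \<i> \<noteq> 0" "a + 2 * b + \<i> \<noteq> 0" "a + 2 * b - \<i> \<noteq> 0"
    unfolding a_def b_def using of_real_ii_nonzero[of "snd p + 2 * t"] by auto
  have ph: "phase p = f * ((a - \<i>) / (a + \<i>))" by (simp add: phase_def f a_def)
  have "turn_den t (fst p) (phase p) = 1 - \<i> * b * (1 - (cnj f * f) * ((a - \<i>) / (a + \<i>)))"
    by (simp add: turn_den_def sp b_def ph f_def)
  also have "\<dots> = (a + 2 * b + \<i>) / (a + \<i>)"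
    unfolding ff using nz by (simp add: field_simps)
  finally have D: "turn_den t (fst p) (phase p) = (a + 2 * b + \<i>) / (a + \<i>)" .
  then have cD: "cnj (turn_den t (fst p) (phase p)) = (a + 2 * b - \<i>) / (a - \<i>)"
    by (simp add: a_def b_def)
  have "turn t (fst p) (phase p) = f * ((a + 2 * b - \<i>) / (a + 2 * b + \<i>))"
    unfolding turn_def cD unfolding D unfolding ph using nz by (simp add: divide_simps)
  then show ?thesis by (simp add: phase_def f a_def b_def)
qed

section \<open>The model flow and its local sections\<close>

definition local_flow :: "real \<Rightarrow> complex \<times> real \<Rightarrow> complex \<times> real" where
  "local_flow t p = reconstruct (collapse 1 p) (turn t (collapse 1 p) (phase p))"

context
  fixes p assumes p: "p \<in> outside"
begin

lemma phase_turn: "cmod (turn t (collapse 1 p) (phase p)) = 1"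
    "collapse 1 p * cnj (turn t (collapse 1 p) (phase p)) \<notin> slit"
  using norm_turn[OF norm_phase[OF p]] collapse_phase_not_slit[OF p]
    turn_not_focus[OF norm_phase[OF p]] slit_iff_focus[OF norm_phase[OF p]]
    slit_iff_focus[OF norm_turn[OF norm_phase[OF p]]]
  by auto

lemma local_flow_outside: "local_flow t p \<in> outside"
  and collapse_local_flow: "collapse 1 (local_flow t p) = collapse 1 p"
  and phase_local_flow: "phase (local_flow t p) = turn t (collapse 1 p) (phase p)"
  unfolding local_flow_def
  using reconstruct_outside[OF phase_turn] collapse_reconstruct[OF phase_turn]
    phase_reconstruct[OF phase_turn] by auto

lemma local_flow_0: "local_flow 0 p = p"
  by (simp add: local_flow_def reconstruct_collapse[OF p])

lemma local_flow_far: "cmod (fst p) \<ge> 2 \<Longrightarrow> local_flow t p = (fst p, snd p + 2 * t)"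
  using turn_far[of p t] reconstruct_collapse[of "(fst p, snd p + 2 * t)"] p
  by (simp add: local_flow_def collapse_far)

lemma local_flow_moves: "\<exists>t. local_flow t p \<noteq> p"
proof -
  have "phase p \<noteq> focus (collapse 1 p)"
    using collapse_phase_not_slit[OF p] slit_iff_focus[OF norm_phase[OF p]] by auto
  then obtain t where "turn t (collapse 1 p) (phase p) \<noteq> phase p"
    using turn_moves[OF norm_phase[OF p]] by metis
  then show ?thesis using phase_local_flow by metis
qed

end

lemma local_flow_add:
  assumes p: "p \<in> outside" shows "local_flow s (local_flow t p) = local_flow (s + t) p"
  unfolding local_flow_def[of s "local_flow t p"] collapse_local_flow[OF p] phase_local_flow[OF p]
  by (simp add: turn_add[OF norm_phase[OF p]] local_flow_def)

lemma local_flow_transitive: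
  assumes p: "p \<in> outside" and q: "q \<in> outside" and eq: "collapse 1 p = collapse 1 q"
  obtains t where "local_flow t p = q"
proof -
  have "phase p \<noteq> focus (collapse 1 p)" "phase q \<noteq> focus (collapse 1 p)"
    using collapse_phase_not_slit[OF p] slit_iff_focus[OF norm_phase[OF p]]
      collapse_phase_not_slit[OF q] slit_iff_focus[OF norm_phase[OF q]] eq by auto
  then obtain t where "turn t (collapse 1 p) (phase p) = phase q"
    using turn_transitive norm_phase[OF p] norm_phase[OF q] by metis
  then have "local_flow t p = q"
    unfolding local_flow_def using eq reconstruct_collapse[OF q] by simp
  then show ?thesis by (rule that)
qed

lemma collapse_surj: obtains p where "p \<in> outside" "collapse 1 p = Q"
proof -
  \<comment> \<open>At most one point is missing from the circle over \<open>Q\<close>, so of any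
    two points one is available.\<close>
  have "\<not> {1, -1} \<subseteq> {focus Q}" by (auto simp: complex_eq_iff)
  then obtain z where "z \<in> {1, -1}" "z \<noteq> focus Q" by blast
  then have "cmod z = 1" "z \<noteq> focus Q" by auto
  then show ?thesis
    using that[of "reconstruct Q z"] slit_iff_focus reconstruct_outside collapse_reconstruct by metis
qed

lemma smooth_on_local_flow: "smooth_on (UNIV \<times> outside) (\<lambda>x. local_flow (fst x) (snd x))"
proof -
  let ?S = "UNIV \<times> outside :: (real \<times> complex \<times> real) set"
  have o: "open ?S" by (intro open_Times open_UNIV open_outside)
  have col: "smooth_on ?S (\<lambda>x. collapse 1 (snd x))"
    by (rule smooth_on_compose[OF smooth_on_collapse, of _ "\<lambda>x. (1, snd x)", simplified])
       (intro smooth_intros o open_Times open_UNIV open_outside | force)+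
  have foc: "smooth_on ?S (\<lambda>x. focus (collapse 1 (snd x)))"
    by (rule smooth_on_compose[OF smooth_on_focus col o]) auto
  have spd: "smooth_on ?S (\<lambda>x. speed (collapse 1 (snd x)))"
    by (rule smooth_on_compose[OF smooth_on_speed col o]) auto
  have ph: "smooth_on ?S (\<lambda>x. phase (snd x))"
    by (rule smooth_on_compose[OF smooth_on_phase _ o open_outside]) (intro smooth_intros o | auto)+
  have den: "smooth_on ?S (\<lambda>x. turn_den (fst x) (collapse 1 (snd x)) (phase (snd x)))"
    unfolding turn_den_def rcos_def rsin_def by (intro smooth_intros o foc spd ph)
  have "smooth_on ?S (\<lambda>x. turn (fst x) (collapse 1 (snd x)) (phase (snd x)))"
    unfolding turn_def by (intro smooth_intros o den ph) (auto simp: turn_den_nonzero norm_phase)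
  then have "smooth_on ?S (\<lambda>x. (collapse 1 (snd x), turn (fst x) (collapse 1 (snd x)) (phase (snd x))))"
    by (intro smooth_intros o col)
  from smooth_on_compose[OF smooth_on_reconstruct this o open_admissible]
  show ?thesis
    unfolding local_flow_def by (force simp: admissible_def phase_turn)
qed

text \<open>\<open>collapse 1\<close> and \<open>phase\<close> trivialise the punctured circle
  bundle, so holding the phase constant gives a section through \<open>p\<close>. It extends over
  all \<open>Q\<close> whose circle is not punctured at this phase.\<close>

lemma local_section:
  assumes p: "p \<in> outside"
  obtains s W where "open W" "collapse 1 p \<in> W" "smooth_on W s" "s ` W \<subseteq> outside"
    "\<And>Q. Q \<in> W \<Longrightarrow> collapse 1 (s Q) = Q" "s (collapse 1 p) = p"
proof
  let ?W = "{Q. Q * cnj (phase p) \<notin> slit}"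
  have "?W = (\<lambda>Q. (Q, phase p)) -` admissible" by (auto simp: admissible_def)
  then show W: "open ?W" by (auto intro!: open_vimage open_admissible continuous_intros)
  show "collapse 1 p \<in> ?W" using collapse_phase_not_slit[OF p] by simp
  show "smooth_on ?W (\<lambda>Q. reconstruct Q (phase p))"
  proof -
    have "(\<lambda>Q. (Q, phase p)) ` ?W \<subseteq> admissible" by (auto simp: admissible_def)
    from smooth_on_compose[OF smooth_on_reconstruct
        smooth_on_Pair[OF smooth_on_id[OF W] smooth_on_const[OF W] W] W open_admissible this]
    show ?thesis by simp
  qed
  show "(\<lambda>Q. reconstruct Q (phase p)) ` ?W \<subseteq> outside"
    using reconstruct_outside[OF norm_phase[OF p]] by auto
  show "collapse 1 (reconstruct Q (phase p)) = Q" if "Q \<in> ?W" for Q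
    using collapse_reconstruct[OF norm_phase[OF p]] that by simp
  show "reconstruct (collapse 1 p) (phase p) = p" by (rule reconstruct_collapse[OF p])
qed

section \<open>Gluing the model flows\<close>

definition planar :: "'e::euclidean_space \<Rightarrow> 'e \<Rightarrow> 'e \<Rightarrow> complex" where
  "planar a b x = Complex (x \<bullet> a) (x \<bullet> b)"

definition set_planar :: "'e::euclidean_space \<Rightarrow> 'e \<Rightarrow> 'e \<Rightarrow> complex \<Rightarrow> 'e" where
  "set_planar a b x z = x + (Re z - x \<bullet> a) *\<^sub>R a + (Im z - x \<bullet> b) *\<^sub>R b"

lemma smooth_on_planar [smooth_intros]:
  "smooth_on S f \<Longrightarrow> open S \<Longrightarrow> smooth_on S (\<lambda>x. planar a b (f x))"
  unfolding planar_def by (intro smooth_intros)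

lemma smooth_on_set_planar [smooth_intros]:
  "smooth_on S f \<Longrightarrow> smooth_on S g \<Longrightarrow> open S \<Longrightarrow> smooth_on S (\<lambda>x. set_planar a b (f x) (g x))"
  unfolding set_planar_def by (intro smooth_intros)

lemma set_planar_planar [simp]: "set_planar a b x (planar a b x) = x"
  by (simp add: set_planar_def planar_def)

context
  fixes a b :: "'e::euclidean_space"
  assumes ab: "a \<in> Basis" "b \<in> Basis" "a \<noteq> b"
begin

lemma planar_set_planar: "planar a b (set_planar a b x z) = z"
  using ab by (simp add: planar_def set_planar_def inner_add_left inner_Basis)

lemma set_planar_set_planar: "set_planar a b (set_planar a b x z) w = set_planar a b x w"
proof -
  have "set_planar a b x z \<bullet> a = Re z" "set_planar a b x z \<bullet> b = Im z"
    using arg_cong[OF planar_set_planar[of x z], of Re] arg_cong[OF planar_set_planar[of x z], of Im]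
    by (simp_all add: planar_def)
  then show ?thesis by (simp add: set_planar_def[of _ _ "set_planar a b x z"]) (simp add: set_planar_def algebra_simps)
qed

text \<open>\<open>set_planar a b x 0\<close> stands for the coordinates of \<open>x\<close>
  complementary to the plane. The model acts on the planar ones only, so the complementary ones are
  constant along orbits.\<close>

lemma set_planar_eq_iff:
  "set_planar a b x z = set_planar a b y w \<longleftrightarrow> z = w \<and> set_planar a b x 0 = set_planar a b y 0"
  by (metis planar_set_planar set_planar_set_planar)

end

lemma openin_preimage_smooth:
  assumes M: "smooth_atlas M" and N: "smooth_atlas N"
    and T: "openin (mtop M) T" "\<And>x. x \<in> T \<Longrightarrow> smooth_at M N f x" and W: "openin (mtop N) W"
  shows "openin (mtop M) {x \<in> T. f x \<in> W}"
proof (subst openin_subopen, clarify)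
  fix x assume x: "x \<in> T" "f x \<in> W"
  obtain R where "openin (mtop M) R" "x \<in> R" "f ` R \<subseteq> W"
    using smooth_at_open_nhd[OF M N T(2)[OF x(1)] W x(2)] by metis
  then show "\<exists>R. openin (mtop M) R \<and> x \<in> R \<and> R \<subseteq> {x \<in> T. f x \<in> W}"
    using T(1) x by (intro exI[of _ "R \<inter> T"]) auto
qed

text \<open>
  Here \<open>ii\<close> and \<open>G h\<close> are left inverses of the embeddings \<open>i\<close> and \<open>J h\<close>.  The last assumption
  is not part of the definition of a handle layer, and is achieved by thinning the handles.
\<close>

locale handles =
  fixes U :: "('a, 'e::euclidean_space) mfd" and V :: "('b, 'e) mfd"
    and i :: "'a \<Rightarrow> 'b" and ii :: "'b \<Rightarrow> 'a" and I :: "nat set"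
    and a b :: "nat \<Rightarrow> 'e" and J :: "nat \<Rightarrow> 'e \<Rightarrow> 'b" and G :: "nat \<Rightarrow> 'b \<Rightarrow> 'e"
  assumes U: "smooth_atlas U" and VM: "smooth_manifold V"
    and i: "\<And>u. u \<in> points U \<Longrightarrow> smooth_at U V i u"
    and ii_i: "\<And>u. u \<in> points U \<Longrightarrow> ii (i u) = u"
    and open_i: "openin (mtop V) (i ` points U)"
    and ii: "\<And>u. u \<in> points U \<Longrightarrow> smooth_at V U ii (i u)"
    and ab: "\<And>h. h \<in> I \<Longrightarrow> a h \<in> Basis" "\<And>h. h \<in> I \<Longrightarrow> b h \<in> Basis" "\<And>h. h \<in> I \<Longrightarrow> a h \<noteq> b h"
    and J: "\<And>h x. h \<in> I \<Longrightarrow> smooth_at euclidean_mfd V (J h) x"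
    and G_J: "\<And>h x. h \<in> I \<Longrightarrow> G h (J h x) = x"
    and open_J: "\<And>h. h \<in> I \<Longrightarrow> openin (mtop V) (range (J h))"
    and G: "\<And>h x. h \<in> I \<Longrightarrow> smooth_at V euclidean_mfd (G h) (J h x)"
    and J_disjoint: "\<And>h h' x x'. h \<in> I \<Longrightarrow> h' \<in> I \<Longrightarrow> J h x = J h' x' \<Longrightarrow> h = h'"
    and cover: "\<And>v. v \<in> points V \<Longrightarrow> v \<in> i ` points U \<or> (\<exists>h\<in>I. v \<in> range (J h))"
    and J_U: "\<And>h x. h \<in> I \<Longrightarrow> J h x \<in> i ` points U \<longleftrightarrow> cmod (planar (a h) (b h) x) > 1"
    and closed_Z: "closedin (mtop V) (\<Union>h\<in>I. J h ` {x. cmod (planar (a h) (b h) x) \<le> 2})"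
begin

abbreviation "P h \<equiv> planar (a h) (b h)"
abbreviation "SP h \<equiv> set_planar (a h) (b h)"
abbreviation "E \<equiv> U \<times>\<^sub>M real_line"
abbreviation "RxE \<equiv> real_line \<times>\<^sub>M E"

text \<open>Outside of this set the handles leave no trace: the quotient map is \<open>i\<close> and
  the flow is a translation. Its closedness yields uniform formulas near every point that lies in no
  handle.\<close>

definition Z :: "'b set" where "Z = (\<Union>h\<in>I. J h ` {x. cmod (P h x) \<le> 2})"

lemma VA: "smooth_atlas V" using VM by (simp add: smooth_manifold_def)

lemma EA: "smooth_atlas E" and RE: "smooth_atlas RxE" using U by auto

lemma P_SP [simp]: "h \<in> I \<Longrightarrow> P h (SP h x z) = z"
  using planar_set_planar ab by blast

lemma SP_SP [simp]: "h \<in> I \<Longrightarrow> SP h (SP h x z) w = SP h x w"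
  using set_planar_set_planar ab by blast

definition in_handle :: "'b \<Rightarrow> bool" where "in_handle v \<longleftrightarrow> (\<exists>h\<in>I. v \<in> range (J h))"

definition handle_of :: "'b \<Rightarrow> nat" where "handle_of v = (SOME h. h \<in> I \<and> v \<in> range (J h))"

lemma handle_of [simp]: "h \<in> I \<Longrightarrow> handle_of (J h x) = h"
  unfolding handle_of_def by (rule some_equality) (use J_disjoint in auto)

lemma in_handle_J [simp]: "h \<in> I \<Longrightarrow> in_handle (J h x)"
  by (auto simp: in_handle_def)

text \<open>\<open>qs 0\<close> is the projection followed by \<open>i\<close>, and
  \<open>qs 1\<close> is going to be the quotient map. With the parameter kept as a variable, one
  proof of smoothness serves both the quotient map and the homotopy.\<close>

definition qs :: "real \<Rightarrow> 'a \<times> real \<Rightarrow> 'b" where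
  "qs s p = (let v = i (fst p); h = handle_of v; x = G h v in
     if in_handle v then J h (SP h x (collapse s (P h x, snd p))) else v)"

text \<open>The model flow never enters the closed unit disk, so the moved point of the handle is
  still in the image of \<open>U\<close> and can be pulled back by \<open>ii\<close>. Away from the
  handles the factor 2 agrees with \<open>local_flow_far\<close>.\<close>

definition flow :: "real \<Rightarrow> 'a \<times> real \<Rightarrow> 'a \<times> real" where
  "flow t p = (let v = i (fst p); h = handle_of v; x = G h v; r = local_flow t (P h x, snd p) in
     if in_handle v then (ii (J h (SP h x (fst r))), snd r) else (fst p, snd p + 2 * t))"

lemma qs_handle:
  "h \<in> I \<Longrightarrow> i u = J h x \<Longrightarrow> qs s (u, t) = J h (SP h x (collapse s (P h x, t)))"
  by (simp add: qs_def G_J Let_def)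

lemma qs_other: "\<not> in_handle (i u) \<Longrightarrow> qs s (u, t) = i u"
  by (simp add: qs_def Let_def)

lemma flow_handle:
  "h \<in> I \<Longrightarrow> i u = J h x \<Longrightarrow>
    flow t (u, t0) = (ii (J h (SP h x (fst (local_flow t (P h x, t0))))), snd (local_flow t (P h x, t0)))"
  by (simp add: flow_def G_J Let_def)

lemma flow_other: "\<not> in_handle (i u) \<Longrightarrow> flow t (u, t0) = (u, t0 + 2 * t)"
  by (simp add: flow_def Let_def)

lemma P_greater: "h \<in> I \<Longrightarrow> i u = J h x \<Longrightarrow> u \<in> points U \<Longrightarrow> cmod (P h x) > 1"
  using J_U by (metis imageI)

lemma in_handleE:
  assumes "in_handle (i u)" "u \<in> points U"
  obtains h x where "h \<in> I" "i u = J h x" "cmod (P h x) > 1"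
  using assms P_greater unfolding in_handle_def by (metis imageE)

lemma not_Z_far: "h \<in> I \<Longrightarrow> J h x \<notin> Z \<Longrightarrow> cmod (P h x) > 2"
  by (force simp: Z_def)

lemma qs_far: assumes "u \<in> points U" "i u \<notin> Z" shows "qs s (u, t) = i u"
proof (cases "in_handle (i u)")
  case True
  then obtain h x where h: "h \<in> I" "i u = J h x" using in_handleE assms by blast
  then show ?thesis using not_Z_far[of h x] assms by (simp add: qs_handle collapse_far)
qed (rule qs_other)

lemma flow_far: assumes "u \<in> points U" "i u \<notin> Z" shows "flow t (u, t0) = (u, t0 + 2 * t)"
proof (cases "in_handle (i u)")
  case True
  then obtain h x where h: "h \<in> I" "i u = J h x" using in_handleE assms by blast
  then have "cmod (P h x) > 2" using not_Z_far[of h x] assms by simp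
  then have "local_flow t (P h x, t0) = (P h x, t0 + 2 * t)"
    by (subst local_flow_far) auto
  moreover have "ii (J h x) = u" using ii_i[OF assms(1)] h(2) by simp
  ultimately show ?thesis by (simp add: flow_handle[OF h])
qed (rule flow_other)

lemma ii_J:
  assumes "h \<in> I" "cmod (P h x) > 1"
  shows "ii (J h x) \<in> points U" "i (ii (J h x)) = J h x"
proof -
  obtain u where "u \<in> points U" "J h x = i u" using J_U[OF assms(1)] assms(2) by blast
  then show "ii (J h x) \<in> points U" "i (ii (J h x)) = J h x" using ii_i by auto
qed

section \<open>Orbits of the glued flow\<close>

lemma qs_0: "u \<in> points U \<Longrightarrow> qs 0 (u, t) = i u"
  by (cases "in_handle (i u)") (auto simp: qs_other qs_handle elim!: in_handleE)

lemma flow_0: "u \<in> points U \<Longrightarrow> flow 0 (u, t) = (u, t)"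
proof (cases "in_handle (i u)")
  case True assume u: "u \<in> points U"
  obtain h x where h: "h \<in> I" "i u = J h x" "cmod (P h x) > 1" using in_handleE[OF True u] .
  have "local_flow 0 (P h x, t) = (P h x, t)" using h by (intro local_flow_0) auto
  moreover have "ii (J h x) = u" using ii_i[OF u] h(2) by simp
  ultimately show ?thesis by (simp add: flow_handle[OF h(1,2)])
qed (simp add: flow_other)

lemma
  assumes u: "u \<in> points U"
  shows flow_add: "flow s (flow t (u, t0)) = flow (s + t) (u, t0)"
    and qs_flow: "qs 1 (flow t (u, t0)) = qs 1 (u, t0)"
proof -
  have "flow s (flow t (u, t0)) = flow (s + t) (u, t0) \<and> qs 1 (flow t (u, t0)) = qs 1 (u, t0)"
  proof (cases "in_handle (i u)")
    case True
    obtain h x where h: "h \<in> I" "i u = J h x" "cmod (P h x) > 1" using in_handleE[OF True u] .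
    define p where "p = (P h x, t0)"
    define r where "r = local_flow t p"
    have p: "p \<in> outside" using h by (simp add: p_def)
    have r: "r \<in> outside" unfolding r_def by (rule local_flow_outside[OF p])
    have f: "flow t (u, t0) = (ii (J h (SP h x (fst r))), snd r)"
      using h by (simp add: flow_handle r_def p_def)
    have ir: "i (ii (J h (SP h x (fst r)))) = J h (SP h x (fst r))"
      using h r by (intro ii_J) auto
    have "flow s (flow t (u, t0)) = (ii (J h (SP h x (fst (local_flow s r)))), snd (local_flow s r))"
      unfolding f flow_handle[OF h(1) ir] using h(1) by simp
    moreover have "local_flow s r = local_flow (s + t) p"
      unfolding r_def by (rule local_flow_add[OF p])
    moreover have "qs 1 (flow t (u, t0)) = J h (SP h x (collapse 1 r))"
      unfolding f qs_handle[OF h(1) ir] using h(1) by simp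
    moreover have "collapse 1 r = collapse 1 p" unfolding r_def by (rule collapse_local_flow[OF p])
    ultimately show ?thesis
      using h(1,2) by (simp add: flow_handle qs_handle p_def)
  next
    case False
    then show ?thesis by (simp add: flow_other qs_other algebra_simps)
  qed
  then show "flow s (flow t (u, t0)) = flow (s + t) (u, t0)"
    "qs 1 (flow t (u, t0)) = qs 1 (u, t0)" by auto
qed

lemma qs_in_range: "h \<in> I \<Longrightarrow> i u = J h x \<Longrightarrow> qs s (u, t) \<in> range (J h)"
  by (simp add: qs_handle)

lemma flow_transitive:
  assumes u: "u \<in> points U" and u': "u' \<in> points U" and eq: "qs 1 (u, t) = qs 1 (u', t')"
  shows "\<exists>s. flow s (u, t) = (u', t')"
proof (cases "in_handle (i u) \<or> in_handle (i u')")
  case True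
  \<comment> \<open>\<open>qs\<close> respects membership in a handle, so that two points with the
    same image are over handles simultaneously, and then over the same one.\<close>
  have "in_handle (qs s (u, t)) \<longleftrightarrow> in_handle (i u)" if "u \<in> points U" for s u t
    by (cases "in_handle (i u)") (auto simp: qs_other qs_handle elim!: in_handleE[OF _ that])
  then have "in_handle (i u)" "in_handle (i u')" using True u u' eq by metis+
  then obtain h x h' x' where h: "h \<in> I" "i u = J h x" "cmod (P h x) > 1"
    and h': "h' \<in> I" "i u' = J h' x'" "cmod (P h' x') > 1"
    using in_handleE u u' by metis
  have hh: "h' = h"
    using eq[symmetric] J_disjoint[OF h'(1) h(1)]
    unfolding qs_handle[OF h(1,2)] qs_handle[OF h'(1,2)] by blast
  have "SP h x (collapse 1 (P h x, t)) = SP h x' (collapse 1 (P h x', t'))"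
    using arg_cong[OF eq, of "G h"] h h' by (simp add: qs_handle G_J hh)
  then have col: "collapse 1 (P h x, t) = collapse 1 (P h x', t')" and rest: "SP h x 0 = SP h x' 0"
    using set_planar_eq_iff[OF ab[OF h(1)]] by blast+
  obtain s where s: "local_flow s (P h x, t) = (P h x', t')"
    by (rule local_flow_transitive[OF _ _ col]) (use h h' hh in auto)
  \<comment> \<open>The complementary coordinates of \<open>x\<close> and \<open>x'\<close> agree,
    so inserting the planar coordinates of \<open>x'\<close> into \<open>x\<close> gives
    \<open>x'\<close>.\<close>
  have "SP h x (P h x') = SP h x' (P h x')"
    using set_planar_eq_iff[OF ab[OF h(1)]] rest by blast
  then have "flow s (u, t) = (ii (J h x'), t')" using h by (simp add: flow_handle s)
  then show ?thesis using h' hh ii_i[OF u'] by auto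
next
  case False
  then have "i u = i u'" using eq by (simp add: qs_other)
  then have "u = u'" using ii_i u u' by metis
  then have "flow ((t' - t) / 2) (u, t) = (u', t')" using False by (simp add: flow_other field_simps)
  then show ?thesis by blast
qed

lemma flow_moves: assumes u: "u \<in> points U" shows "\<exists>s. flow s (u, t) \<noteq> (u, t)"
proof (cases "in_handle (i u)")
  case True
  obtain h x where h: "h \<in> I" "i u = J h x" "cmod (P h x) > 1" using in_handleE[OF True u] .
  have p: "(P h x, t) \<in> outside" using h by simp
  obtain s where s: "local_flow s (P h x, t) \<noteq> (P h x, t)" using local_flow_moves[OF p] by blast
  define r where "r = local_flow s (P h x, t)"
  have r: "cmod (fst r) > 1" using local_flow_outside[OF p] by (simp add: r_def)
  have "flow s (u, t) \<noteq> (u, t)"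
  proof
    assume "flow s (u, t) = (u, t)"
    then have eq: "ii (J h (SP h x (fst r))) = u" "snd r = t" using h by (auto simp: flow_handle r_def)
    then have "J h (SP h x (fst r)) = J h x" using ii_J(2)[OF h(1), of "SP h x (fst r)"] r h by simp
    then have "SP h x (fst r) = x" using G_J[OF h(1)] by metis
    then have "fst r = P h x" using P_SP[OF h(1)] by metis
    then show False using s eq by (auto simp: r_def prod_eq_iff)
  qed
  then show ?thesis by blast
next
  case False
  then show ?thesis by (intro exI[of _ 1]) (simp add: flow_other)
qed

lemma qs_surj: "qs 1 ` points E = points V"
proof
  show "qs 1 ` points E \<subseteq> points V"
  proof clarify
    fix u t assume "(u, t) \<in> points E"
    then have u: "u \<in> points U" by simp
    show "qs 1 (u, t) \<in> points V"
    proof (cases "in_handle (i u)")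
      case True
      obtain h x where h: "h \<in> I" "i u = J h x" "cmod (P h x) > 1" using in_handleE[OF True u] .
      then show ?thesis using qs_in_range[of h u x 1 t] openin_subset[OF open_J[of h]] by auto
    next
      case False
      then show ?thesis using u openin_subset[OF open_i] by (auto simp: qs_other)
    qed
  qed
  show "points V \<subseteq> qs 1 ` points E"
  proof
    fix v assume v: "v \<in> points V"
    show "v \<in> qs 1 ` points E"
    proof (cases "in_handle v")
      case True
      then obtain h x where h: "h \<in> I" "v = J h x" by (auto simp: in_handle_def)
      obtain p where p: "p \<in> outside" "collapse 1 p = P h x" using collapse_surj .
      define y where "y = SP h x (fst p)"
      have y: "cmod (P h y) > 1" using p h by (simp add: y_def)
      have "qs 1 (ii (J h y), snd p) = v"
        using qs_handle[OF h(1) ii_J(2)[OF h(1) y]] h p by (simp add: y_def)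
      then show ?thesis using ii_J(1)[OF h(1) y] by (intro image_eqI[of _ _ "(ii (J h y), snd p)"]) auto
    next
      case False
      then obtain u where u: "u \<in> points U" "v = i u" using cover[OF v] by (auto simp: in_handle_def)
      then have "qs 1 (u, 0) = v" using False by (simp add: qs_other)
      then show ?thesis using u by (intro image_eqI[of _ _ "(u, 0)"]) auto
    qed
  qed
qed

lemma orbit_eq_iff:
  assumes p: "p \<in> points E" and q: "q \<in> points E"
  shows "orbit flow p = orbit flow q \<longleftrightarrow> qs 1 p = qs 1 q"
proof -
  obtain u t where pu: "p = (u, t)" "u \<in> points U" using p by auto
  obtain u' t' where qu: "q = (u', t')" "u' \<in> points U" using q by auto
  show ?thesis
  proof
    assume eq: "orbit flow p = orbit flow q"
    have "q \<in> orbit flow q" unfolding orbit_def using flow_0[OF qu(2)] qu by (metis rangeI)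
    then obtain s where "q = flow s p" using eq by (auto simp: orbit_def)
    then show "qs 1 p = qs 1 q" using qs_flow[OF pu(2)] pu by simp
  next
    assume "qs 1 p = qs 1 q"
    then obtain s where s: "flow s p = q" using flow_transitive pu qu by metis
    have 1: "flow r q = flow (r + s) p" for r using flow_add[OF pu(2)] s pu by metis
    then have 2: "flow r p = flow (r - s) q" for r using 1[of "r - s"] by simp
    show "orbit flow p = orbit flow q"
    proof -
      have "flow r p \<in> orbit flow q" for r unfolding 2[of r] orbit_def by (rule rangeI)
      moreover have "flow r q \<in> orbit flow p" for r unfolding 1[of r] orbit_def by (rule rangeI)
      ultimately show ?thesis by (auto simp: orbit_def)
    qed
  qed
qed

section \<open>Smoothness of the glued flow and sections of its quotient map\<close>

lemma open_handle_part: "h \<in> I \<Longrightarrow> openin (mtop U) {u \<in> points U. i u \<in> range (J h)}"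
  by (intro openin_preimage_smooth[OF U VA _ i] open_J) auto

lemma open_far_part: "openin (mtop U) {u \<in> points U. i u \<in> points V - Z}"
  using closed_Z by (intro openin_preimage_smooth[OF U VA _ i]) (auto simp: closedin_def Z_def)

lemma smooth_at_proj:
  assumes "p \<in> points RxE"
  shows "smooth_at RxE real_line fst p"
    "smooth_at RxE U (\<lambda>p. fst (snd p)) p"
    "smooth_at RxE real_line (\<lambda>p. snd (snd p)) p"
proof -
  show "smooth_at RxE real_line fst p"
    using assms U by (intro smooth_at_fst_snd) auto
  have s: "smooth_at RxE E snd p"
    using assms U by (intro smooth_at_fst_snd) auto
  show "smooth_at RxE U (\<lambda>p. fst (snd p)) p"
    using assms by (intro smooth_at_compose[OF RE EA U _ s] smooth_at_fst_snd U) auto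
  show "smooth_at RxE real_line (\<lambda>p. snd (snd p)) p"
    using assms by (intro smooth_at_compose[OF RE EA _ _ s] smooth_at_fst_snd U) auto
qed

lemma smooth_at_handle_coords:
  assumes p: "p \<in> points RxE" and h: "h \<in> I" "i (fst (snd p)) = J h x"
  shows "smooth_at RxE euclidean_mfd (\<lambda>p. (fst p, G h (i (fst (snd p))), snd (snd p))) p"
proof -
  have u: "fst (snd p) \<in> points U" using p by auto
  have "smooth_at RxE V (\<lambda>p. i (fst (snd p))) p"
    by (rule smooth_at_compose[OF RE U VA i[OF u] smooth_at_proj(2)[OF p]])
  moreover have "smooth_at V euclidean_mfd (G h) (i (fst (snd p)))"
    using G[OF h(1), of x] h by simp
  ultimately have "smooth_at RxE euclidean_mfd (\<lambda>p. G h (i (fst (snd p)))) p"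
    by (rule smooth_at_compose[OF RE VA smooth_atlas_euclidean, rotated])
  then show ?thesis
    by (intro smooth_at_euclidean_Pair[OF RE] smooth_at_proj[OF p])
qed

text \<open>The domain of the formulas of the model. The components are the flow time or homotopy
  parameter, the point of the handle and the line coordinate.\<close>

definition coords :: "nat \<Rightarrow> (real \<times> 'e \<times> real) set" where
  "coords h = {x. cmod (P h (fst (snd x))) > 1}"

lemma open_coords: "open (coords h)"
proof -
  have "smooth_on UNIV (\<lambda>x :: real \<times> 'e \<times> real. P h (fst (snd x)))"
    by (intro smooth_intros) auto
  then have "continuous_on UNIV (\<lambda>x :: real \<times> 'e \<times> real. cmod (P h (fst (snd x))))"
    by (intro continuous_on_norm smooth_on_imp_continuous_on)
  then have "open ((\<lambda>x :: real \<times> 'e \<times> real. cmod (P h (fst (snd x)))) -` {1<..})"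
    by (intro open_vimage) auto
  then show ?thesis by (simp add: coords_def vimage_def)
qed

lemma smooth_on_coords:
  "smooth_on (coords h) (\<lambda>x. SP h (fst (snd x)) (collapse (fst x) (P h (fst (snd x)), snd (snd x))))"
  "smooth_on (coords h) (\<lambda>x. SP h (fst (snd x)) (fst (local_flow (fst x) (P h (fst (snd x)), snd (snd x)))))"
  "smooth_on (coords h) (\<lambda>x. snd (local_flow (fst x) (P h (fst (snd x)), snd (snd x))))"
proof -
  have s: "smooth_on (coords h) (\<lambda>x. (fst x, (P h (fst (snd x)), snd (snd x))))"
    by (intro smooth_intros open_coords)
  have img: "(\<lambda>x. (fst x, (P h (fst (snd x)), snd (snd x)))) ` coords h \<subseteq> UNIV \<times> outside"
    by (auto simp: coords_def)
  have o: "open (UNIV \<times> outside :: (real \<times> complex \<times> real) set)"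
    by (intro open_Times open_UNIV open_outside)
  have 1: "smooth_on (coords h) (\<lambda>x. collapse (fst x) (P h (fst (snd x)), snd (snd x)))"
    using smooth_on_compose[OF smooth_on_collapse s open_coords o img] by simp
  have 2: "smooth_on (coords h) (\<lambda>x. local_flow (fst x) (P h (fst (snd x)), snd (snd x)))"
    using smooth_on_compose[OF smooth_on_local_flow s open_coords o img] by simp
  show "smooth_on (coords h) (\<lambda>x. SP h (fst (snd x)) (collapse (fst x) (P h (fst (snd x)), snd (snd x))))"
    "smooth_on (coords h) (\<lambda>x. SP h (fst (snd x)) (fst (local_flow (fst x) (P h (fst (snd x)), snd (snd x)))))"
    "smooth_on (coords h) (\<lambda>x. snd (local_flow (fst x) (P h (fst (snd x)), snd (snd x))))"
    by (intro smooth_intros open_coords 1 2)+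
qed

text \<open>A point that lies in no handle may still be a limit of points of handles, but not of
  points of \<open>Z\<close>. Its neighbourhood off \<open>Z\<close> can meet handles only where the
  flow is a translation and \<open>qs\<close> equals \<open>i\<close>. Hence one formula is valid
  near each point, be it that of a handle or that of the far part.\<close>

lemma
  assumes p: "p \<in> points RxE"
  shows qs_smooth_at: "smooth_at RxE V (\<lambda>(s, x). qs s x) p"
    and flow_smooth_at: "smooth_at RxE E (\<lambda>(s, x). flow s x) p"
proof -
    have u: "fst (snd p) \<in> points U" using p by auto
  have "smooth_at RxE V (\<lambda>(s, x). qs s x) p \<and> smooth_at RxE E (\<lambda>(s, x). flow s x) p"
  proof (cases "in_handle (i (fst (snd p)))")
    case True
    obtain h x where h: "h \<in> I" "i (fst (snd p)) = J h x" "cmod (P h x) > 1" using in_handleE[OF True u] .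
    define T where "T = (UNIV :: real set) \<times> ({u \<in> points U. i u \<in> range (J h)} \<times> (UNIV :: real set))"
    have T: "openin (mtop RxE) T"
      unfolding T_def using open_handle_part[OF h(1)] by (simp add: openin_prod_Times_iff)
    have pT: "p \<in> T" using u h by (simp add: T_def mem_Times_iff)
    define c where "c = (\<lambda>p :: real \<times> 'a \<times> real. (fst p, G h (i (fst (snd p))), snd (snd p)))"
    have c: "smooth_at RxE euclidean_mfd c p" unfolding c_def by (rule smooth_at_handle_coords[OF p h(1,2)])
    have cp: "c p \<in> coords h" using h by (simp add: c_def coords_def G_J)
    note sm = smooth_at_compose_smooth_on[OF RE c _ open_coords cp]
    have "smooth_at RxE V (\<lambda>p. J h (SP h (fst (snd (c p))) (collapse (fst (c p)) (P h (fst (snd (c p))), snd (snd (c p)))))) p"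
      by (rule smooth_at_compose[OF RE _ VA J[OF h(1)] sm[OF smooth_on_coords(1)]]) simp
    then have 1: "smooth_at RxE V (\<lambda>(s, x). qs s x) p"
      by (rule smooth_at_cong[OF RE _ T pT]) (auto simp: T_def c_def qs_handle[OF h(1)] G_J[OF h(1)])
    define k where "k = (\<lambda>p. SP h (fst (snd (c p))) (fst (local_flow (fst (c p)) (P h (fst (snd (c p))), snd (snd (c p))))))"
    have k: "smooth_at RxE V (\<lambda>p. J h (k p)) p"
      unfolding k_def by (rule smooth_at_compose[OF RE _ VA J[OF h(1)] sm[OF smooth_on_coords(2)]]) simp
    have out: "local_flow (fst (c p)) (P h (fst (snd (c p))), snd (snd (c p))) \<in> outside"
      using h by (intro local_flow_outside) (simp add: c_def G_J)
    then have "cmod (P h (k p)) > 1" using h by (simp add: k_def)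
    then obtain u' where "u' \<in> points U" "J h (k p) = i u'" using J_U[OF h(1)] by blast
    then have "smooth_at V U ii (J h (k p))" using ii by simp
    then have "smooth_at RxE U (\<lambda>p. ii (J h (k p))) p" using k by (rule smooth_at_compose[OF RE VA U])
    then have "smooth_at RxE E (\<lambda>p. (ii (J h (k p)), snd (local_flow (fst (c p)) (P h (fst (snd (c p))), snd (snd (c p)))))) p"
      by (intro smooth_at_Pair RE U sm[OF smooth_on_coords(3)]) auto
    then have 2: "smooth_at RxE E (\<lambda>(s, x). flow s x) p"
      by (rule smooth_at_cong[OF RE _ T pT]) (auto simp: T_def c_def k_def flow_handle[OF h(1)] G_J[OF h(1)])
    show ?thesis using 1 2 by blast
  next
    case False
    define T where "T = (UNIV :: real set) \<times> ({u \<in> points U. i u \<in> points V - Z} \<times> (UNIV :: real set))"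
    have T: "openin (mtop RxE) T"
      unfolding T_def using open_far_part by (simp add: openin_prod_Times_iff)
    have "i (fst (snd p)) \<notin> Z" using False by (auto simp: Z_def)
    moreover have "i (fst (snd p)) \<in> points V" using u openin_subset[OF open_i] by auto
    ultimately have pT: "p \<in> T" using u by (simp add: T_def mem_Times_iff)
    have "smooth_at RxE V (\<lambda>p. i (fst (snd p))) p"
      by (rule smooth_at_compose[OF RE U VA i[OF u] smooth_at_proj(2)[OF p]])
    then have 1: "smooth_at RxE V (\<lambda>(s, x). qs s x) p"
      by (rule smooth_at_cong[OF RE _ T pT]) (auto simp: T_def qs_far)
    have "smooth_at RxE real_line (\<lambda>p. (\<lambda>x. snd x + 2 * fst x) (fst p, snd (snd p))) p"
      by (rule smooth_at_compose_smooth_on[OF RE smooth_at_euclidean_Pair[OF RE smooth_at_proj(1,3)[OF p]], of UNIV])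
         (auto intro!: smooth_intros)
    then have "smooth_at RxE E (\<lambda>p. (fst (snd p), snd (snd p) + 2 * fst p)) p"
      by (intro smooth_at_Pair RE U smooth_at_proj(2)[OF p]) auto
    then have 2: "smooth_at RxE E (\<lambda>(s, x). flow s x) p"
      by (rule smooth_at_cong[OF RE _ T pT]) (auto simp: T_def flow_far)
    show ?thesis using 1 2 by blast
  qed
  then show "smooth_at RxE V (\<lambda>(s, x). qs s x) p" "smooth_at RxE E (\<lambda>(s, x). flow s x) p" by auto
qed

lemma smooth_flow: "smooth_flow E flow"
  unfolding smooth_flow_def smooth_map_iff_smooth_at[OF RE EA]
  using flow_smooth_at flow_0 flow_add by auto

lemma fixed_point_free: "fixed_point_free E flow"
  unfolding fixed_point_free_def using flow_moves by fastforce

lemma smooth_qs: "smooth_map E V (qs 1)"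
  unfolding smooth_map_iff_smooth_at[OF EA VA]
proof
  fix p assume p: "p \<in> points E"
  have "smooth_at E RxE (\<lambda>p. (1, p)) p"
    using p by (intro smooth_at_Pair EA smooth_at_const smooth_at_id) auto
  from smooth_at_compose[OF EA RE VA qs_smooth_at this]
  show "smooth_at E V (qs 1) p" using p by simp
qed

text \<open>In a handle, the section of the model is inserted in the planar coordinates while the
  others are kept. Away from the handles, \<open>ii\<close> together with the constant line
  coordinate \<open>t\<close> is a section.\<close>

lemma qs_section:
  assumes p: "p \<in> points E"
  shows "\<exists>s W. openin (mtop V) W \<and> qs 1 p \<in> W \<and> (\<forall>v\<in>W. qs 1 (s v) = v) \<and>
    s (qs 1 p) = p \<and> smooth_at V E s (qs 1 p)"
proof -
  obtain u t where pu: "p = (u, t)" and u: "u \<in> points U" using p by auto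
  show ?thesis
  proof (cases "in_handle (i u)")
    case True
    obtain h x where h: "h \<in> I" "i u = J h x" "cmod (P h x) > 1" using in_handleE[OF True u] .
    have out: "(P h x, t) \<in> outside" using h by simp
    obtain s W where W: "open W" "collapse 1 (P h x, t) \<in> W" "smooth_on W s" "s ` W \<subseteq> outside"
      "\<And>Q. Q \<in> W \<Longrightarrow> collapse 1 (s Q) = Q" "s (collapse 1 (P h x, t)) = (P h x, t)"
      using local_section[OF out] by metis
    define y0 where "y0 = SP h x (collapse 1 (P h x, t))"
    have q: "qs 1 p = J h y0" using h by (simp add: pu qs_handle y0_def)
    have Py0: "P h y0 = collapse 1 (P h x, t)" using h by (simp add: y0_def)
    define S where "S v = (let y = G h v; r = s (P h y) in (ii (J h (SP h y (fst r))), snd r))" for v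
    define Y where "Y = {y. P h y \<in> W}"
    have oY: "open Y"
    proof -
      have "continuous_on UNIV (P h)"
        by (intro smooth_on_imp_continuous_on smooth_intros) auto
      then have "open (P h -` W)" using W(1) by (intro open_vimage)
      then show ?thesis by (simp add: Y_def vimage_def)
    qed
    define R where "R = {v \<in> range (J h). G h v \<in> Y}"
    have R: "openin (mtop V) R"
      unfolding R_def using open_J[OF h(1)] oY G[OF h(1)]
      by (intro openin_preimage_smooth[OF VA smooth_atlas_euclidean]) auto
    have "qs 1 p \<in> R" using W(2) h by (simp add: R_def q G_J Y_def Py0)
    moreover have "qs 1 (S v) = v" if v: "v \<in> R" for v
    proof -
      obtain y where y: "v = J h y" "P h y \<in> W" using v h by (auto simp: R_def Y_def G_J)
      have "s (P h y) \<in> outside" using W(4) y by auto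
      then have "i (ii (J h (SP h y (fst (s (P h y)))))) = J h (SP h y (fst (s (P h y))))"
        using h by (intro ii_J) auto
      then have "qs 1 (S v) = J h (SP h y (collapse 1 (s (P h y))))"
        using h by (simp add: S_def y G_J Let_def qs_handle[OF h(1)])
      then show ?thesis using W(5)[OF y(2)] by (simp add: y)
    qed
    moreover have "S (qs 1 p) = p"
      using h ii_i[OF u] by (simp add: q S_def G_J Py0 W(6) Let_def) (simp add: y0_def pu flip: h(2))
    moreover have "smooth_at V E S (qs 1 p)"
    proof -
      have s1: "smooth_on Y (\<lambda>y. s (P h y))"
        by (rule smooth_on_compose[OF W(3) _ oY W(1)]) (auto simp: Y_def intro!: smooth_intros oY[unfolded Y_def])
      have g: "smooth_at V euclidean_mfd (G h) (J h y0)" by (rule G[OF h(1)])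
      have gY: "G h (J h y0) \<in> Y" using h W(2) by (simp add: G_J Y_def Py0)
      note sm = smooth_at_compose_smooth_on[OF VA g _ oY gY]
      have "smooth_at V euclidean_mfd (\<lambda>v. SP h (G h v) (fst (s (P h (G h v))))) (J h y0)"
        by (rule sm[of "\<lambda>y. SP h y (fst (s (P h y)))"]) (intro smooth_intros s1 oY)
      then have "smooth_at V V (\<lambda>v. J h (SP h (G h v) (fst (s (P h (G h v)))))) (J h y0)"
        by (rule smooth_at_compose[OF VA _ VA J[OF h(1)], rotated]) simp
      moreover have "smooth_at V U ii (J h (SP h (G h (J h y0)) (fst (s (P h (G h (J h y0)))))))"
        using h ii[OF u] by (simp add: G_J Py0 W(6)) (simp add: y0_def flip: h(2))
      ultimately have "smooth_at V U (\<lambda>v. ii (J h (SP h (G h v) (fst (s (P h (G h v))))))) (J h y0)"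
        by (rule smooth_at_compose[OF VA VA U, rotated])
      moreover have "smooth_at V real_line (\<lambda>v. snd (s (P h (G h v)))) (J h y0)"
        by (rule sm[of "\<lambda>y. snd (s (P h y))"]) (intro smooth_intros s1 oY)
      ultimately show ?thesis
        unfolding q S_def Let_def by (intro smooth_at_Pair VA U) auto
    qed
    ultimately show ?thesis using R by (intro exI[of _ S] exI[of _ R]) simp
  next
    case False
    then have nZ: "i u \<notin> Z" by (auto simp: Z_def)
    define R where "R = i ` points U \<inter> (points V - Z)"
    have "openin (mtop V) R" unfolding R_def using open_i closed_Z by (auto simp: closedin_def Z_def)
    moreover have "qs 1 p = i u" using False by (simp add: pu qs_other)
    moreover have "i u \<in> R" using u nZ openin_subset[OF open_i] by (auto simp: R_def)
    moreover have "qs 1 (ii v, t) = v" if v: "v \<in> R" for v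
    proof -
      obtain w where "w \<in> points U" "v = i w" "v \<notin> Z" using v by (auto simp: R_def)
      then show ?thesis using ii_i qs_far by auto
    qed
    moreover have "smooth_at V E (\<lambda>v. (ii v, t)) (i u)"
      using u ii[OF u] smooth_at_in_points[OF U VA i[OF u]]
      by (intro smooth_at_Pair VA U smooth_at_const) auto
    ultimately show ?thesis
      using ii_i[OF u] by (intro exI[of _ "\<lambda>v. (ii v, t)"] exI[of _ R]) (simp add: pu)
  qed
qed

section \<open>The homotopy from the quotient map to the embedding\<close>

lemma homotopic_qs: "homotopic_with (\<lambda>x. True) (mtop E) (mtop V) (qs 1) (i \<circ> fst)"
proof -
  have "smooth_map RxE V (\<lambda>(s, x). qs s x)"
    unfolding smooth_map_iff_smooth_at[OF RE VA] using qs_smooth_at by blast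
  then have "continuous_map (prod_topology euclidean (mtop E)) (mtop V) (\<lambda>(s, x). qs s x)"
    by (simp add: smooth_map_def)
  then have "continuous_map (prod_topology (top_of_set {0..1}) (mtop E)) (mtop V) (\<lambda>(s, x). qs s x)"
    by (metis continuous_map_from_subtopology prod_topology_subtopology(1))
  then have "homotopic_with (\<lambda>x. True) (mtop E) (mtop V) (i \<circ> fst) (qs 1)"
    using qs_0 by (subst homotopic_with) (auto intro!: exI[of _ "\<lambda>(s, x). qs s x"])
  then show ?thesis by (rule homotopic_with_symD)
qed

text \<open>The two equivalences are the projection, with the zero section as homotopy inverse, and
  the identity of \<open>V\<close>. The map \<open>q\<close> comes from the orbit space, hence
  agreement with \<open>qs 1\<close> is available on the points of the manifold only.\<close>

lemma homotopy_equivalent_qs: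
  assumes "\<And>x. x \<in> points E \<Longrightarrow> q x = qs 1 x"
  shows "homotopy_equivalent_maps (mtop E) (mtop V) q (mtop U) (mtop V) i"
  unfolding homotopy_equivalent_maps_def
proof (intro exI conjI)
  have cf: "continuous_map (mtop E) (mtop U) fst" by (simp add: continuous_map_fst)
  have cg: "continuous_map (mtop U) (mtop E) (\<lambda>u. (u, 0))"
    by (simp add: continuous_map_pairedI)
  have "continuous_map (prod_topology (top_of_set {0..1}) (mtop E))
      (prod_topology (mtop U) (mtop real_line)) (\<lambda>x. (fst (snd x), fst x * snd (snd x)))"
  proof (rule continuous_map_pairedI)
    let ?X = "prod_topology (top_of_set {0..1::real}) (mtop E)"
    have "continuous_map ?X (mtop U) (fst \<circ> snd)"
      using cf by (rule continuous_map_compose[OF continuous_map_snd])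
    then show "continuous_map ?X (mtop U) (\<lambda>x. fst (snd x))" by (simp add: comp_def)
    have 1: "continuous_map ?X euclideanreal fst"
      by (rule continuous_map_into_fulltopology[OF continuous_map_fst])
    have "continuous_map (mtop E) euclideanreal snd" by (simp add: continuous_map_snd)
    then have "continuous_map ?X euclideanreal (snd \<circ> snd)"
      by (rule continuous_map_compose[OF continuous_map_snd])
    then have "continuous_map ?X euclideanreal (\<lambda>x. fst x * snd (snd x))"
      using 1 by (intro continuous_map_real_mult) (auto simp: comp_def)
    then show "continuous_map ?X (mtop real_line) (\<lambda>x. fst x * snd (snd x))" by simp
  qed
  then have "homotopic_with (\<lambda>x. True) (mtop E) (mtop E) ((\<lambda>u. (u, 0)) \<circ> fst) id"
    by (subst homotopic_with) (auto intro!: exI[of _ "\<lambda>x. (fst (snd x), fst x * snd (snd x))"])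
  then show "homotopy_equivalence_map (mtop E) (mtop U) fst"
    unfolding homotopy_equivalence_map_def using cf cg
    by (intro conjI exI[of _ "\<lambda>u. (u, 0)"]) (auto simp: comp_def id_def homotopic_with_refl)
  show "homotopy_equivalence_map (mtop V) (mtop V) id"
    unfolding homotopy_equivalence_map_def
    by (intro conjI exI[of _ id]) (auto simp: homotopic_with_refl)
  show "homotopic_with (\<lambda>x. True) (mtop E) (mtop V) (id \<circ> q) (i \<circ> fst)"
    by (rule homotopic_with_eq[OF homotopic_qs]) (use assms in auto)
qed

theorem flow_exists:
  "\<exists>\<phi> q. smooth_flow E \<phi> \<and> fixed_point_free E \<phi> \<and> has_quotient E \<phi> V q \<and>
     homotopy_equivalent_maps (mtop E) (mtop V) q (mtop U) (mtop V) i"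
proof -
  obtain q where "has_quotient E flow V q" "\<And>x. x \<in> points E \<Longrightarrow> q x = qs 1 x"
    using has_quotient_if_sections[OF EA VM smooth_qs qs_surj orbit_eq_iff qs_section] by blast
  then show ?thesis using smooth_flow fixed_point_free homotopy_equivalent_qs by blast
qed

end

section \<open>Thinning the handles\<close>

lemma norm_le_planar:
  assumes "a \<in> Basis" "b \<in> Basis"
  shows "norm x \<le> norm (set_planar a b x 0) + 2 * cmod (planar a b x)"
proof -
  have "x = set_planar a b x 0 + (Re (planar a b x) *\<^sub>R a + Im (planar a b x) *\<^sub>R b)"
    by (simp add: set_planar_def planar_def)
  then have "norm x \<le> norm (set_planar a b x 0) + norm (Re (planar a b x) *\<^sub>R a + Im (planar a b x) *\<^sub>R b)"
    by (metis norm_triangle_ineq)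
  also have "norm (Re (planar a b x) *\<^sub>R a + Im (planar a b x) *\<^sub>R b) \<le>
      \<bar>Re (planar a b x)\<bar> + \<bar>Im (planar a b x)\<bar>"
    using assms by (intro norm_triangle_le) simp
  also have "\<dots> \<le> 2 * cmod (planar a b x)"
    using abs_Re_le_cmod[of "planar a b x"] abs_Im_le_cmod[of "planar a b x"] by simp
  finally show ?thesis by simp
qed

lemma continuous_on_planar: "continuous_on S (planar a b)"
  and continuous_on_set_planar:
    "continuous_on S f \<Longrightarrow> continuous_on S g \<Longrightarrow> continuous_on S (\<lambda>x. set_planar a b (f x) (g x))"
  unfolding planar_def[abs_def] set_planar_def by (intro continuous_intros)+

abbreviation planar_sq :: "'e::euclidean_space \<Rightarrow> 'e \<Rightarrow> 'e \<Rightarrow> real" where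
  "planar_sq a b x \<equiv> planar a b x \<bullet> planar a b x"

text \<open>The norm is squared in order to be smooth also where the complementary coordinates
  vanish.\<close>

definition height :: "'e::euclidean_space \<Rightarrow> 'e \<Rightarrow> 'e \<Rightarrow> real" where
  "height a b x = (norm (set_planar a b x 0))\<^sup>2"

lemma compact_handle_part:
  assumes ab: "a \<in> Basis" "b \<in> Basis"
  shows "compact {x. cmod (planar a b x) \<le> c \<and> height a b x \<le> d}"
proof (rule compact_eq_bounded_closed[THEN iffD2], rule conjI)
  have "norm x \<le> sqrt d + 2 * c" if "cmod (planar a b x) \<le> c" "height a b x \<le> d" for x
    using norm_le_planar[OF ab, of x] real_le_rsqrt[of "norm (set_planar a b x 0)" d] that
    by (simp add: height_def)
  then show "bounded {x. cmod (planar a b x) \<le> c \<and> height a b x \<le> d}"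
    unfolding bounded_iff by blast
  show "closed {x. cmod (planar a b x) \<le> c \<and> height a b x \<le> d}"
    unfolding height_def
    by (intro closed_Collect_conj closed_Collect_le continuous_intros continuous_on_planar continuous_on_set_planar)
qed

text \<open>
  The square of the planar radius is changed by the Moebius transformation which fixes \<open>0\<close> and
  \<open>1\<close> and sends \<open>\<infinity>\<close> to \<open>1 + 1 / e\<close>.
\<close>

definition shrink :: "'e::euclidean_space \<Rightarrow> 'e \<Rightarrow> (real \<Rightarrow> real) \<Rightarrow> 'e \<Rightarrow> 'e" where
  "shrink a b E x = (let e = E (height a b x); z = planar a b x in
     set_planar a b x (of_real (sqrt ((e + 1) / (1 + e * (z \<bullet> z)))) * z))"

definition expand :: "'e::euclidean_space \<Rightarrow> 'e \<Rightarrow> (real \<Rightarrow> real) \<Rightarrow> 'e \<Rightarrow> 'e" where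
  "expand a b E x = (let e = E (height a b x); z = planar a b x in
     set_planar a b x (of_real (1 / sqrt (e + 1 - e * (z \<bullet> z))) * z))"

definition shrink_range :: "'e::euclidean_space \<Rightarrow> 'e \<Rightarrow> (real \<Rightarrow> real) \<Rightarrow> 'e set" where
  "shrink_range a b E = {y. E (height a b y) * (planar_sq a b y) < E (height a b y) + 1}"

context
  fixes a b :: "'e::euclidean_space" and E :: "real \<Rightarrow> real"
  assumes ab: "a \<in> Basis" "b \<in> Basis" "a \<noteq> b"
    and E: "smooth_on UNIV E" "\<And>x. E x \<ge> 1"
begin

lemma height_set_planar: "height a b (set_planar a b x z) = height a b x"
  by (simp add: height_def set_planar_set_planar[OF ab])

lemma height_shrink: "height a b (shrink a b E x) = height a b x"
  by (simp add: shrink_def Let_def height_set_planar)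

lemma shrink_inner:
  "planar_sq a b (shrink a b E x) =
    (E (height a b x) + 1) * (planar_sq a b x) / (1 + E (height a b x) * (planar_sq a b x))"
proof -
  have "0 \<le> (E (height a b x) + 1) / (1 + E (height a b x) * (planar_sq a b x))"
    using E(2)[of "height a b x"] by (intro divide_nonneg_nonneg add_nonneg_nonneg mult_nonneg_nonneg) auto
  then show ?thesis
    by (simp add: shrink_def Let_def planar_set_planar[OF ab] dot_square_norm norm_mult power_mult_distrib
        del: real_sqrt_divide)
qed

lemma shrink_den_pos: "1 + E (height a b x) * (planar_sq a b x) > 0"
  using E(2)[of "height a b x"] by (intro add_pos_nonneg mult_nonneg_nonneg) auto

text \<open>The radicand of \<open>expand\<close> at an image point equals the radicand of
  \<open>shrink\<close> at the original point, so the two radial factors cancel.\<close>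

lemma shrink_gap:
  "E (height a b x) + 1 - E (height a b x) * (planar_sq a b (shrink a b E x)) =
    (E (height a b x) + 1) / (1 + E (height a b x) * (planar_sq a b x))"
  unfolding shrink_inner using shrink_den_pos[of x] by (simp add: field_simps)

lemma shrink_gap_pos:
  "E (height a b x) * (planar_sq a b (shrink a b E x)) < E (height a b x) + 1"
proof -
  have "(E (height a b x) + 1) / (1 + E (height a b x) * (planar_sq a b x)) > 0"
    using shrink_den_pos[of x] E(2)[of "height a b x"] by (intro divide_pos_pos) auto
  then show ?thesis using shrink_gap[of x] by linarith
qed

text \<open>The radial transformation is increasing and fixes 1, so thinning does not alter which
  parameters of a handle are mapped into \<open>U\<close>.\<close>

lemma planar_shrink_greater: "cmod (planar a b (shrink a b E x)) > 1 \<longleftrightarrow> cmod (planar a b x) > 1"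
proof -
  have g: "cmod z > 1 \<longleftrightarrow> z \<bullet> z > 1" for z
    by (metis dot_square_norm less_eq_real_def norm_ge_zero not_le one_less_power one_power2 power2_less_imp_less zero_less_numeral power_le_one)
  show ?thesis
    unfolding g shrink_inner using shrink_den_pos[of x] by (simp add: field_simps)
qed

lemma expand_shrink: "expand a b E (shrink a b E x) = x"
proof -
  define k where "k = (E (height a b x) + 1) / (1 + E (height a b x) * (planar_sq a b x))"
  have k: "k > 0"
    unfolding k_def using shrink_den_pos[of x] E(2)[of "height a b x"] by (intro divide_pos_pos) auto
  have p: "planar a b (shrink a b E x) = of_real (sqrt k) * planar a b x"
    by (simp add: shrink_def Let_def planar_set_planar[OF ab] k_def)
  have "expand a b E (shrink a b E x) =
      set_planar a b (shrink a b E x) (of_real (1 / sqrt k) * (of_real (sqrt k) * planar a b x))"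
    unfolding expand_def Let_def height_shrink unfolding shrink_gap k_def[symmetric] unfolding p ..
  also have "of_real (1 / sqrt k) * (of_real (sqrt k) * planar a b x) = planar a b x"
    using k by simp
  finally show ?thesis
    by (simp add: shrink_def Let_def set_planar_set_planar[OF ab])
qed

lemma shrink_expand:
  assumes "y \<in> shrink_range a b E" shows "shrink a b E (expand a b E y) = y"
proof -
  define e k where "e = E (height a b y)" and "k = e + 1 - e * (planar_sq a b y)"
  have k: "k > 0" using assms by (simp add: shrink_range_def e_def k_def)
  have e: "e \<ge> 1" using E(2) by (simp add: e_def)
  have p: "planar a b (expand a b E y) = of_real (1 / sqrt k) * planar a b y"
    by (simp add: expand_def Let_def planar_set_planar[OF ab] k_def e_def)
  have h: "height a b (expand a b E y) = height a b y"
    by (simp add: expand_def Let_def height_set_planar)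
  have "planar_sq a b (expand a b E y) = (planar_sq a b y) / k"
    using k unfolding p by (simp add: dot_square_norm norm_divide norm_mult power_mult_distrib power_divide)
  then have "(e + 1) / (1 + e * (planar_sq a b (expand a b E y))) =
      (e + 1) / (1 + e * ((planar_sq a b y) / k))" by simp
  also have "1 + e * ((planar_sq a b y) / k) = (e + 1) / k"
    using k by (simp add: field_simps) (simp add: k_def)
  finally have "(e + 1) / (1 + e * (planar_sq a b (expand a b E y))) = k"
    using e by simp
  then have "shrink a b E (expand a b E y) =
      set_planar a b (expand a b E y) (of_real (sqrt k) * (of_real (1 / sqrt k) * planar a b y))"
    unfolding shrink_def Let_def h e_def[symmetric] p[symmetric] by simp
  also have "of_real (sqrt k) * (of_real (1 / sqrt k) * planar a b y) = planar a b y"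
    using k by simp
  finally show ?thesis
    by (simp add: expand_def Let_def set_planar_set_planar[OF ab])
qed

lemma range_shrink: "range (shrink a b E) = shrink_range a b E"
proof
  show "range (shrink a b E) \<subseteq> shrink_range a b E"
    using shrink_gap_pos by (auto simp: shrink_range_def height_shrink)
  show "shrink_range a b E \<subseteq> range (shrink a b E)"
    using shrink_expand by (metis rangeI subsetI)
qed

text \<open>Thinning removes points outside of the closed unit disk only, that is, points of
  \<open>U\<close>. The covering of \<open>V\<close> therefore survives.\<close>

lemma in_range_shrink:
  assumes "cmod (planar a b y) \<le> 1" shows "y \<in> range (shrink a b E)"
proof -
  have "planar_sq a b y \<le> 1" using assms by (simp add: dot_square_norm power_le_one)
  then have "E (height a b y) * (planar_sq a b y) \<le> E (height a b y) * 1"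
    using E(2)[of "height a b y"] by (intro mult_left_mono) auto
  then show ?thesis by (simp add: range_shrink shrink_range_def)
qed

lemma smooth_on_height: "smooth_on S f \<Longrightarrow> open S \<Longrightarrow> smooth_on S (\<lambda>x. E (height a b (f x)))"
  unfolding height_def power2_norm_eq_inner
  by (rule smooth_on_compose[OF E(1)]) (auto intro!: smooth_intros)

lemma open_shrink_range: "open (shrink_range a b E)"
proof -
  have "smooth_on UNIV (\<lambda>y. E (height a b y))" by (intro smooth_on_height smooth_intros) auto
  then show ?thesis
    unfolding shrink_range_def
    by (intro open_Collect_less continuous_intros continuous_on_planar smooth_on_imp_continuous_on)
qed

lemma smooth_on_shrink: "smooth_on UNIV (shrink a b E)"
proof -
  have "E y + 1 > 0" for y using E(2)[of y] by linarith
  then show ?thesis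
    unfolding shrink_def Let_def using shrink_den_pos
    by (intro smooth_intros smooth_on_height open_UNIV divide_pos_pos)
       (auto simp: less_imp_neq[THEN not_sym])
qed

lemma smooth_on_expand: "smooth_on (shrink_range a b E) (expand a b E)"
  unfolding expand_def Let_def
  by (intro smooth_intros smooth_on_height open_shrink_range) (auto simp: shrink_range_def)

end

text \<open>Just outside of the unit cylinder, \<open>f\<close> sends a point and its radial
  projection to nearby points. At bounded height compactness makes this uniform: a large
  \<open>e\<close> keeps the square of the planar radius below \<open>1 + 1 / e\<close>, too close
  to 1 for a distance of \<open>\<eta>\<close>.\<close>

lemma collar_bound:
  fixes f :: "'e::euclidean_space \<Rightarrow> 'b"
  assumes X: "Metric_space M d" and f: "continuous_map euclidean (Metric_space.mtopology M d) f"
    and ab: "a \<in> Basis" "b \<in> Basis" "a \<noteq> b" and eta: "\<eta> > 0"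
  obtains B :: real where "\<And>e x. e \<ge> 1 \<Longrightarrow> e \<ge> B \<Longrightarrow> height a b x \<le> m \<Longrightarrow> cmod (planar a b x) \<ge> 1 \<Longrightarrow>
      e * (planar_sq a b x) < e + 1 \<Longrightarrow>
      d (f x) (f (set_planar a b x (planar a b x / of_real (cmod (planar a b x))))) < \<eta>"
proof -
  interpret Metric_space M d by (rule X)
  define hat where "hat x = set_planar a b x (planar a b x / of_real (cmod (planar a b x)))" for x
  define S where "S = {x. cmod (planar a b x) \<ge> 1}"
  define g where "g x = d (f x) (f (hat x))" for x
  have hat: "continuous_on S hat"
    unfolding hat_def S_def
    by (intro continuous_on_set_planar continuous_intros continuous_on_planar) auto
  have "continuous_map (top_of_set S) euclidean hat" using hat by simp
  then have 1: "continuous_map (top_of_set S) mtopology (f \<circ> hat)" using f by (rule continuous_map_compose)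
  have 2: "continuous_map (top_of_set S) mtopology f" using f by (rule continuous_map_from_subtopology)
  have "continuous_map (top_of_set S) euclidean (\<lambda>x. mdist (metric (M, d)) (f x) ((f \<circ> hat) x))"
    by (rule continuous_map_mdist) (use 1 2 in \<open>simp_all add: comp_def\<close>)
  then have g: "continuous_on S g" by (simp add: g_def[abs_def])
  have S: "closed S"
    unfolding S_def by (intro closed_Collect_le continuous_intros continuous_on_planar)
  \<comment> \<open>The points sent too far from their projections. They form a compact set that
    misses the unit cylinder, so the squares of their planar radii are bounded below by some
    \<open>c > 1\<close>.\<close>
  define K where "K = {x \<in> S. g x \<ge> \<eta>} \<inter> {x. cmod (planar a b x) \<le> 2 \<and> height a b x \<le> m}"
  have "closed (S \<inter> g -` {\<eta>..})" by (intro continuous_closed_preimage g S) auto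
  moreover have "K = (S \<inter> g -` {\<eta>..}) \<inter> {x. cmod (planar a b x) \<le> 2 \<and> height a b x \<le> m}"
    by (auto simp: K_def)
  ultimately have K: "compact K"
    using closed_Int_compact[OF _ compact_handle_part[OF ab(1,2)]] by simp
  have sq: "planar_sq a b x = (cmod (planar a b x))\<^sup>2" for x by (simp add: dot_square_norm)
  have K1: "planar_sq a b x > 1" if "x \<in> K" for x
  proof -
    have "cmod (planar a b x) \<noteq> 1"
    proof
      assume "cmod (planar a b x) = 1"
      then have "hat x = x" by (simp add: hat_def)
      moreover have "f x \<in> M" using continuous_map_image_subset_topspace[OF f] by auto
      ultimately have "g x = 0" by (simp add: g_def)
      then show False using that eta by (simp add: K_def)
    qed
    then have "cmod (planar a b x) > 1" using that by (simp add: K_def S_def)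
    then show ?thesis unfolding sq by (simp add: one_less_power)
  qed
  \<comment> \<open>\<open>e \<ge> 1\<close> keeps the collar within planar radius 2, hence in the
    compact piece from which \<open>K\<close> is cut.\<close>
  have small: "cmod (planar a b x) \<le> 2" if "e \<ge> 1" "e * (planar_sq a b x) < e + 1" for e x
  proof -
    have "planar_sq a b x \<le> 2\<^sup>2"
    proof (rule ccontr)
      assume "\<not> ?thesis"
      then have "e * 4 \<le> e * (planar_sq a b x)" using that by (intro mult_left_mono) auto
      then show False using that by linarith
    qed
    then show ?thesis unfolding sq using power2_le_imp_le[of "cmod (planar a b x)" 2] by simp
  qed
  obtain c where c: "c > 1" "\<And>x. x \<in> K \<Longrightarrow> planar_sq a b x \<ge> c"
  proof (cases "K = {}")
    case True
    then show ?thesis using that[of 2] by simp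
  next
    case False
    have "continuous_on K (\<lambda>x. planar_sq a b x)"
      by (intro continuous_intros continuous_on_planar)
    then obtain x where "x \<in> K" "\<forall>y\<in>K. planar_sq a b x \<le> planar_sq a b y"
      using continuous_attains_inf[OF K False] by blast
    then show ?thesis using that[of "planar_sq a b x"] K1 by blast
  qed
  show ?thesis
  \<comment> \<open>For such \<open>e\<close> the bound \<open>1 + 1 / e\<close> is at most
    \<open>c\<close>.\<close>
  proof (rule that[of "1 / (c - 1)"])
    fix e x assume e: "1 \<le> e" "1 / (c - 1) \<le> e" and x: "height a b x \<le> m" "1 \<le> cmod (planar a b x)"
      "e * (planar_sq a b x) < e + 1"
    have "x \<notin> K"
    proof
      assume "x \<in> K"
      then have "e * c \<le> e * (planar_sq a b x)" using c(2) e by (intro mult_left_mono) auto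
      moreover have "1 \<le> e * (c - 1)" using e(2) c(1) by (simp add: field_simps)
      ultimately show False using x(3) by (simp add: algebra_simps)
    qed
    then show "d (f x) (f (set_planar a b x (planar a b x / of_real (cmod (planar a b x))))) < \<eta>"
      using x small[OF e(1) x(3)] by (simp add: K_def S_def g_def hat_def)
  qed
qed

text \<open>The union could fail to be closed by accumulation along infinitely many handles or along
  unbounded heights. Once the handles are thin, its points in \<open>W\<close> approach the
  complement of \<open>W\<close> as the number of the handle or the height grows, so a small ball
  around a point of \<open>W\<close> meets only finitely many compact pieces.\<close>

lemma shrink_handles:
  fixes f :: "nat \<Rightarrow> 'e::euclidean_space \<Rightarrow> 'b"
  assumes X: "metrizable_space X"
    and f: "\<And>h. h \<in> I \<Longrightarrow> continuous_map euclidean X (f h)"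
    and ab: "\<And>h. h \<in> I \<Longrightarrow> a h \<in> Basis" "\<And>h. h \<in> I \<Longrightarrow> b h \<in> Basis" "\<And>h. h \<in> I \<Longrightarrow> a h \<noteq> b h"
    and W: "openin X W"
    and f_W: "\<And>h x. h \<in> I \<Longrightarrow> f h x \<in> W \<longleftrightarrow> cmod (planar (a h) (b h) x) > 1"
    and cover: "\<And>v. v \<in> topspace X \<Longrightarrow> v \<in> W \<or> (\<exists>h\<in>I. v \<in> range (f h))"
  obtains E :: "nat \<Rightarrow> real \<Rightarrow> real" where "\<And>h. smooth_on UNIV (E h)" "\<And>h x. E h x \<ge> 1"
    "closedin X (\<Union>h\<in>I. (\<lambda>x. f h (shrink (a h) (b h) (E h) x)) ` {x. cmod (planar (a h) (b h) x) \<le> 2})"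
proof -
  obtain M d where Md: "Metric_space M d" and XM: "X = Metric_space.mtopology M d"
    using X unfolding metrizable_space_def by blast
  interpret Metric_space M d by (rule Md)
  define hat where "hat h x = set_planar (a h) (b h) x
    (planar (a h) (b h) x / of_real (cmod (planar (a h) (b h) x)))" for h x
  \<comment> \<open>The tolerance tends to 0 with the number of the handle as well as with the
    height. All of these countably many bounds for one handle are then dominated by one smooth
    function of the height.\<close>
  have "\<exists>B :: real. \<forall>e x. e \<ge> 1 \<longrightarrow> e \<ge> B \<longrightarrow> height (a h) (b h) x \<le> real m + 1 \<longrightarrow>
      cmod (planar (a h) (b h) x) \<ge> 1 \<longrightarrow>
      e * (planar_sq (a h) (b h) x) < e + 1 \<longrightarrow>
      d (f h x) (f h (hat h x)) < 1 / (real h + real m + 1)" if h: "h \<in> I" for h m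
  proof -
    have "1 / (real h + real m + 1) > 0" by (simp add: add_nonneg_pos)
    from collar_bound[OF Md f[OF h, unfolded XM] ab[OF h] this, of "real m + 1"]
    show ?thesis unfolding hat_def by metis
  qed
  then obtain B :: "nat \<Rightarrow> nat \<Rightarrow> real" where B: "\<And>h m e x. h \<in> I \<Longrightarrow> e \<ge> 1 \<Longrightarrow> e \<ge> B h m \<Longrightarrow>
      height (a h) (b h) x \<le> real m + 1 \<Longrightarrow> cmod (planar (a h) (b h) x) \<ge> 1 \<Longrightarrow>
      e * (planar_sq (a h) (b h) x) < e + 1 \<Longrightarrow>
      d (f h x) (f h (hat h x)) < 1 / (real h + real m + 1)"
    by metis
  have "\<exists>E. smooth_on UNIV E \<and> (\<forall>x. E x \<ge> (1::real)) \<and> (\<forall>m x. real m \<le> x \<longrightarrow> B h m \<le> E x)" for h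
    using smooth_majorant[of "B h"] by metis
  then obtain E :: "nat \<Rightarrow> real \<Rightarrow> real" where E: "\<And>h. smooth_on UNIV (E h)" "\<And>h x. E h x \<ge> 1"
    "\<And>h m x. real m \<le> x \<Longrightarrow> B h m \<le> E h x" by metis
  define J where "J h x = f h (shrink (a h) (b h) (E h) x)" for h x
  define Z where "Z = (\<Union>h\<in>I. J h ` {x. cmod (planar (a h) (b h) x) \<le> 2})"
  have JW: "J h x \<in> W \<longleftrightarrow> cmod (planar (a h) (b h) x) > 1" if "h \<in> I" for h x
    unfolding J_def f_W[OF that] using planar_shrink_greater[OF ab[OF that] E(1,2)] .
  have JM: "J h x \<in> M" if "h \<in> I" for h x
    using continuous_map_image_subset_topspace[OF f[OF that]] by (auto simp: J_def XM)
  have contJ: "continuous_map euclidean X (J h)" if h: "h \<in> I" for h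
  proof -
    have "continuous_map euclidean euclidean (shrink (a h) (b h) (E h))"
      using smooth_on_imp_continuous_on[OF smooth_on_shrink[OF ab[OF h] E(1,2)]] by simp
    then have "continuous_map euclidean X (f h \<circ> shrink (a h) (b h) (E h))"
      using f[OF h] by (rule continuous_map_compose)
    then show ?thesis by (simp add: J_def[abs_def] comp_def)
  qed
  \<comment> \<open>The witness is the image of the radial projection to the unit cylinder, which is
    not mapped into \<open>W\<close>.\<close>
  have near: "\<exists>w\<in>M - W. \<exists>m. d (J h x) w < 1 / (real h + real m + 1) \<and> height (a h) (b h) x \<le> real m + 1"
    if h: "h \<in> I" and x: "cmod (planar (a h) (b h) x) > 1" for h x
  proof -
    define y where "y = shrink (a h) (b h) (E h) x"
    have hy: "height (a h) (b h) y = height (a h) (b h) x"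
      unfolding y_def by (rule height_shrink[OF ab[OF h] E(1,2)])
    have y1: "cmod (planar (a h) (b h) y) > 1"
      unfolding y_def using planar_shrink_greater[OF ab[OF h] E(1,2)] x by blast
    \<comment> \<open>The majorant dominates \<open>B h m\<close> from height \<open>m\<close> on,
      while \<open>B h m\<close> serves heights up to \<open>m + 1\<close>; rounding down meets both
      conditions.\<close>
    define m where "m = nat \<lfloor>height (a h) (b h) x\<rfloor>"
    have "height (a h) (b h) x \<ge> 0" by (simp add: height_def)
    then have m: "real m \<le> height (a h) (b h) x" "height (a h) (b h) x \<le> real m + 1"
      unfolding m_def by linarith+
    have "d (f h y) (f h (hat h y)) < 1 / (real h + real m + 1)"
      using shrink_gap_pos[OF ab[OF h] E(1,2), of h x] y1 m E
      by (intro B[OF h, of "E h (height (a h) (b h) x)"]) (simp_all add: hy, simp add: y_def)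
    moreover have "f h (hat h y) \<notin> W"
    proof -
      have "cmod (planar (a h) (b h) (hat h y)) = 1"
        using y1 by (auto simp: hat_def planar_set_planar[OF ab[OF h]] norm_divide)
      then show ?thesis using f_W[OF h] by simp
    qed
    moreover have "f h (hat h y) \<in> M"
      using continuous_map_image_subset_topspace[OF f[OF h]] by (auto simp: XM)
    ultimately show ?thesis using m by (auto simp: J_def y_def)
  qed
  have "closedin X Z"
    unfolding closedin_def
  proof
    show "Z \<subseteq> topspace X" using JM by (auto simp: Z_def XM)
    show "openin X (topspace X - Z)"
    proof (subst openin_subopen, clarify)
      fix v assume v: "v \<in> topspace X" "v \<notin> Z"
      \<comment> \<open>The complement of \<open>W\<close> is covered by the handle parts of planar
        radius at most 1, which survive the thinning and belong to \<open>Z\<close>.\<close>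
      have vW: "v \<in> W"
      proof (rule ccontr)
        assume nW: "v \<notin> W"
        then obtain h y where h: "h \<in> I" "v = f h y" using cover[OF v(1)] by auto
        have y1: "cmod (planar (a h) (b h) y) \<le> 1" using f_W[OF h(1)] nW h by (simp add: not_less)
        then obtain x where x: "y = shrink (a h) (b h) (E h) x"
          using in_range_shrink[OF ab[OF h(1)] E(1,2)] by blast
        then have "cmod (planar (a h) (b h) x) \<le> 1"
          using y1 planar_shrink_greater[OF ab[OF h(1)] E(1,2), of h x] by (simp add: not_less[symmetric])
        then show False using v(2) h x by (force simp: Z_def J_def)
      qed
      \<comment> \<open>Doubling the radius leaves room for the triangle inequality: from the ball
        of radius \<open>r\<close>, the complement of \<open>W\<close> is more than \<open>r\<close>
        away.\<close>
      obtain r where r: "r > 0" "mball v (2 * r) \<subseteq> W"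
      proof -
        obtain s where "s > 0" "mball v s \<subseteq> W" using W vW unfolding XM openin_mtopology by blast
        then show ?thesis using that[of "s / 2"] by simp
      qed
      obtain N where N: "1 / r < real N" using reals_Archimedean2 by blast
      \<comment> \<open>By the choice of \<open>N\<close>, all of \<open>Z\<close> that meets the
        ball of radius \<open>r\<close> lies in this finite union of compact sets.\<close>
      define F where "F = (\<Union>h\<in>I \<inter> {..N}. J h ` {x. cmod (planar (a h) (b h) x) \<le> 2 \<and> height (a h) (b h) x \<le> real N + 1})"
      have "closedin X (J h ` {x. cmod (planar (a h) (b h) x) \<le> 2 \<and> height (a h) (b h) x \<le> real N + 1})" if h: "h \<in> I" for h
      proof (rule compactin_imp_closedin[OF metrizable_imp_Hausdorff_space[OF X]])
        show "compactin X (J h ` {x. cmod (planar (a h) (b h) x) \<le> 2 \<and> height (a h) (b h) x \<le> real N + 1})"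
          by (rule image_compactin[OF _ contJ[OF h]]) (simp add: compact_handle_part[OF ab(1,2)[OF h]])
      qed
      then have F: "closedin X F" unfolding F_def by (intro closedin_Union) auto
      have "F \<subseteq> Z" by (auto simp: F_def Z_def)
      have "mball v r - F \<subseteq> topspace X - Z"
      proof
        fix w assume w: "w \<in> mball v r - F"
        show "w \<in> topspace X - Z"
        proof (rule ccontr)
          assume "w \<notin> topspace X - Z"
          then have "w \<in> Z" using w by (auto simp: XM)
          then obtain h x where h: "h \<in> I" "w = J h x" "cmod (planar (a h) (b h) x) \<le> 2" by (auto simp: Z_def)
          have "mball v r \<subseteq> mball v (2 * r)" using r by (intro mball_subset_concentric) auto
          then have "w \<in> W" using w r by auto
          then have "cmod (planar (a h) (b h) x) > 1" using JW h by auto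
          then obtain u m where u: "u \<in> M - W" "d w u < 1 / (real h + real m + 1)"
            and m: "height (a h) (b h) x \<le> real m + 1" using near[OF h(1)] h(2) by blast
          have "u \<notin> mball v (2 * r)" using u r by auto
          then have "d v u \<ge> 2 * r" using u v by (auto simp: XM)
          moreover have "d v w < r" using w by auto
          moreover have "d v u \<le> d v w + d w u" using u v w by (intro triangle) (auto simp: XM)
          ultimately have "r < 1 / (real h + real m + 1)" using u by linarith
          then have "real h + real m + 1 < 1 / r"
            using r(1) by (simp add: field_simps add_nonneg_pos)
          then have "h \<le> N" "m \<le> N" using N by linarith+
          then have "w \<in> F" using h m by (force simp: F_def)
          then show False using w by simp
        qed
      qed
      moreover have "openin X (mball v r - F)" using F by (intro openin_diff) (auto simp: XM)
      moreover have "v \<in> mball v r - F" using r v \<open>F \<subseteq> Z\<close> by (auto simp: XM)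
      ultimately show "\<exists>T. openin X T \<and> v \<in> T \<and> T \<subseteq> topspace X - Z" by blast
    qed
  qed
  then show ?thesis
    using that[of E] E by (simp add: Z_def J_def)
qed

section \<open>From a handle layer to the gluing data\<close>

lemma immersion_copies_component:
  fixes V :: "('b, 'e::euclidean_space) mfd" and j :: "'i \<times> 'e \<Rightarrow> 'b"
  assumes j: "immersion (copies_mfd I) V j" and h: "h \<in> I"
  shows "immersion euclidean_mfd V (\<lambda>x. j (h, x))"
proof -
  have at: "({h} \<times> UNIV, snd) \<in> atlas (copies_mfd I :: ('i \<times> 'e, 'e) mfd)"
    using h by (auto simp: copies_mfd_def)
  have inv: "inv_into ({h} \<times> UNIV) snd = Pair h"
    by (rule ext, rule inv_into_f_eq) (auto simp: inj_on_def)
  have img: "snd ` ({h} \<times> UNIV \<inter> j -` D) = (\<lambda>x. j (h, x)) -` D" for D by force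
  have "continuous_map euclidean (mtop V) (j \<circ> Pair h)"
    using j continuous_map_component_injection[OF h]
    by (intro continuous_map_compose[of _ "mtop (copies_mfd I)"])
       (auto simp: immersion_def smooth_map_def copies_mfd_def)
  moreover have "smooth_on ((\<lambda>x. j (h, x)) -` D) (c \<circ> (\<lambda>x. j (h, x)))" if "(D, c) \<in> atlas V" for D c
  proof -
    have "\<forall>(D', c')\<in>atlas (copies_mfd I). \<forall>(D, c)\<in>atlas V.
        smooth_on (c' ` (D' \<inter> j -` D)) (c \<circ> j \<circ> inv_into D' c')"
      using j unfolding immersion_def smooth_map_def by (elim conjE)
    from bspec[OF bspec[OF this at, unfolded prod.case] that] show ?thesis
      by (simp add: inv img comp_def)
  qed
  moreover have "inj (frechet_derivative (c \<circ> (\<lambda>x. j (h, x))) (at x))"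
    if "(D, c) \<in> atlas V" "j (h, x) \<in> D" for D c x
  proof -
    have "\<forall>(D', c')\<in>atlas (copies_mfd I). \<forall>(D, c)\<in>atlas V. \<forall>p\<in>D'. j p \<in> D \<longrightarrow>
        inj (chart_derivative D' c' c j p)"
      using j unfolding immersion_def by (elim conjE)
    from bspec[OF bspec[OF this at, unfolded prod.case] that(1)]
    have "inj (chart_derivative ({h} \<times> UNIV) snd c j (h, x))" using that(2) by simp
    then show ?thesis by (simp add: chart_derivative_def inv comp_def)
  qed
  ultimately show ?thesis
    by (auto simp: immersion_def smooth_map_def chart_derivative_def euclidean_mfd_def comp_def inv_id)
qed

text \<open>The two basis vectors in \<open>K h\<close> provide the planar coordinates, and each
  component of \<open>j\<close> is composed with a radial \<open>shrink\<close>. This preserves the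
  attaching condition and the covering, and gains the closedness which the gluing relies on.\<close>

lemma handles_exist:
  fixes U :: "('a, 'e::euclidean_space) mfd" and V :: "('b, 'e) mfd"
  assumes UM: "smooth_manifold U" and VM: "smooth_manifold V"
    and att: "attaching_handles_at_infinity 2 U V i"
  obtains ii I a b J G where "handles U V i ii I a b J G"
proof -
  have U: "smooth_atlas U" and V: "smooth_atlas V" and metr: "metrizable_space (mtop V)"
    using UM VM by (auto simp: smooth_manifold_def)
  obtain I K j where hl: "handle_layer U V i I K j" and card: "\<And>h. h \<in> I \<Longrightarrow> card (K h) = 2"
    using att by (auto simp: attaching_handles_at_infinity_def)
  have "\<exists>a b. a \<in> Basis \<and> b \<in> Basis \<and> a \<noteq> b \<and> K h = {a, b}" if h: "h \<in> I" for h
  proof -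
    obtain a b where "K h = {a, b}" "a \<noteq> b" using card[OF h] by (auto simp: card_2_iff)
    moreover have "K h \<subseteq> Basis" using hl h by (auto simp: handle_layer_def)
    ultimately show ?thesis by blast
  qed
  then obtain a b where ab: "\<And>h. h \<in> I \<Longrightarrow> a h \<in> Basis" "\<And>h. h \<in> I \<Longrightarrow> b h \<in> Basis" "\<And>h. h \<in> I \<Longrightarrow> a h \<noteq> b h"
    and K: "\<And>h. h \<in> I \<Longrightarrow> K h = {a h, b h}" by metis
  have imm: "immersion U V i" "inj_on i (points U)" "immersion (copies_mfd I) V j" "inj_on j (I \<times> UNIV)"
    and cov: "i ` points U \<union> j ` (I \<times> UNIV) = points V"
    and jU: "{p \<in> I \<times> UNIV. j p \<in> i ` points U} = (SIGMA h:I. handle_end (K h))"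
    using hl by (auto simp: handle_layer_def smooth_embedding_def copies_mfd_def)
  have i: "smooth_at U V i u" if "u \<in> points U" for u
    using imm(1) that smooth_map_iff_smooth_at[OF U V] by (auto simp: immersion_def)
  define f where "f h x = j (h, x)" for h x
  define g where "g h = inv (f h)" for h
  have fi: "immersion euclidean_mfd V (f h)" and inj: "inj_on (f h) (points euclidean_mfd)" if "h \<in> I" for h
    using immersion_copies_component[OF imm(3) that] imm(4) that by (auto simp: f_def[abs_def] inj_on_def)
  have gf: "g h (f h x) = x" if "h \<in> I" for h x
    using inj[OF that] by (simp add: g_def)
  have f: "smooth_at euclidean_mfd V (f h) x" if "h \<in> I" for h x
    using fi[OF that] smooth_map_iff_smooth_at[OF smooth_atlas_euclidean V] by (auto simp: immersion_def)
  have g: "smooth_at V euclidean_mfd (g h) (f h x)" if h: "h \<in> I" for h x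
    using immersion_inverse_smooth(2)[OF _ V fi[OF h] inj[OF h], of x] by (simp add: g_def)
  have f_cont: "continuous_map euclidean (mtop V) (f h)" if "h \<in> I" for h
  proof -
    have "smooth_map euclidean_mfd V (f h)"
      using f[OF that] smooth_map_iff_smooth_at[OF smooth_atlas_euclidean V] by blast
    then show ?thesis by (simp add: smooth_map_def)
  qed
  have norm_eq: "norm (\<Sum>k\<in>K h. (x \<bullet> k) *\<^sub>R k) = cmod (planar (a h) (b h) x)" if h: "h \<in> I" for h x
  proof -
    have "(norm (\<Sum>k\<in>K h. (x \<bullet> k) *\<^sub>R k))\<^sup>2 = (x \<bullet> a h)\<^sup>2 + (x \<bullet> b h)\<^sup>2"
      using ab[OF h] unfolding power2_norm_eq_inner
      by (simp add: K[OF h] inner_add_left inner_add_right inner_Basis power2_eq_square)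
    then show ?thesis
      by (simp add: planar_def cmod_def real_sqrt_unique[symmetric])
  qed
  have f_U: "f h x \<in> i ` points U \<longleftrightarrow> cmod (planar (a h) (b h) x) > 1" if h: "h \<in> I" for h x
  proof -
    have "f h x \<in> i ` points U \<longleftrightarrow> (h, x) \<in> {p \<in> I \<times> UNIV. j p \<in> i ` points U}"
      using h by (simp add: f_def)
    also have "\<dots> \<longleftrightarrow> norm (\<Sum>k\<in>K h. (x \<bullet> k) *\<^sub>R k) > 1"
      unfolding jU using h by (simp add: handle_end_def)
    finally show ?thesis unfolding norm_eq[OF h] .
  qed
  have open_i: "openin (mtop V) (i ` points U)" by (rule immersion_inverse_smooth(1)[OF U V imm(1,2)])
  have cover: "v \<in> i ` points U \<or> (\<exists>h\<in>I. v \<in> range (f h))" if "v \<in> points V" for v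
    using that cov unfolding f_def by fastforce
  obtain E :: "nat \<Rightarrow> real \<Rightarrow> real" where E: "\<And>h. smooth_on UNIV (E h)" "\<And>h x. E h x \<ge> 1"
    and cl: "closedin (mtop V) (\<Union>h\<in>I. (\<lambda>x. f h (shrink (a h) (b h) (E h) x)) ` {x. cmod (planar (a h) (b h) x) \<le> 2})"
    using shrink_handles[where X = "mtop V" and W = "i ` points U" and f = f and I = I and a = a and b = b,
        OF metr f_cont ab open_i f_U cover] by blast
  define J where "J h x = f h (shrink (a h) (b h) (E h) x)" for h x
  define G where "G h v = expand (a h) (b h) (E h) (g h v)" for h v
  have GJ: "G h (J h x) = x" if "h \<in> I" for h x
    unfolding G_def J_def gf[OF that] by (rule expand_shrink[OF ab[OF that] E])
  have open_f: "openin (mtop V) (range (f h))" if h: "h \<in> I" for h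
    using immersion_inverse_smooth(1)[OF _ V fi[OF h] inj[OF h]] by simp
  have "handles U V i (inv_into (points U) i) I a b J G"
  proof
    show "smooth_atlas U" "smooth_manifold V" by (rule U, rule VM)
    show "smooth_at U V i u" if "u \<in> points U" for u by (rule i[OF that])
    show "inv_into (points U) i (i u) = u" if "u \<in> points U" for u using imm(2) that by simp
    show "openin (mtop V) (i ` points U)" by (rule open_i)
    show "smooth_at V U (inv_into (points U) i) (i u)" if "u \<in> points U" for u
      by (rule immersion_inverse_smooth(2)[OF U V imm(1,2) that])
    show "h \<in> I \<Longrightarrow> a h \<in> Basis" "h \<in> I \<Longrightarrow> b h \<in> Basis" "h \<in> I \<Longrightarrow> a h \<noteq> b h" for h
      by (rule ab; assumption)+
    show "smooth_at euclidean_mfd V (J h) x" if h: "h \<in> I" for h x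
      unfolding J_def[abs_def]
      by (rule smooth_at_compose[OF smooth_atlas_euclidean smooth_atlas_euclidean V f[OF h]])
         (rule smooth_at_euclidean[OF open_UNIV UNIV_I smooth_on_shrink[OF ab[OF h] E]])
    show "G h (J h x) = x" if "h \<in> I" for h x by (rule GJ[OF that])
    show "openin (mtop V) (range (J h))" if h: "h \<in> I" for h
    proof -
      have "openin (mtop V) {v \<in> range (f h). g h v \<in> shrink_range (a h) (b h) (E h)}"
        by (rule openin_preimage_smooth[OF V smooth_atlas_euclidean open_f[OF h]])
           (use g[OF h] open_shrink_range[OF ab[OF h] E] in auto)
      moreover have "{v \<in> range (f h). g h v \<in> shrink_range (a h) (b h) (E h)} = range (J h)"
        using gf[OF h] unfolding range_shrink[OF ab[OF h] E, symmetric] by (auto simp: J_def)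
      ultimately show ?thesis by simp
    qed
    show "smooth_at V euclidean_mfd (G h) (J h x)" if h: "h \<in> I" for h x
      unfolding G_def[abs_def]
    proof (rule smooth_at_compose_smooth_on[OF V _ smooth_on_expand[OF ab[OF h] E] open_shrink_range[OF ab[OF h] E]])
      show "smooth_at V euclidean_mfd (g h) (J h x)" unfolding J_def by (rule g[OF h])
      show "g h (J h x) \<in> shrink_range (a h) (b h) (E h)"
        unfolding J_def gf[OF h] range_shrink[OF ab[OF h] E, symmetric] by simp
    qed
    show "h = h'" if "h \<in> I" "h' \<in> I" "J h x = J h' x'" for h h' x x'
      using that imm(4) by (auto simp: J_def f_def inj_on_def)
    show "v \<in> i ` points U \<or> (\<exists>h\<in>I. v \<in> range (J h))" if v: "v \<in> points V" for v
    proof (cases "v \<in> i ` points U")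
      case False
      then obtain h y where h: "h \<in> I" "v = f h y" using cover[OF v] by auto
      have "cmod (planar (a h) (b h) y) \<le> 1" using f_U[OF h(1)] False h by (simp add: not_less)
      then have "y \<in> range (shrink (a h) (b h) (E h))"
        by (rule in_range_shrink[OF ab[OF h(1)] E])
      then show ?thesis using h by (auto simp: J_def)
    qed simp
    show "J h x \<in> i ` points U \<longleftrightarrow> cmod (planar (a h) (b h) x) > 1" if h: "h \<in> I" for h x
      unfolding J_def f_U[OF h] by (rule planar_shrink_greater[OF ab[OF h] E])
    show "closedin (mtop V) (\<Union>h\<in>I. J h ` {x. cmod (planar (a h) (b h) x) \<le> 2})"
      using cl by (simp add: J_def[abs_def])
  qed
  then show ?thesis by (rule that)
qed

theorem theorem2p3:
  fixes U :: "('a, 'e::euclidean_space) mfd"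
    and V :: "('b, 'e) mfd"
    and i :: "'a \<Rightarrow> 'b"
  assumes "smooth_manifold U"
    and "smooth_manifold V"
    and "attaching_handles_at_infinity 2 U V i"
  shows "\<exists>\<phi> q. smooth_flow (U \<times>\<^sub>M real_line) \<phi> \<and>
           fixed_point_free (U \<times>\<^sub>M real_line) \<phi> \<and>
           has_quotient (U \<times>\<^sub>M real_line) \<phi> V q \<and>
           homotopy_equivalent_maps (mtop (U \<times>\<^sub>M real_line)) (mtop V) q (mtop U) (mtop V) i"
proof -
  obtain ii I a b J G where "handles U V i ii I a b J G"
    using handles_exist[OF assms] .
  then show ?thesis by (rule handles.flow_exists)
qed

end
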